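(* Let $K$ be an algebraically closed field. For all positive integers $r$ and $k$, the pfaffian jet variety $\mathcal{P}^{2r+1,k}_r$ is irreducible of codimension $3k$ (in the affine space $\mathbb{A}_K^{(2r+1)rk}$).
   Context: Let $K$ be an algebraically closed field and $n,k,r$ positive integers with $2r\le n$. Let $A^{n,k}=K[x_{ij}^{(h)} : 1\le i<j\le n,\ h=0,\ldots,k-1]$, a polynomial ring in $kn(n-1)/2$ variables. Let $t$ be a further indeterminate and let $X(t)$ be the $n\times n$ skew-symmetric matrix (zero diagonal) with entries $x_{ij}(t)=x_{ij}^{(0)}+x_{ij}^{(1)}t+\cdots+x_{ij}^{(k-1)}t^{k-1}$ for $i<j$ and $x_{ji}(t)=-x_{ij}(t)$. A $2r$-pfaffian of $X(t)$ is the pfaffian of a submatrix of $X(t)$ with rows and columns $a_1<\cdots<a_{2r}$. Write a $2r$-pfaffian as $p=\sum_{h\ge 0}p^{(h)}t^h$ with $p^{(h)}\in A^{n,k}$. The pfaffian jet ideal $I^{n,k}_r\subseteq A^{n,k}$ is the ideal generated by $p^{(h)}$ for all $2r$-pfaffians $p$ of $X(t)$ and all $h=0,\ldots,k-1$. The pfaffian jet variety is the zero locus $\mathcal{P}^{n,k}_r=\mathbb{V}(I^{n,k}_r)\subseteq\mathbb{A}_K^{kn(n-1)/2}$. *)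

theory Defs
  imports
    "HOL-Library.Poly_Mapping"
    "HOL-Library.Extended_Nat"
    "HOL-Computational_Algebra.Polynomial"
    "HOL-Combinatorics.Permutations"
    "HOL-Algebra.Ideal"
    "HOL-Analysis.Abstract_Topology"
begin

section \<open>Polynomial rings in a given set of variables\<close>

text \<open>
  A polynomial is a finitely supported map from monomials to coefficients, and a monomial is a
  finitely supported map from variables to exponents. The multiplication of \<^typ>\<open>'b \<Rightarrow>\<^sub>0 'c\<close> is
  convolution, so this is the usual polynomial ring over all variables of type \<^typ>\<open>'v\<close>. The
  number of variables is not fixed by a type, so the ring in the variables \<open>V\<close> is a record with
  an explicit carrier.
\<close>

type_synonym ('v, 'a) mpoly = "('v \<Rightarrow>\<^sub>0 nat) \<Rightarrow>\<^sub>0 'a"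

definition mvar :: "'v \<Rightarrow> ('v, 'a::comm_ring_1) mpoly" where
  "mvar v = Poly_Mapping.single (Poly_Mapping.single v 1) 1"

definition mpoly_ring :: "'v set \<Rightarrow> ('v, 'a::comm_ring_1) mpoly ring" where
  "mpoly_ring V =
     \<lparr>carrier = {p. \<forall>m \<in> Poly_Mapping.keys p. Poly_Mapping.keys m \<subseteq> V},
      monoid.mult = (*), one = 1, zero = 0, add = (+)\<rparr>"

definition eval_mpoly :: "('v \<Rightarrow> 'a::comm_ring_1) \<Rightarrow> ('v, 'a) mpoly \<Rightarrow> 'a" where
  "eval_mpoly x p = (\<Sum>m \<in> Poly_Mapping.keys p.
     Poly_Mapping.lookup p m * (\<Prod>v \<in> Poly_Mapping.keys m. x v ^ Poly_Mapping.lookup m v))"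

lemma eval_mpoly_0 [simp]: "eval_mpoly x 0 = 0"
  by (simp add: eval_mpoly_def)

lemma eval_mpoly_1 [simp]: "eval_mpoly x 1 = 1"
  by (simp add: eval_mpoly_def lookup_one)

lemma eval_mpoly_add: "eval_mpoly x (p + q) = eval_mpoly x p + eval_mpoly x q"
  unfolding eval_mpoly_def by (rule setsum_keys_plus_distrib) (simp_all add: distrib_right)

lemma eval_mpoly_single:
  "eval_mpoly x (Poly_Mapping.single m c) =
     c * (\<Prod>v \<in> Poly_Mapping.keys m. x v ^ Poly_Mapping.lookup m v)"
  by (simp add: eval_mpoly_def)

lemma eval_mpoly_mvar [simp]: "eval_mpoly x (mvar v) = x v"
  by (simp add: mvar_def eval_mpoly_single)

lemma mpoly_induct [case_names single add]:
  fixes p :: "'b \<Rightarrow>\<^sub>0 'c::comm_monoid_add"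
  assumes single: "\<And>m c. P (Poly_Mapping.single m c)"
    and add: "\<And>p q. P p \<Longrightarrow> P q \<Longrightarrow> P (p + q)"
  shows "P p"
proof (induction p rule: update_induct)
  case const
  then show ?case using single[of undefined 0] by simp
next
  case (update f a b)
  have "Poly_Mapping.update a b f = f + Poly_Mapping.single a b"
    using update.hyps
    by (intro poly_mapping_eqI)
      (auto simp: lookup_update lookup_add lookup_single in_keys_iff when_def)
  then show ?case using add[OF update.IH single] by simp
qed

lemma prod_powers_add:
  fixes x :: "'v \<Rightarrow> 'a::comm_ring_1"
  shows "(\<Prod>v \<in> Poly_Mapping.keys (m + m'). x v ^ Poly_Mapping.lookup (m + m') v) =
    (\<Prod>v \<in> Poly_Mapping.keys m. x v ^ Poly_Mapping.lookup m v) *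
    (\<Prod>v \<in> Poly_Mapping.keys m'. x v ^ Poly_Mapping.lookup m' v)"
proof -
  let ?A = "Poly_Mapping.keys m \<union> Poly_Mapping.keys m'"
  have *: "(\<Prod>v \<in> Poly_Mapping.keys n. x v ^ Poly_Mapping.lookup n v) =
      (\<Prod>v \<in> ?A. x v ^ Poly_Mapping.lookup n v)"
    if "Poly_Mapping.keys n \<subseteq> ?A" for n
    using that by (intro prod.mono_neutral_left) (auto simp: in_keys_iff)
  show ?thesis
    using *[of m] *[of m'] *[OF keys_add[of m m']]
    by (simp add: lookup_add power_add prod.distrib)
qed

lemma eval_mpoly_mult: "eval_mpoly x (p * q) = eval_mpoly x p * eval_mpoly x q"
proof (induction p rule: mpoly_induct)
  case (single m c)
  then show ?case
  proof (induction q rule: mpoly_induct)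
    case (single m' c')
    then show ?case
      by (simp add: mult_single eval_mpoly_single prod_powers_add ac_simps)
  next
    case (add q q')
    then show ?case
      by (simp add: distrib_left eval_mpoly_add)
  qed
qed (simp add: eval_mpoly_add distrib_right)

lemma mpoly_ring_simps [simp]:
  "p \<in> carrier (mpoly_ring V) \<longleftrightarrow> (\<forall>m \<in> Poly_Mapping.keys p. Poly_Mapping.keys m \<subseteq> V)"
  "p \<otimes>\<^bsub>mpoly_ring V\<^esub> q = p * q"
  "p \<oplus>\<^bsub>mpoly_ring V\<^esub> q = p + q"
  "\<one>\<^bsub>mpoly_ring V\<^esub> = 1"
  "\<zero>\<^bsub>mpoly_ring V\<^esub> = 0"
  by (simp_all add: mpoly_ring_def)

lemma mpoly_carrier_add:
  "p \<in> carrier (mpoly_ring V) \<Longrightarrow> q \<in> carrier (mpoly_ring V) \<Longrightarrow> p + q \<in> carrier (mpoly_ring V)"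
  using keys_add[of p q] by auto

lemma mpoly_carrier_mult:
  assumes "p \<in> carrier (mpoly_ring V)" "q \<in> carrier (mpoly_ring V)"
  shows "p * q \<in> carrier (mpoly_ring V)"
proof -
  have "Poly_Mapping.keys m \<subseteq> V" if m: "m \<in> Poly_Mapping.keys (p * q)" for m
  proof -
    obtain a b where "m = a + b" "a \<in> Poly_Mapping.keys p" "b \<in> Poly_Mapping.keys q"
      using keys_mult[of p q] m by blast
    then show ?thesis using assms keys_add[of a b] by fastforce
  qed
  then show ?thesis by simp
qed

lemma mpoly_carrier_uminus:
  "p \<in> carrier (mpoly_ring V) \<Longrightarrow> - p \<in> carrier (mpoly_ring V)"
  by (simp add: in_keys_iff)

lemma cring_mpoly_ring: "cring (mpoly_ring V :: ('v, 'a::comm_ring_1) mpoly ring)"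
  (is "cring ?R")
proof (rule cringI)
  show "abelian_group ?R"
  proof (rule abelian_groupI)
    fix p q assume "p \<in> carrier ?R" "q \<in> carrier ?R"
    then show "p \<oplus>\<^bsub>?R\<^esub> q \<in> carrier ?R"
      unfolding mpoly_ring_simps(3) by (rule mpoly_carrier_add)
  next
    fix p assume "p \<in> carrier ?R"
    from mpoly_carrier_uminus[OF this] show "\<exists>q \<in> carrier ?R. q \<oplus>\<^bsub>?R\<^esub> p = \<zero>\<^bsub>?R\<^esub>"
      by (rule bexI[rotated]) simp
  qed (simp_all add: ac_simps)
  show "Group.comm_monoid ?R"
  proof (rule comm_monoidI)
    fix p q assume "p \<in> carrier ?R" "q \<in> carrier ?R"
    then show "p \<otimes>\<^bsub>?R\<^esub> q \<in> carrier ?R"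
      unfolding mpoly_ring_simps(2) by (rule mpoly_carrier_mult)
  qed (simp_all add: ac_simps)
qed (simp add: distrib_right)


section \<open>The Zariski topology on affine space\<close>

text \<open>
  A point of the affine space with coordinates \<open>V\<close> is a function on \<open>V\<close>, extended by
  \<^term>\<open>undefined\<close> outside \<open>V\<close>, so that equality of points is equality on \<open>V\<close>.
\<close>

definition affine_space :: "'v set \<Rightarrow> ('v \<Rightarrow> 'a) set" where
  "affine_space V = (\<Pi>\<^sub>E v \<in> V. UNIV)"

definition zero_locus :: "'v set \<Rightarrow> ('v, 'a::comm_ring_1) mpoly set \<Rightarrow> ('v \<Rightarrow> 'a) set" where
  "zero_locus V F = {x \<in> affine_space V. \<forall>f \<in> F. eval_mpoly x f = 0}"

definition zariski :: "'v set \<Rightarrow> ('v \<Rightarrow> 'a::field) topology" where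
  "zariski V =
     topology (\<lambda>U. \<exists>F \<subseteq> carrier (mpoly_ring V). U = affine_space V - zero_locus V F)"

lemma openin_zariski:
  fixes U :: "('v \<Rightarrow> 'a::field) set"
  shows "openin (zariski V) U \<longleftrightarrow>
    (\<exists>F \<subseteq> carrier (mpoly_ring V). U = affine_space V - zero_locus V F)"
proof -
  let ?L = "\<lambda>U :: ('v \<Rightarrow> 'a) set.
    \<exists>F \<subseteq> carrier (mpoly_ring V). U = affine_space V - zero_locus V F"
  have "istopology ?L"
    unfolding istopology_def
  proof (intro conjI allI impI)
    fix S T assume "?L S" "?L T"
    then obtain F G where F: "F \<subseteq> carrier (mpoly_ring V)" "S = affine_space V - zero_locus V F"
      and G: "G \<subseteq> carrier (mpoly_ring V)" "T = affine_space V - zero_locus V G"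
      by blast
    let ?H = "(\<lambda>(f, g). f * g) ` (F \<times> G)"
    have "?H \<subseteq> carrier (mpoly_ring V)"
      using F(1) G(1) mpoly_carrier_mult by fast
    moreover have "S \<inter> T = affine_space V - zero_locus V ?H"
      unfolding F(2) G(2) by (force simp: zero_locus_def eval_mpoly_mult)
    ultimately show "?L (S \<inter> T)" by blast
  next
    fix \<K> :: "('v \<Rightarrow> 'a) set set" assume "\<forall>K\<in>\<K>. ?L K"
    then obtain F where F: "\<And>K. K \<in> \<K> \<Longrightarrow> F K \<subseteq> carrier (mpoly_ring V)"
      "\<And>K. K \<in> \<K> \<Longrightarrow> K = affine_space V - zero_locus V (F K)"
      by metis
    have "\<Union>\<K> = (\<Union>K\<in>\<K>. affine_space V - zero_locus V (F K))"
      using F(2) by auto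
    also have "\<dots> = affine_space V - zero_locus V (\<Union>K\<in>\<K>. F K)"
      by (auto simp: zero_locus_def)
    finally have "\<Union>\<K> = affine_space V - zero_locus V (\<Union>K\<in>\<K>. F K)" .
    moreover have "(\<Union>K\<in>\<K>. F K) \<subseteq> carrier (mpoly_ring V)"
      using F(1) by blast
    ultimately show "?L (\<Union>\<K>)" by blast
  qed
  then show ?thesis
    by (simp add: zariski_def)
qed

lemma topspace_zariski: "topspace (zariski V :: ('v \<Rightarrow> 'a::field) topology) = affine_space V"
proof
  have "openin (zariski V) (affine_space V :: ('v \<Rightarrow> 'a) set)"
    unfolding openin_zariski
    by (rule exI[of _ "{1}"]) (auto simp: zero_locus_def)
  then show "affine_space V \<subseteq> topspace (zariski V :: ('v \<Rightarrow> 'a) topology)"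
    by (rule openin_subset)
next
  show "topspace (zariski V :: ('v \<Rightarrow> 'a) topology) \<subseteq> affine_space V"
    using openin_topspace[of "zariski V :: ('v \<Rightarrow> 'a) topology"] unfolding openin_zariski by blast
qed

lemma closedin_zariski:
  "closedin (zariski V) (C :: ('v \<Rightarrow> 'a::field) set) \<longleftrightarrow>
    (\<exists>F \<subseteq> carrier (mpoly_ring V). C = zero_locus V F)"
proof -
  have "zero_locus V F \<subseteq> affine_space V" for F :: "('v, 'a) mpoly set"
    by (auto simp: zero_locus_def)
  then show ?thesis
    unfolding closedin_def openin_zariski topspace_zariski by (metis Diff_subset double_diff order_refl)
qed

definition irreducible_in :: "'b topology \<Rightarrow> 'b set \<Rightarrow> bool" where
  "irreducible_in T S \<longleftrightarrow> S \<noteq> {} \<and> S \<subseteq> topspace T \<and>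
     (\<forall>C D. closedin T C \<longrightarrow> closedin T D \<longrightarrow> S \<subseteq> C \<union> D \<longrightarrow> S \<subseteq> C \<or> S \<subseteq> D)"

text \<open>
  The codimension of an irreducible closed subset \<open>Y\<close> is the supremum of the lengths \<open>d\<close> of chains
  \<open>Y = Z 0 \<subset> Z 1 \<subset> \<dots> \<subset> Z d\<close> of irreducible closed subsets.
\<close>

definition codim_in :: "'b topology \<Rightarrow> 'b set \<Rightarrow> enat" where
  "codim_in T Y = Sup {enat d | d. \<exists>Z :: nat \<Rightarrow> 'b set. Z 0 = Y \<and>
     (\<forall>i \<le> d. closedin T (Z i) \<and> irreducible_in T (Z i)) \<and> (\<forall>i < d. Z i \<subset> Z (Suc i))}"


section \<open>Pfaffian jet varieties\<close>

text \<open>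
  The pfaffian of a skew-symmetric matrix of size \<open>2r\<close>, with rows and columns \<open>1, \<dots>, 2r\<close>, is the
  signed sum over the perfect matchings
  \<open>{\<sigma> 1, \<sigma> 2}, \<dots>, {\<sigma> (2r-1), \<sigma> (2r)}\<close>. Each matching is represented by the one permutation with
  \<open>\<sigma> (2i-1) < \<sigma> (2i)\<close> and \<open>\<sigma> 1 < \<sigma> 3 < \<dots> < \<sigma> (2r-1)\<close>. This makes sense in every characteristic.
\<close>

definition pfaffian :: "nat \<Rightarrow> (nat \<Rightarrow> nat \<Rightarrow> 'b::comm_ring_1) \<Rightarrow> 'b" where
  "pfaffian r M = (\<Sum>\<sigma> | \<sigma> permutes {1..2 * r} \<and>
        (\<forall>i \<in> {1..r}. \<sigma> (2 * i - 1) < \<sigma> (2 * i)) \<and>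
        (\<forall>i \<in> {1..<r}. \<sigma> (2 * i - 1) < \<sigma> (2 * i + 1)).
      of_int (sign \<sigma>) * (\<Prod>i = 1..r. M (\<sigma> (2 * i - 1)) (\<sigma> (2 * i))))"

text \<open>The triple \<open>(i, j, h)\<close> stands for the variable \<open>x\<^sub>i\<^sub>j\<close> with upper index \<open>h\<close>.\<close>

type_synonym jet_var = "nat \<times> nat \<times> nat"

definition jet_vars :: "nat \<Rightarrow> nat \<Rightarrow> jet_var set" where
  "jet_vars n k = {(i, j, h). 1 \<le> i \<and> i < j \<and> j \<le> n \<and> h < k}"

text \<open>
  The entries of \<open>X(t)\<close> are univariate polynomials in \<open>t\<close> whose coefficients are multivariate
  polynomials. The formula does not depend on \<open>n\<close>, which only bounds the indices.
\<close>

definition jet_entry :: "nat \<Rightarrow> nat \<Rightarrow> nat \<Rightarrow> (jet_var, 'a::comm_ring_1) mpoly poly" where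
  "jet_entry k i j = (\<Sum>h<k. Polynomial.monom (mvar (i, j, h)) h)"

definition jet_matrix :: "nat \<Rightarrow> nat \<Rightarrow> nat \<Rightarrow> (jet_var, 'a::comm_ring_1) mpoly poly" where
  "jet_matrix k i j =
     (if i < j then jet_entry k i j else if j < i then - jet_entry k j i else 0)"

definition jet_pfaffians ::
    "nat \<Rightarrow> nat \<Rightarrow> nat \<Rightarrow> (jet_var, 'a::comm_ring_1) mpoly poly set" where
  "jet_pfaffians n k r =
     {pfaffian r (\<lambda>i j. jet_matrix k (a i) (a j)) | a.
        strict_mono_on {1..2 * r} a \<and> a ` {1..2 * r} \<subseteq> {1..n}}"

definition pfaffian_jet_ideal ::
    "nat \<Rightarrow> nat \<Rightarrow> nat \<Rightarrow> (jet_var, 'a::comm_ring_1) mpoly set" where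
  "pfaffian_jet_ideal n k r =
     genideal (mpoly_ring (jet_vars n k)) {coeff p h | p h. p \<in> jet_pfaffians n k r \<and> h < k}"

definition pfaffian_jet_variety ::
    "nat \<Rightarrow> nat \<Rightarrow> nat \<Rightarrow> (jet_var \<Rightarrow> 'a::comm_ring_1) set" where
  "pfaffian_jet_variety n k r = zero_locus (jet_vars n k) (pfaffian_jet_ideal n k r)"

text \<open>
  The generators lie in the ring, so \<^const>\<open>genideal\<close> is applied in the intended situation.
\<close>

lemma mpoly_carrier_sum:
  "(\<And>i. i \<in> I \<Longrightarrow> f i \<in> carrier (mpoly_ring V)) \<Longrightarrow> sum f I \<in> carrier (mpoly_ring V)"
  by (induction I rule: infinite_finite_induct)
    (simp, simp, metis insertCI mpoly_carrier_add sum.insert)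

lemma coeff_carrier_mult:
  assumes "\<And>h. coeff p h \<in> carrier (mpoly_ring V)" "\<And>h. coeff q h \<in> carrier (mpoly_ring V)"
  shows "coeff (p * q) h \<in> carrier (mpoly_ring V)"
  unfolding coeff_mult by (intro mpoly_carrier_sum mpoly_carrier_mult assms)

lemma coeff_carrier_prod:
  assumes "\<And>i h. i \<in> I \<Longrightarrow> coeff (f i) h \<in> carrier (mpoly_ring V)"
  shows "coeff (prod f I) h \<in> carrier (mpoly_ring V)"
  using assms
proof (induction I arbitrary: h rule: infinite_finite_induct)
  case (insert i I)
  then have "coeff (f i * prod f I) h \<in> carrier (mpoly_ring V)"
    by (intro coeff_carrier_mult) (blast intro: insertI1 insertI2)+
  with insert.hyps show ?case by simp
qed (simp_all add: coeff_1)

lemma coeff_jet_matrix_carrier: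
  assumes "i \<in> {1..n}" "j \<in> {1..n}"
  shows "coeff (jet_matrix k i j) h \<in> carrier (mpoly_ring (jet_vars n k))"
proof -
  have *: "coeff (jet_entry k i j) h \<in> carrier (mpoly_ring (jet_vars n k))"
    if "1 \<le> i" "i < j" "j \<le> n" for i j
    unfolding jet_entry_def coeff_sum
    by (rule mpoly_carrier_sum) (use that in \<open>auto simp: mvar_def jet_vars_def\<close>)
  show ?thesis
    using assms *[of i j] mpoly_carrier_uminus[OF *[of j i]]
    by (auto simp: jet_matrix_def simp del: mpoly_ring_simps(1)) simp
qed

lemma jet_pfaffian_coeffs_in_carrier:
  "{coeff p h | p h. p \<in> jet_pfaffians n k r \<and> h < k} \<subseteq> carrier (mpoly_ring (jet_vars n k))"
proof clarify
  fix p :: "(jet_var, 'a) mpoly poly" and h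
  assume "p \<in> jet_pfaffians n k r"
  then obtain a where p: "p = pfaffian r (\<lambda>i j. jet_matrix k (a i) (a j))"
    and a: "a ` {1..2 * r} \<subseteq> {1..n}"
    by (auto simp: jet_pfaffians_def)
  show "coeff p h \<in> carrier (mpoly_ring (jet_vars n k))"
    unfolding p pfaffian_def coeff_sum
  proof (rule mpoly_carrier_sum)
    fix \<sigma> assume "\<sigma> \<in> {\<sigma>. \<sigma> permutes {1..2 * r} \<and>
        (\<forall>i \<in> {1..r}. \<sigma> (2 * i - 1) < \<sigma> (2 * i)) \<and>
        (\<forall>i \<in> {1..<r}. \<sigma> (2 * i - 1) < \<sigma> (2 * i + 1))}"
    then have \<sigma>: "\<sigma> permutes {1..2 * r}" by simp
    have mem: "a (\<sigma> i) \<in> {1..n}" if "1 \<le> i" "i \<le> 2 * r" for i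
      using that a permutes_in_image[OF \<sigma>, of i] by (auto simp: image_subset_iff)
    have "coeff (\<Prod>i = 1..r. jet_matrix k (a (\<sigma> (2 * i - 1))) (a (\<sigma> (2 * i)))) h
        \<in> carrier (mpoly_ring (jet_vars n k))" (is "coeff ?q h \<in> _")
      by (intro coeff_carrier_prod coeff_jet_matrix_carrier) (rule mem; auto)+
    then show "coeff (of_int (sign \<sigma>) * ?q) h \<in> carrier (mpoly_ring (jet_vars n k))"
      by (cases \<sigma> rule: sign_cases) (use mpoly_carrier_uminus in auto)
  qed
qed

lemma card_jet_vars: "card (jet_vars (2 * r + 1) k) = (2 * r + 1) * r * k"
proof -
  have "jet_vars n k = (\<lambda>((i, j), h). (i, j, h)) ` ((SIGMA j:{1..n}. {1..<j})\<inverse> \<times> {..<k})" for n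
    by (force simp: jet_vars_def)
  moreover have "inj_on (\<lambda>((i, j), h). (i, j, h)) A" for A :: "((nat \<times> nat) \<times> nat) set"
    by (auto simp: inj_on_def)
  ultimately have "card (jet_vars n k) = (\<Sum>j = 1..n. j - 1) * k" for n
    by (simp add: card_image card_cartesian_product)
  moreover have "(\<Sum>j = 1..2 * r + 1. j - 1) = (2 * r + 1) * r"
    by (induction r) (auto simp: algebra_simps)
  ultimately show ?thesis by simp
qed

end

theory Submission
  imports Defs "HOL-Computational_Algebra.Formal_Power_Series"
begin

text \<open>
  Let \<open>n = 2r + 1\<close>, and let a point of affine space be a skew-symmetric matrix over \<open>K[[t]]\<close> modulo \<open>t\<^sup>k\<close>.
  Over the discrete valuation ring \<open>K[[t]]\<close> a skew-symmetric matrix has a normal form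
  \<open>\<Sum>\<^sub>l d\<^sub>l (e\<^sub>l \<and> f\<^sub>l)\<close> with \<open>r\<close> terms, in which the vectors \<open>e\<^sub>l, f\<^sub>l\<close> have a minor equal to \<open>\<plusminus>1\<close>. On the
  variety therefore \<open>t\<^sup>k\<close> divides \<open>\<Prod> d\<^sub>l\<close>, and a degeneration that multiplies two of the coefficients
  together shows that such a matrix is a limit of sums of \<open>r - 1\<close> decomposable ones. Hence the variety is
  the closure of the set \<open>D\<close> of these sums, which is irreducible because any two of its points are joined
  by a polynomial curve. Freeing the \<open>3k\<close> coordinates of the last \<open>3 \<times> 3\<close> block of \<open>D\<close> one after another
  gives a chain of length \<open>3k\<close> that ends with the whole space. No chain is longer, since the other
  coordinates are algebraically independent on the variety and every step of a chain adds one
  algebraically independent function.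
\<close>

section \<open>Pfaffians\<close>

text \<open>Divisibility of \<open>\<Prod> d_l\<close> by \<open>t^k\<close> does not make a single
  \<open>d_l\<close> vanish modulo \<open>t^k\<close>: for \<open>r = k = 2\<close> and
  \<open>d_1 = d_2 = t\<close> the point lies on the variety but is not a single decomposable matrix
  modulo \<open>t^2\<close>. Such points might form further components, and this is what the
  degeneration has to exclude. The odd size is what makes it work: skew elimination ends after
  exactly \<open>r\<close> pairs with a zero 1 x 1 block, so every pfaffian condition is a multiple
  of one product of \<open>r\<close> coefficients, and \<open>r - 1\<close> merges turn these into a
  single coefficient that is zero modulo \<open>t^k\<close>. Limits are taken without a topology on
  \<open>K\<close> itself: a polynomial that vanishes at infinitely many parameters of a line or
  curve vanishes along all of it. Likewise dimension theory is replaced by counting monomials. The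
  number \<open>3k\<close> stands for the three entries of the 3 x 3 skew block that is left after
  \<open>r - 1\<close> pivot pairs, with \<open>k\<close> coefficients each.\<close>

definition dec :: "('i \<Rightarrow> 'b::comm_ring_1) \<Rightarrow> ('i \<Rightarrow> 'b) \<Rightarrow> 'i \<Rightarrow> 'i \<Rightarrow> 'b" where
  "dec u v i j = u i * v j - u j * v i"

section \<open>Permutations that represent a perfect matching\<close>

definition pfaffian_perms :: "nat \<Rightarrow> (nat \<Rightarrow> nat) set" where
  "pfaffian_perms r = {\<sigma>. \<sigma> permutes {1..2 * r} \<and>
        (\<forall>i \<in> {1..r}. \<sigma> (2 * i - 1) < \<sigma> (2 * i)) \<and>
        (\<forall>i \<in> {1..<r}. \<sigma> (2 * i - 1) < \<sigma> (2 * i + 1))}"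

text \<open>Defined for every permutation, not only for the representatives in
  \<open>pfaffian_perms\<close>: for skew-symmetric \<open>M\<close> the value depends on the
  matching alone, which gives access to the sum over the whole symmetric group.\<close>

definition pfaffian_term :: "nat \<Rightarrow> (nat \<Rightarrow> nat \<Rightarrow> 'b::comm_ring_1) \<Rightarrow> (nat \<Rightarrow> nat) \<Rightarrow> 'b" where
  "pfaffian_term r M \<sigma> = of_int (sign \<sigma>) * (\<Prod>i = 1..r. M (\<sigma> (2 * i - 1)) (\<sigma> (2 * i)))"

definition matching :: "nat \<Rightarrow> (nat \<Rightarrow> nat) \<Rightarrow> nat set set" where
  "matching r \<sigma> = (\<lambda>i. {\<sigma> (2 * i - 1), \<sigma> (2 * i)}) ` {1..r}"

lemma pfaffian_eq_sum_terms: "pfaffian r M = (\<Sum>\<sigma>\<in>pfaffian_perms r. pfaffian_term r M \<sigma>)"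
  by (simp add: pfaffian_def pfaffian_perms_def pfaffian_term_def)

lemma pfaffian_term_cong:
  assumes "\<And>i j. i \<in> {1..2*r} \<Longrightarrow> j \<in> {1..2*r} \<Longrightarrow> M i j = N i j" "\<sigma> permutes {1..2*r}"
  shows "pfaffian_term r M \<sigma> = pfaffian_term r N \<sigma>"
proof -
  have "M (\<sigma> (2 * i - 1)) (\<sigma> (2 * i)) = N (\<sigma> (2 * i - 1)) (\<sigma> (2 * i))" if "i \<in> {1..r}" for i
    using that by (intro assms(1)) (simp_all only: permutes_in_image[OF assms(2)], auto)
  then have "(\<Prod>i = 1..r. M (\<sigma> (2 * i - 1)) (\<sigma> (2 * i))) = (\<Prod>i = 1..r. N (\<sigma> (2 * i - 1)) (\<sigma> (2 * i)))"
    by (rule prod.cong[OF refl])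
  then show ?thesis by (simp only: pfaffian_term_def)
qed

lemma pfaffian_cong:
  assumes "\<And>i j. i \<in> {1..2*r} \<Longrightarrow> j \<in> {1..2*r} \<Longrightarrow> M i j = N i j"
  shows "pfaffian r M = pfaffian r N"
  unfolding pfaffian_eq_sum_terms
proof (rule sum.cong[OF refl])
  fix \<sigma> assume "\<sigma> \<in> pfaffian_perms r"
  then have "\<sigma> permutes {1..2*r}" by (simp add: pfaffian_perms_def)
  with assms show "pfaffian_term r M \<sigma> = pfaffian_term r N \<sigma>" by (rule pfaffian_term_cong)
qed

text \<open>Serves twice: it sorts the pairs of a matching by their first elements, and it sorts the
  pivot rows of a normal form, because the pfaffians of the variety are taken on increasing
  rows.\<close>

lemma exists_sorting_perm:
  fixes m :: "nat \<Rightarrow> 'c::linorder"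
  assumes "inj_on m {1..r}"
  shows "\<exists>\<pi>. \<pi> permutes {1..r} \<and> strict_mono_on {1..r} (m \<circ> \<pi>)"
proof -
  define xs where "xs = sorted_list_of_set (m ` {1..r})"
  have len: "length xs = r" using assms by (simp add: xs_def card_image)
  have st: "sorted_wrt (<) xs" by (simp add: xs_def)
  have set_xs: "set xs = m ` {1..r}" by (simp add: xs_def)
  define \<pi> where "\<pi> = (\<lambda>i. if i \<in> {1..r} then inv_into {1..r} m (xs ! (i - 1)) else i)"
  have nth_mem': "xs ! (i - 1) \<in> m ` {1..r}" if "i \<in> {1..r}" for i
    using that len set_xs nth_mem[of "i - 1" xs] by auto
  have m\<pi>: "m (\<pi> i) = xs ! (i - 1)" if "i \<in> {1..r}" for i
    using f_inv_into_f[OF nth_mem'[OF that]] that by (simp add: \<pi>_def)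
  have sm: "strict_mono_on {1..r} (m \<circ> \<pi>)"
  proof (rule strict_mono_onI)
    fix i j assume "i \<in> {1..r}" "j \<in> {1..r}" "i < j"
    then show "(m \<circ> \<pi>) i < (m \<circ> \<pi>) j"
      using sorted_wrt_nth_less[OF st, of "i - 1" "j - 1"] len by (auto simp: m\<pi>)
  qed
  have "\<pi> permutes {1..r}"
  proof (rule bij_imp_permutes)
    have "inj_on \<pi> {1..r}"
      using strict_mono_on_imp_inj_on[OF sm] by (rule inj_on_imageI2)
    moreover have "\<pi> ` {1..r} \<subseteq> {1..r}"
    proof (rule image_subsetI)
      fix i assume i: "i \<in> {1..r}"
      show "\<pi> i \<in> {1..r}"
        using inv_into_into[OF nth_mem'[OF i]] i by (simp add: \<pi>_def)
    qed
    ultimately show "bij_betw \<pi> {1..r} {1..r}"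
      by (simp add: bij_betw_def endo_inj_surj)
  qed (auto simp: \<pi>_def)
  with sm show ?thesis by blast
qed

text \<open>With \<open>f\<close> and \<open>g\<close> the odd and the even positions, this is the
  exchange of two blocks of length two. The ranges are disjoint, so neither transposition disturbs
  the other.\<close>

lemma transpose_pair:
  assumes "\<And>x y. x \<in> A \<Longrightarrow> y \<in> A \<Longrightarrow> f x \<noteq> g y" "inj_on f A" "inj_on g A" "a \<in> A" "b \<in> A" "i \<in> A"
  shows "(transpose (f a) (f b) \<circ> transpose (g a) (g b)) (f i) = f (transpose a b i)"
    "(transpose (f a) (f b) \<circ> transpose (g a) (g b)) (g i) = g (transpose a b i)"
proof -
  note ne = assms(1)[OF assms(4,4)] assms(1)[OF assms(4,5)] assms(1)[OF assms(5,4)]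
    assms(1)[OF assms(5,5)] assms(1)[OF assms(6,4)] assms(1)[OF assms(6,5)]
    assms(1)[OF assms(4,6)] assms(1)[OF assms(5,6)]
  note iff = inj_on_eq_iff[OF assms(2,6,4)] inj_on_eq_iff[OF assms(2,6,5)]
    inj_on_eq_iff[OF assms(3,6,4)] inj_on_eq_iff[OF assms(3,6,5)]
  show "(transpose (f a) (f b) \<circ> transpose (g a) (g b)) (f i) = f (transpose a b i)"
    "(transpose (f a) (f b) \<circ> transpose (g a) (g b)) (g i) = g (transpose a b i)"
    by (cases "i = a"; cases "i = b"; use ne iff in \<open>simp add: transpose_def\<close>;
        metis (no_types) ne)+
qed

text \<open>Exchanging two blocks of length two is a product of two transpositions, hence even;
  induction over the transpositions that make up \<open>\<pi>\<close> does the rest.\<close>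

lemma exists_block_perm:
  fixes \<sigma> :: "nat \<Rightarrow> nat"
  assumes "\<pi> permutes {1..r}" "\<sigma> permutes {1..2*r}"
  shows "\<exists>\<rho>. \<rho> permutes {1..2*r} \<and> sign \<rho> = sign \<sigma> \<and>
    (\<forall>i\<in>{1..r}. \<rho> (2*i - 1) = \<sigma> (2 * \<pi> i - 1) \<and> \<rho> (2*i) = \<sigma> (2 * \<pi> i))"
  using finite_atLeastAtMost[of 1 r] assms(1)
proof (induction rule: permutes_rev_induct)
  case id
  show ?case using assms(2) by (intro exI[of _ \<sigma>]) auto
next
  case (swap a b p)
  then obtain \<rho> where \<rho>: "\<rho> permutes {1..2*r}" "sign \<rho> = sign \<sigma>"
    and eq: "\<And>i. i\<in>{1..r} \<Longrightarrow> \<rho> (2*i - 1) = \<sigma> (2 * p i - 1)"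
      "\<And>i. i\<in>{1..r} \<Longrightarrow> \<rho> (2*i) = \<sigma> (2 * p i)" by blast
  define t where "t = transpose (2*a - 1) (2*b - 1) \<circ> transpose (2*a) (2*b)"
  have p1: "transpose (2*a - 1) (2*b - 1) permutes {1..2*r}"
    and p2: "transpose (2*a) (2*b) permutes {1..2*r}"
    using swap.hyps by (auto intro!: permutes_swap_id)
  have t: "t permutes {1..2*r}" unfolding t_def by (rule permutes_compose[OF p2 p1])
  have perm: "permutation (transpose (2*a - 1) (2*b - 1))" "permutation (transpose (2*a) (2*b))"
    "permutation t" "permutation \<rho>"
    using p1 p2 t \<rho> permutation_permutes by blast+
  have ne: "2*a - 1 \<noteq> 2*b - 1" using swap.hyps by auto
  have "sign t = 1" unfolding t_def sign_compose[OF perm(1,2)] sign_swap_id using ne swap.hyps by simp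
  then have s: "sign (\<rho> \<circ> t) = sign \<sigma>" using sign_compose[OF perm(4,3)] \<rho>(2) by simp
  have t1: "t (2*i - 1) = 2 * transpose a b i - 1" "t (2*i) = 2 * transpose a b i"
    if "i \<in> {1..r}" for i
  proof -
    have "2*x - 1 \<noteq> 2*y" if "x \<in> {1..r}" "y \<in> {1..r}" for x y :: nat using that by auto presburger
    moreover have "inj_on (\<lambda>i. 2*i - 1 :: nat) {1..r}" "inj_on (\<lambda>i. 2*i :: nat) {1..r}"
      by (auto simp: inj_on_def)
    ultimately show "t (2*i - 1) = 2 * transpose a b i - 1" "t (2*i) = 2 * transpose a b i"
      unfolding t_def using transpose_pair[where f = "\<lambda>i. 2*i - 1" and g = "\<lambda>i. 2*i"] swap.hyps(1,2) that
      by blast+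
  qed
  have m: "transpose a b i \<in> {1..r}" if "i \<in> {1..r}" for i
    using that swap.hyps by (auto simp: transpose_def)
  show ?case
  proof (intro exI conjI ballI)
    show "\<rho> \<circ> t permutes {1..2*r}" by (rule permutes_compose[OF t \<rho>(1)])
    fix i assume i: "i \<in> {1..r}"
    show "(\<rho> \<circ> t) (2 * i - 1) = \<sigma> (2 * (p \<circ> transpose a b) i - 1)"
      "(\<rho> \<circ> t) (2 * i) = \<sigma> (2 * (p \<circ> transpose a b) i)"
      using t1[OF i] eq[OF m[OF i]] by simp_all
  qed (rule s)
qed

text \<open>Reversing one pair changes the sign of the permutation and, by skew symmetry, the sign
  of one factor; the two changes cancel.\<close>

lemma pfaffian_term_flip:
  fixes M :: "nat \<Rightarrow> nat \<Rightarrow> 'b::comm_ring_1"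
  assumes skew: "\<And>a b. M a b = - M b a" and \<sigma>: "\<sigma> permutes {1..2*r}" and i: "i \<in> {1..r}"
  defines "\<rho> \<equiv> \<sigma> \<circ> transpose (2*i - 1) (2*i)"
  shows "\<rho> permutes {1..2*r}" "matching r \<rho> = matching r \<sigma>"
    "pfaffian_term r M \<rho> = pfaffian_term r M \<sigma>"
    "\<rho> (2*i - 1) = \<sigma> (2*i)" "\<rho> (2*i) = \<sigma> (2*i - 1)"
    "\<And>j. j \<noteq> i \<Longrightarrow> j \<ge> 1 \<Longrightarrow> \<rho> (2*j - 1) = \<sigma> (2*j - 1) \<and> \<rho> (2*j) = \<sigma> (2*j)"
proof -
  have t: "transpose (2*i - 1) (2*i) permutes {1..2*r}"
    using i by (intro permutes_swap_id) auto
  show p: "\<rho> permutes {1..2*r}" unfolding \<rho>_def by (rule permutes_compose[OF t \<sigma>])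
  show e1: "\<rho> (2*i - 1) = \<sigma> (2*i)" and e2: "\<rho> (2*i) = \<sigma> (2*i - 1)"
    by (simp_all add: \<rho>_def)
  show e3: "\<rho> (2*j - 1) = \<sigma> (2*j - 1) \<and> \<rho> (2*j) = \<sigma> (2*j)" if "j \<noteq> i" "j \<ge> 1" for j
  proof -
    have "2*j - 1 \<noteq> 2*i - 1" "2*j-1 \<noteq> 2*i" "2*j \<noteq> 2*i-1" "2*j\<noteq>2*i" using that i by (simp_all; presburger)+
    then show ?thesis by (simp add: \<rho>_def transpose_def)
  qed
  show "matching r \<rho> = matching r \<sigma>"
    unfolding matching_def
  proof (rule image_cong[OF refl])
    fix j assume "j \<in> {1..r}"
    then show "{\<rho> (2 * j - 1), \<rho> (2 * j)} = {\<sigma> (2 * j - 1), \<sigma> (2 * j)}"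
      using e1 e2 e3[of j] by (cases "j = i") auto
  qed
  have perm: "permutation \<sigma>" "permutation (transpose (2*i-1) (2*i))"
    using \<sigma> t permutation_permutes by blast+
  have ne: "2*i-1 \<noteq> 2*i" using i by auto
  have sgn: "sign \<rho> = - sign \<sigma>"
    unfolding \<rho>_def sign_compose[OF perm] sign_swap_id using ne by simp
  have "(\<Prod>j = 1..r. M (\<rho> (2 * j - 1)) (\<rho> (2 * j))) =
      M (\<rho> (2 * i - 1)) (\<rho> (2 * i)) * (\<Prod>j \<in> {1..r} - {i}. M (\<rho> (2 * j - 1)) (\<rho> (2 * j)))"
    using i by (subst prod.remove[of _ i]) auto
  also have "(\<Prod>j \<in> {1..r} - {i}. M (\<rho> (2 * j - 1)) (\<rho> (2 * j))) =
     (\<Prod>j \<in> {1..r} - {i}. M (\<sigma> (2 * j - 1)) (\<sigma> (2 * j)))"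
    using e3 by (intro prod.cong) auto
  also have "M (\<rho> (2 * i - 1)) (\<rho> (2 * i)) = - M (\<sigma> (2 * i - 1)) (\<sigma> (2 * i))"
    unfolding e1 e2 by (rule skew)
  also have "- M (\<sigma> (2 * i - 1)) (\<sigma> (2 * i)) * (\<Prod>j \<in> {1..r} - {i}. M (\<sigma> (2 * j - 1)) (\<sigma> (2 * j)))
      = - (\<Prod>j = 1..r. M (\<sigma> (2 * j - 1)) (\<sigma> (2 * j)))"
    using i by (subst prod.remove[of "{1..r}" i]) auto
  finally show "pfaffian_term r M \<rho> = pfaffian_term r M \<sigma>"
    by (simp add: pfaffian_term_def sgn)
qed

text \<open>Reversing pairs makes each of them increasing, and sorting the blocks then orders their
  first elements. Both moves preserve the matching and the term.\<close>

lemma exists_canonical_perm: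
  fixes M :: "nat \<Rightarrow> nat \<Rightarrow> 'b::comm_ring_1"
  assumes skew: "\<And>a b. M a b = - M b a" and \<sigma>: "\<sigma> permutes {1..2*r}"
  shows "\<exists>\<rho>\<in>pfaffian_perms r. matching r \<rho> = matching r \<sigma> \<and> pfaffian_term r M \<rho> = pfaffian_term r M \<sigma>"
proof -
  \<comment> \<open>Induction on the number \<open>m\<close> of leading pairs that are already
    increasing.\<close>
  have "\<exists>\<rho>. \<rho> permutes {1..2*r} \<and> matching r \<rho> = matching r \<sigma> \<and>
      pfaffian_term r M \<rho> = pfaffian_term r M \<sigma> \<and> (\<forall>i\<in>{1..m}. \<rho> (2*i - 1) < \<rho> (2*i))"
    if "m \<le> r" for m
    using that
  proof (induction m)
    case 0
    show ?case using \<sigma> by (intro exI[of _ \<sigma>]) simp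
  next
    case (Suc m)
    then obtain \<rho> where \<rho>: "\<rho> permutes {1..2*r}" "matching r \<rho> = matching r \<sigma>"
      "pfaffian_term r M \<rho> = pfaffian_term r M \<sigma>" "\<forall>i\<in>{1..m}. \<rho> (2*i - 1) < \<rho> (2*i)" by auto
    show ?case
    proof (cases "\<rho> (2 * Suc m - 1) < \<rho> (2 * Suc m)")
      case True
      then show ?thesis using \<rho> by (intro exI[of _ \<rho>]) (auto simp: le_Suc_eq)
    next
      case False
      have mem: "Suc m \<in> {1..r}" using Suc.prems by simp
      have "\<rho> (2 * Suc m - 1) \<noteq> \<rho> (2 * Suc m)"
        using permutes_inj[OF \<rho>(1)] by (auto dest!: injD)
      with False have lt: "\<rho> (2 * Suc m) < \<rho> (2 * Suc m - 1)" by simp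
      note fl = pfaffian_term_flip[of M, OF skew \<rho>(1) mem]
      show ?thesis
      proof (intro exI conjI ballI)
        fix i assume i: "i \<in> {1..Suc m}"
        show "(\<rho> \<circ> transpose (2 * Suc m - 1) (2 * Suc m)) (2 * i - 1)
            < (\<rho> \<circ> transpose (2 * Suc m - 1) (2 * Suc m)) (2 * i)"
        proof (cases "i = Suc m")
          case True
          then show ?thesis using fl(4,5) lt by simp
        next
          case False
          then have "i \<in> {1..m}" using i by auto
          then show ?thesis using fl(6)[OF False] \<rho>(4) i by auto
        qed
      qed (simp_all only: fl(1-3) \<rho>)
    qed
  qed
  from this[of r] obtain \<rho> where \<rho>: "\<rho> permutes {1..2*r}" "matching r \<rho> = matching r \<sigma>"
      "pfaffian_term r M \<rho> = pfaffian_term r M \<sigma>" "\<forall>i\<in>{1..r}. \<rho> (2*i - 1) < \<rho> (2*i)" by auto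
  have "inj_on (\<lambda>i. \<rho> (2*i - 1)) {1..r}"
    using permutes_inj[OF \<rho>(1)] by (auto intro!: inj_onI dest!: injD)
  then obtain \<pi> where \<pi>: "\<pi> permutes {1..r}" "strict_mono_on {1..r} ((\<lambda>i. \<rho> (2*i - 1)) \<circ> \<pi>)"
    using exists_sorting_perm by blast
  obtain \<tau> where \<tau>: "\<tau> permutes {1..2*r}" "sign \<tau> = sign \<rho>"
    "\<And>i. i\<in>{1..r} \<Longrightarrow> \<tau> (2*i - 1) = \<rho> (2 * \<pi> i - 1)" "\<And>i. i\<in>{1..r} \<Longrightarrow> \<tau> (2*i) = \<rho> (2 * \<pi> i)"
    using exists_block_perm[OF \<pi>(1) \<rho>(1)] by blast
  have mem: "\<pi> i \<in> {1..r} \<longleftrightarrow> i \<in> {1..r}" for i using permutes_in_image[OF \<pi>(1)] .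
  have "matching r \<tau> = (\<lambda>i. {\<rho> (2 * \<pi> i - 1), \<rho> (2 * \<pi> i)}) ` {1..r}"
    unfolding matching_def using \<tau> by (intro image_cong) auto
  also have "\<dots> = (\<lambda>i. {\<rho> (2 * i - 1), \<rho> (2 * i)}) ` (\<pi> ` {1..r})" by (simp add: image_image)
  also have "\<dots> = matching r \<rho>" using permutes_image[OF \<pi>(1)] by (simp add: matching_def)
  finally have m: "matching r \<tau> = matching r \<rho>" .
  have "(\<Prod>i = 1..r. M (\<tau> (2 * i - 1)) (\<tau> (2 * i))) = (\<Prod>i = 1..r. M (\<rho> (2 * \<pi> i - 1)) (\<rho> (2 * \<pi> i)))"
    using \<tau> by (intro prod.cong) auto
  also have "\<dots> = (\<Prod>i = 1..r. M (\<rho> (2 * i - 1)) (\<rho> (2 * i)))"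
    using prod.permute[OF \<pi>(1), of "\<lambda>i. M (\<rho> (2 * i - 1)) (\<rho> (2 * i))"] by (simp add: comp_def)
  finally have t: "pfaffian_term r M \<tau> = pfaffian_term r M \<rho>"
    by (simp add: pfaffian_term_def \<tau>)
  have "\<tau> \<in> pfaffian_perms r"
    unfolding pfaffian_perms_def
  proof (intro CollectI conjI ballI \<tau>(1))
    fix i assume i: "i \<in> {1..r}"
    show "\<tau> (2 * i - 1) < \<tau> (2 * i)" using \<tau>(3,4)[OF i] \<rho>(4) mem i by metis
  next
    fix i assume i: "i \<in> {1..<r}"
    have "\<rho> (2 * \<pi> i - 1) < \<rho> (2 * \<pi> (Suc i) - 1)"
      using strict_mono_onD[OF \<pi>(2), of i "Suc i"] i by auto
    then show "\<tau> (2 * i - 1) < \<tau> (2 * i + 1)" using \<tau>(3)[of i] \<tau>(3)[of "Suc i"] i by auto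
  qed
  then show ?thesis using m t \<rho> by (intro bexI[of _ \<tau>]) auto
qed

text \<open>A representative can be read off from its matching: the odd positions list the minima of
  the pairs in increasing order, and each even position holds the partner.\<close>

lemma inj_on_matching: "inj_on (matching r) (pfaffian_perms r)"
proof (rule inj_onI)
  fix \<sigma> \<tau> assume S: "\<sigma> \<in> pfaffian_perms r" and T: "\<tau> \<in> pfaffian_perms r"
    and eq: "matching r \<sigma> = matching r \<tau>"
  have mins: "Min ` matching r \<sigma> = (\<lambda>i. \<sigma> (2*i - 1)) ` {1..r}" if "\<sigma> \<in> pfaffian_perms r" for \<sigma>
    unfolding matching_def image_image
  proof (rule image_cong[OF refl])
    fix i assume "i \<in> {1..r}"
    then have "\<sigma> (2*i-1) < \<sigma> (2*i)" using that by (simp add: pfaffian_perms_def)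
    then show "Min {\<sigma> (2 * i - 1), \<sigma> (2 * i)} = \<sigma> (2 * i - 1)" by simp
  qed
  have st: "sorted_wrt (<) (map (\<lambda>i. \<sigma> (2*i - 1)) [1..<Suc r])" if "\<sigma> \<in> pfaffian_perms r" for \<sigma>
    unfolding sorted_wrt_iff_nth_Suc_transp[OF transp_on_less]
  proof (intro allI impI)
    fix i assume i: "Suc i < length (map (\<lambda>i. \<sigma> (2 * i - 1)) [1..<Suc r])"
    then have "Suc i \<in> {1..<r}" by (simp del: upt_Suc)
    then have "\<sigma> (2 * Suc i - 1) < \<sigma> (2 * Suc i + 1)" using that unfolding pfaffian_perms_def by blast
    then show "map (\<lambda>i. \<sigma> (2 * i - 1)) [1..<Suc r] ! i < map (\<lambda>i. \<sigma> (2 * i - 1)) [1..<Suc r] ! Suc i"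
      using i by (simp add: nth_append del: upt_Suc)
  qed
  have "(\<lambda>i. \<sigma> (2*i - 1)) ` {1..r} = (\<lambda>i. \<tau> (2*i - 1)) ` {1..r}"
    using mins[OF S] mins[OF T] eq by simp
  then have "set (map (\<lambda>i. \<sigma> (2*i - 1)) [1..<Suc r]) = set (map (\<lambda>i. \<tau> (2*i - 1)) [1..<Suc r])"
    by (simp only: set_map set_upt atLeastLessThanSuc_atLeastAtMost)
  then have "map (\<lambda>i. \<sigma> (2*i - 1)) [1..<Suc r] = map (\<lambda>i. \<tau> (2*i - 1)) [1..<Suc r]"
    using strict_sorted_equal[OF st[OF T] st[OF S]] by simp
  then have odd_eq: "\<sigma> (2*i - 1) = \<tau> (2*i - 1)" if "i \<in> {1..r}" for i
    using that unfolding map_eq_conv set_upt by (metis atLeastLessThanSuc_atLeastAtMost)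
  have even_eq: "\<sigma> (2*i) = \<tau> (2*i)" if i: "i \<in> {1..r}" for i
  proof -
    have "{\<sigma> (2*i - 1), \<sigma> (2*i)} \<in> matching r \<tau>" unfolding eq[symmetric] using i by (auto simp: matching_def)
    then obtain j where j: "j \<in> {1..r}" "{\<sigma> (2*i - 1), \<sigma> (2*i)} = {\<tau> (2*j - 1), \<tau> (2*j)}"
      by (auto simp: matching_def)
    have "\<sigma> (2*i - 1) < \<sigma> (2*i)" "\<tau> (2*j - 1) < \<tau> (2*j)"
      using S T i j(1) by (auto simp: pfaffian_perms_def)
    then have *: "\<sigma> (2*i - 1) = \<tau> (2*j - 1)" "\<sigma> (2*i) = \<tau> (2*j)"
      using j(2) by (auto simp: doubleton_eq_iff)
    have "\<tau> (2*i - 1) = \<tau> (2*j - 1)" using odd_eq[OF i] * by simp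
    moreover have "inj \<tau>" using T permutes_inj by (auto simp: pfaffian_perms_def)
    ultimately have "2*i - 1 = 2*j - 1" by (auto dest: injD)
    then have "i = j" using i j by auto
    with * show ?thesis by simp
  qed
  show "\<sigma> = \<tau>"
  proof
    fix j
    show "\<sigma> j = \<tau> j"
    proof (cases "j \<in> {1..2*r}")
      case True
      then have "(\<exists>i\<in>{1..r}. j = 2*i - 1) \<or> (\<exists>i\<in>{1..r}. j = 2*i)"
        by (cases "even j") (auto elim!: evenE oddE, force)
      then show ?thesis using odd_eq even_eq by blast
    next
      case False
      have "\<sigma> permutes {1..2*r}" "\<tau> permutes {1..2*r}" using S T by (simp_all add: pfaffian_perms_def)
      then show ?thesis using permutes_not_in[OF _ False] by metis
    qed
  qed
qed

text \<open>The stabiliser of the matching \<open>{1,2}, {3,4}, ...\<close>; the fibres of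
  \<open>matching\<close> are its left cosets.\<close>

definition hyperoctahedral :: "nat \<Rightarrow> (nat \<Rightarrow> nat) set" where
  "hyperoctahedral r = {g. g permutes {1..2*r} \<and> matching r g = matching r id}"

text \<open>The term is constant on each fibre of \<open>matching\<close>, and every fibre is a
  coset of the stabiliser that contains exactly one representative.\<close>

lemma sum_perms_pfaffian_term:
  fixes M :: "nat \<Rightarrow> nat \<Rightarrow> 'b::comm_ring_1"
  assumes skew: "\<And>a b. M a b = - M b a"
  shows "(\<Sum>\<sigma> | \<sigma> permutes {1..2*r}. pfaffian_term r M \<sigma>) = of_nat (card (hyperoctahedral r)) * pfaffian r M"
proof -
  let ?S = "{\<sigma>. \<sigma> permutes {1..2*r}}"
  have fin: "finite ?S" by (rule finite_permutations) simp
  have sub: "pfaffian_perms r \<subseteq> ?S" by (auto simp: pfaffian_perms_def)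
  have finc: "finite (pfaffian_perms r)" using fin sub by (rule finite_subset[rotated])
  have fibre: "card {\<sigma> \<in> ?S. matching r \<sigma> = matching r \<rho>} = card (hyperoctahedral r)"
    if \<rho>: "\<rho> permutes {1..2*r}" for \<rho>
  proof -
    have mcomp: "matching r (\<rho> \<circ> g) = (image \<rho>) ` matching r g" for g
      by (auto simp: matching_def image_image)
    have inj: "inj \<rho>" using \<rho> by (rule permutes_inj)
    have "{\<sigma> \<in> ?S. matching r \<sigma> = matching r \<rho>} = (\<lambda>g. \<rho> \<circ> g) ` hyperoctahedral r"
    proof (intro equalityI subsetI)
      fix \<sigma> assume "\<sigma> \<in> {\<sigma> \<in> ?S. matching r \<sigma> = matching r \<rho>}"
      then have \<sigma>: "\<sigma> permutes {1..2*r}" "matching r \<sigma> = matching r \<rho>" by auto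
      define g where "g = inv_into UNIV \<rho> \<circ> \<sigma>"
      have eq: "\<sigma> = \<rho> \<circ> g"
        using permutes_inv_o(1)[OF \<rho>] by (simp add: g_def comp_assoc[symmetric])
      have g: "g permutes {1..2*r}"
        unfolding g_def using \<sigma>(1) permutes_inv[OF \<rho>] by (rule permutes_compose)
      have "(image \<rho>) ` matching r g = (image \<rho>) ` matching r id"
        using \<sigma>(2) mcomp[of g] mcomp[of id] eq by simp
      then have "matching r g = matching r id"
        using inj by (metis inj_image_eq_iff inj_image_eq_iff inj_def)
      then show "\<sigma> \<in> (\<lambda>g. \<rho> \<circ> g) ` hyperoctahedral r"
        using g eq by (auto simp: hyperoctahedral_def)
    next
      fix \<sigma> assume "\<sigma> \<in> (\<lambda>g. \<rho> \<circ> g) ` hyperoctahedral r"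
      then obtain g where g: "\<sigma> = \<rho> \<circ> g" "g permutes {1..2*r}" "matching r g = matching r id"
        by (auto simp: hyperoctahedral_def)
      have "matching r \<sigma> = matching r \<rho>" using mcomp[of g] mcomp[of id] g by simp
      moreover have "\<sigma> permutes {1..2*r}" unfolding g(1) by (rule permutes_compose[OF g(2) \<rho>])
      ultimately show "\<sigma> \<in> {\<sigma> \<in> ?S. matching r \<sigma> = matching r \<rho>}" by simp
    qed
    moreover have "inj_on (\<lambda>g. \<rho> \<circ> g) (hyperoctahedral r)"
      by (rule inj_on_subset[of _ UNIV]) (simp_all add: fun.inj_map inj)
    ultimately show ?thesis by (simp add: card_image)
  qed
  have "(\<Sum>\<sigma>\<in>?S. pfaffian_term r M \<sigma>) =
      (\<Sum>m \<in> matching r ` pfaffian_perms r. \<Sum>\<sigma> \<in> {\<sigma> \<in> ?S. matching r \<sigma> = m}. pfaffian_term r M \<sigma>)"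
  proof (rule sum.group[symmetric])
    show "matching r ` ?S \<subseteq> matching r ` pfaffian_perms r"
    proof (rule image_subsetI)
      fix \<sigma> assume "\<sigma> \<in> ?S"
      then have "\<sigma> permutes {1..2*r}" by simp
      from exists_canonical_perm[of M, OF skew this] obtain \<rho>
        where "\<rho> \<in> pfaffian_perms r" "matching r \<rho> = matching r \<sigma>" by blast
      then show "matching r \<sigma> \<in> matching r ` pfaffian_perms r" by (metis imageI)
    qed
  qed (use fin finc in auto)
  also have "\<dots> = (\<Sum>\<rho> \<in> pfaffian_perms r. \<Sum>\<sigma> \<in> {\<sigma> \<in> ?S. matching r \<sigma> = matching r \<rho>}. pfaffian_term r M \<sigma>)"
    by (rule sum.reindex[OF inj_on_matching, simplified comp_def])
  also have "\<dots> = (\<Sum>\<rho> \<in> pfaffian_perms r. of_nat (card (hyperoctahedral r)) * pfaffian_term r M \<rho>)"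
  proof (rule sum.cong[OF refl])
    fix \<rho> assume \<rho>: "\<rho> \<in> pfaffian_perms r"
    have "pfaffian_term r M \<sigma> = pfaffian_term r M \<rho>"
      if "\<sigma> \<in> {\<sigma> \<in> ?S. matching r \<sigma> = matching r \<rho>}" for \<sigma>
    proof -
      have \<sigma>: "\<sigma> permutes {1..2*r}" "matching r \<sigma> = matching r \<rho>" using that by simp_all
      from exists_canonical_perm[of M, OF skew \<sigma>(1)] obtain \<tau>
        where \<tau>: "\<tau> \<in> pfaffian_perms r" "matching r \<tau> = matching r \<sigma>"
          "pfaffian_term r M \<tau> = pfaffian_term r M \<sigma>" by blast
      have "\<tau> = \<rho>" using inj_onD[OF inj_on_matching _ \<tau>(1) \<rho>] \<tau>(2) \<sigma>(2) by simp
      then show ?thesis using \<tau>(3) by simp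
    qed
    then have "(\<Sum>\<sigma> \<in> {\<sigma> \<in> ?S. matching r \<sigma> = matching r \<rho>}. pfaffian_term r M \<sigma>)
        = (\<Sum>\<sigma> \<in> {\<sigma> \<in> ?S. matching r \<sigma> = matching r \<rho>}. pfaffian_term r M \<rho>)"
      by (rule sum.cong[OF refl])
    also have "\<dots> = of_nat (card (hyperoctahedral r)) * pfaffian_term r M \<rho>"
      using fibre \<rho> sub by (subst sum_constant) auto
    finally show "(\<Sum>\<sigma> \<in> {\<sigma> \<in> ?S. matching r \<sigma> = matching r \<rho>}. pfaffian_term r M \<sigma>) =
      of_nat (card (hyperoctahedral r)) * pfaffian_term r M \<rho>" .
  qed
  also have "\<dots> = of_nat (card (hyperoctahedral r)) * pfaffian r M"
    by (simp add: pfaffian_eq_sum_terms sum_distrib_left)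
  finally show ?thesis .
qed

lemma card_hyperoctahedral_pos: "card (hyperoctahedral r) > 0"
proof -
  have "finite (hyperoctahedral r)"
    by (rule finite_subset[OF _ finite_permutations[of "{1..2*r}"]]) (auto simp: hyperoctahedral_def)
  moreover have "id \<in> hyperoctahedral r" by (simp add: hyperoctahedral_def permutes_id)
  ultimately show ?thesis by (auto simp: card_gt_0_iff)
qed

section \<open>Determinants and the congruence rule for pfaffians\<close>

definition detf :: "nat \<Rightarrow> (nat \<Rightarrow> nat \<Rightarrow> 'b::comm_ring_1) \<Rightarrow> 'b" where
  "detf m U = (\<Sum>\<sigma> | \<sigma> permutes {1..m}. of_int (sign \<sigma>) * (\<Prod>j = 1..m. U (\<sigma> j) j))"

lemma prod_pairs:
  fixes h :: "nat \<Rightarrow> 'b::comm_monoid_mult"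
  shows "(\<Prod>j = 1..2*r. h j) = (\<Prod>i = 1..r. h (2*i - 1) * h (2*i))"
  by (induction r) (simp_all add: ac_simps)

lemma sum_pairs:
  fixes h :: "nat \<Rightarrow> 'b::comm_monoid_add"
  shows "(\<Sum>j = 1..2*r. h j) = (\<Sum>i = 1..r. h (2*i - 1) + h (2*i))"
  by (induction r) (simp_all add: ac_simps)

lemma sum_perms_sign_comp:
  fixes F :: "(nat \<Rightarrow> nat) \<Rightarrow> 'b::comm_ring_1"
  assumes \<tau>: "\<tau> permutes {1..m}"
  shows "(\<Sum>\<sigma> | \<sigma> permutes {1..m}. of_int (sign \<sigma>) * F (\<sigma> \<circ> \<tau>)) =
    of_int (sign \<tau>) * (\<Sum>\<sigma> | \<sigma> permutes {1..m}. of_int (sign \<sigma>) * F \<sigma>)"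
proof -
  have "of_int (sign \<tau>) * (\<Sum>\<sigma> | \<sigma> permutes {1..m}. of_int (sign \<sigma>) * F \<sigma>)
     = (\<Sum>\<sigma> | \<sigma> permutes {1..m}. of_int (sign \<tau>) * (of_int (sign \<sigma>) * F \<sigma>))"
    by (rule sum_distrib_left)
  also have "\<dots> = (\<Sum>\<sigma> | \<sigma> permutes {1..m}. of_int (sign \<tau>) * (of_int (sign (\<sigma> \<circ> \<tau>)) * F (\<sigma> \<circ> \<tau>)))"
    by (rule sum_permutations_compose_right[OF \<tau>])
  also have "\<dots> = (\<Sum>\<sigma> | \<sigma> permutes {1..m}. of_int (sign \<sigma>) * F (\<sigma> \<circ> \<tau>))"
  proof (rule sum.cong[OF refl])
    fix \<sigma> assume "\<sigma> \<in> {\<sigma>. \<sigma> permutes {1..m}}"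
    then have "permutation \<sigma>" "permutation \<tau>" using \<tau> permutation_permutes by blast+
    then have "sign \<tau> * sign (\<sigma> \<circ> \<tau>) = sign \<sigma>"
      by (simp add: sign_compose mult.commute mult.assoc)
    then show "of_int (sign \<tau>) * (of_int (sign (\<sigma> \<circ> \<tau>)) * F (\<sigma> \<circ> \<tau>)) = of_int (sign \<sigma>) * F (\<sigma> \<circ> \<tau>)"
      by (metis mult.assoc of_int_mult)
  qed
  finally show ?thesis by simp
qed

lemma detf_one: "detf m (\<lambda>i j. of_bool (i = j)) = (1 :: 'b::comm_ring_1)"
    proof -
      have *: "(\<Prod>j = 1..m. of_bool (\<sigma> j = j) :: 'b) = of_bool (\<sigma> = id)" if "\<sigma> permutes {1..m}" for \<sigma>
      proof (cases "\<sigma> = id")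
        case False
        then obtain j where "\<sigma> j \<noteq> j" by fastforce
        moreover have "j \<in> {1..m}" using permutes_not_in[OF that, of j] \<open>\<sigma> j \<noteq> j\<close> by blast
        ultimately have "(\<Prod>j = 1..m. of_bool (\<sigma> j = j) :: 'b) = 0" by (intro prod_zero) auto
        with False show ?thesis by simp
      qed simp
      have "detf m (\<lambda>i j. of_bool (i = j) :: 'b) = (\<Sum>\<sigma> | \<sigma> permutes {1..m}. of_int (sign \<sigma>) * of_bool (\<sigma> = id))"
        unfolding detf_def by (rule sum.cong[OF refl]) (use * in \<open>simp only: mem_Collect_eq\<close>)
      also have "\<dots> = (\<Sum>\<sigma> \<in> {id :: nat \<Rightarrow> nat}. of_int (sign \<sigma>) * of_bool (\<sigma> = id))"
        by (rule sum.mono_neutral_right) (simp_all add: finite_permutations permutes_id)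
      finally show ?thesis by simp
    qed

text \<open>The sum is alternating in the columns picked by \<open>g\<close>: for injective
  \<open>g\<close> it is \<open>\<plusminus>\<close> the determinant, and otherwise it equals its
  own negative, which is where \<open>tf\<close> enters. The factor is left as the same sum for the
  identity matrix, since only its independence of \<open>U\<close> matters later.\<close>

lemma detf_columns:
  fixes U :: "nat \<Rightarrow> nat \<Rightarrow> 'b::comm_ring_1"
  assumes g: "g ` {1..m} \<subseteq> {1..m}" and tf: "\<And>x::'b. x + x = 0 \<Longrightarrow> x = 0"
  shows "(\<Sum>\<sigma> | \<sigma> permutes {1..m}. of_int (sign \<sigma>) * (\<Prod>j = 1..m. U (\<sigma> j) (g j))) =
    (\<Sum>\<sigma> | \<sigma> permutes {1..m}. of_int (sign \<sigma>) * (\<Prod>j = 1..m. of_bool (\<sigma> j = g j))) * detf m U"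
proof -
  let ?A = "\<lambda>U :: nat \<Rightarrow> nat \<Rightarrow> 'b. \<Sum>\<sigma> | \<sigma> permutes {1..m}. of_int (sign \<sigma>) * (\<Prod>j = 1..m. U (\<sigma> j) (g j))"
  show ?thesis
  proof (cases "inj_on g {1..m}")
    case True
    define \<tau> where "\<tau> = (\<lambda>j. if j \<in> {1..m} then g j else j)"
    have \<tau>: "\<tau> permutes {1..m}"
    proof (rule bij_imp_permutes)
      have "bij_betw g {1..m} {1..m}" using True g by (simp add: bij_betw_def endo_inj_surj)
      then show "bij_betw \<tau> {1..m} {1..m}" by (rule bij_betw_cong[THEN iffD1, rotated]) (simp add: \<tau>_def)
    qed (auto simp: \<tau>_def)
    have A: "?A U = of_int (sign \<tau>) * detf m U" for U
    proof -
      have \<tau>': "inv_into UNIV \<tau> permutes {1..m}" using \<tau> by (rule permutes_inv)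
      have "(\<Prod>j = 1..m. U (\<sigma> j) (g j)) = (\<Prod>j = 1..m. U ((\<sigma> \<circ> inv_into UNIV \<tau>) j) j)" for \<sigma>
      proof -
        have "(\<Prod>j = 1..m. U ((\<sigma> \<circ> inv_into UNIV \<tau>) j) j)
            = (\<Prod>j = 1..m. U ((\<sigma> \<circ> inv_into UNIV \<tau>) (\<tau> j)) (\<tau> j))"
          using prod.permute[OF \<tau>, of "\<lambda>j. U ((\<sigma> \<circ> inv_into UNIV \<tau>) j) j"] by (simp add: comp_def)
        also have "\<dots> = (\<Prod>j = 1..m. U (\<sigma> j) (g j))"
        proof (rule prod.cong[OF refl])
          fix j assume "j \<in> {1..m}"
          then have "\<tau> j = g j" by (simp add: \<tau>_def)
          then show "U ((\<sigma> \<circ> inv_into UNIV \<tau>) (\<tau> j)) (\<tau> j) = U (\<sigma> j) (g j)"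
            using permutes_inverses(2)[OF \<tau>, of j] by simp
        qed
        finally show ?thesis by simp
      qed
      then have "?A U = of_int (sign (inv_into UNIV \<tau>)) * detf m U"
        unfolding detf_def
        using sum_perms_sign_comp[OF \<tau>', of "\<lambda>\<sigma>. \<Prod>j = 1..m. U (\<sigma> j) j"] by simp
      also have "sign (inv_into UNIV \<tau>) = sign \<tau>"
        using \<tau> permutation_permutes by (intro sign_inverse) blast
      finally show ?thesis .
    qed
    with A[of U] A[of "\<lambda>i j. of_bool (i = j)"] show ?thesis by (simp add: detf_one)
  next
    case False
    then obtain a b where ab: "a \<in> {1..m}" "b \<in> {1..m}" "a \<noteq> b" "g a = g b"
      by (auto simp: inj_on_def)
    define t where "t = transpose a b"
    have t: "t permutes {1..m}" unfolding t_def using ab by (intro permutes_swap_id)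
    have A: "?A U = 0" for U :: "nat \<Rightarrow> nat \<Rightarrow> 'b"
    proof -
      have "(\<Prod>j = 1..m. U ((\<sigma> \<circ> t) j) (g j)) = (\<Prod>j = 1..m. U (\<sigma> j) (g j))" for \<sigma>
      proof -
        have "(\<Prod>j = 1..m. U (\<sigma> j) (g j)) = (\<Prod>j = 1..m. U (\<sigma> (t j)) (g (t j)))"
          using prod.permute[OF t, of "\<lambda>j. U (\<sigma> j) (g j)"] by (simp add: comp_def)
        also have "\<dots> = (\<Prod>j = 1..m. U (\<sigma> (t j)) (g j))"
          using ab by (intro prod.cong) (auto simp: t_def transpose_def)
        finally show ?thesis by simp
      qed
      then have "?A U = of_int (sign t) * ?A U"
        using sum_perms_sign_comp[OF t, of "\<lambda>\<sigma>. \<Prod>j = 1..m. U (\<sigma> j) (g j)"] by simp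
      also have "sign t = -1" using ab by (simp add: t_def sign_swap_id)
      finally have "?A U + ?A U = 0" by (simp add: eq_neg_iff_add_eq_0)
      then show ?thesis by (rule tf)
    qed
    show ?thesis using A[of U] A[of "\<lambda>i j. of_bool (i = j)"] by simp
  qed
qed

text \<open>Direct sum of 2 x 2 skew blocks, the \<open>l\<close>-th one with entry
  \<open>d l\<close> in row \<open>2l - 1\<close> and column \<open>2l\<close>.\<close>

definition blockdiag :: "(nat \<Rightarrow> 'b::comm_ring_1) \<Rightarrow> nat \<Rightarrow> nat \<Rightarrow> 'b" where
  "blockdiag d p q = (if odd p \<and> q = p + 1 then d ((p + 1) div 2)
     else if odd q \<and> p = q + 1 then - d (p div 2) else 0)"

text \<open>A nonzero term forces every pair to be \<open>{c, c + 1}\<close> with \<open>c\<close>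
  odd. As the first elements increase, this gives \<open>\<sigma> j \<ge> j\<close> for all
  \<open>j\<close>, so only the identity contributes.\<close>

lemma pfaffian_blockdiag: "pfaffian r (blockdiag d) = (\<Prod>i = 1..r. d i)"
proof -
  have idp: "id \<in> pfaffian_perms r" by (auto simp: pfaffian_perms_def permutes_id)
  have fin: "finite (pfaffian_perms r)"
    by (rule finite_subset[OF _ finite_permutations[of "{1..2*r}"]]) (auto simp: pfaffian_perms_def)
  have "pfaffian_term r (blockdiag d) \<sigma> = 0" if \<sigma>: "\<sigma> \<in> pfaffian_perms r" "\<sigma> \<noteq> id" for \<sigma>
  proof (rule ccontr)
    assume nz: "pfaffian_term r (blockdiag d) \<sigma> \<noteq> 0"
    have perm: "\<sigma> permutes {1..2*r}" using \<sigma> by (simp add: pfaffian_perms_def)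
    have *: "odd (\<sigma> (2*i - 1)) \<and> \<sigma> (2*i) = \<sigma> (2*i - 1) + 1" if i: "i \<in> {1..r}" for i
    proof -
      have "blockdiag d (\<sigma> (2*i - 1)) (\<sigma> (2*i)) \<noteq> 0"
      proof
        assume "blockdiag d (\<sigma> (2*i - 1)) (\<sigma> (2*i)) = 0"
        then have "(\<Prod>i = 1..r. blockdiag d (\<sigma> (2*i - 1)) (\<sigma> (2*i))) = 0"
          using i by (intro prod_zero) auto
        with nz show False by (simp add: pfaffian_term_def)
      qed
      moreover have "\<sigma> (2*i - 1) < \<sigma> (2*i)" using \<sigma> i by (simp add: pfaffian_perms_def)
      ultimately show ?thesis by (auto simp: blockdiag_def split: if_splits)
    qed
    \<comment> \<open>Consecutive first elements are odd and increasing, hence differ by at least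
      two.\<close>
    have ge: "\<sigma> (2*i - 1) \<ge> 2*i - 1" if "i \<in> {1..r}" for i
      using that
    proof (induction i)
      case (Suc i)
      show ?case
      proof (cases "i = 0")
        case True
        have "odd (\<sigma> (2 * Suc i - 1))" using *[OF Suc.prems] by blast
        then show ?thesis using True odd_pos[of "\<sigma> 1"] by simp
      next
        case False
        then have i: "i \<in> {1..r}" "i \<in> {1..<r}" using Suc.prems by auto
        have "\<sigma> (2*i - 1) < \<sigma> (2*i + 1)" using \<sigma> i(2) unfolding pfaffian_perms_def by blast
        moreover have "2*i - 1 \<le> \<sigma> (2*i - 1)" using Suc.IH[OF i(1)] .
        moreover have "odd (\<sigma> (2*i - 1))" using *[OF i(1)] by blast
        moreover have "odd (\<sigma> (2*i + 1))" using *[OF Suc.prems] by simp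
        ultimately have "\<sigma> (2*i + 1) \<ge> \<sigma> (2*i - 1) + 2" by presburger
        then show ?thesis using \<open>2*i - 1 \<le> \<sigma> (2*i - 1)\<close> False by simp
      qed
    qed simp
    have "\<forall>j\<in>{1..2*r}. \<sigma> j \<ge> j"
    proof
      fix j assume j: "j \<in> {1..2*r}"
      show "\<sigma> j \<ge> j"
      proof (cases "even j")
        case True
        then obtain i where "j = 2*i" by (elim evenE)
        then show ?thesis using j ge[of i] *[of i] by auto
      next
        case False
        then obtain i where "j = 2*i + 1" by (elim oddE)
        then show ?thesis using j ge[of "Suc i"] by auto
      qed
    qed
    then have "\<sigma> = id" by (rule permutes_natset_ge[OF perm])
    with \<sigma> show False by simp
  qed
  then have "pfaffian r (blockdiag d) = (\<Sum>\<sigma>\<in>{id}. pfaffian_term r (blockdiag d) \<sigma>)"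
    unfolding pfaffian_eq_sum_terms using fin idp by (intro sum.mono_neutral_right) auto
  also have "\<dots> = (\<Prod>i = 1..r. blockdiag d (2*i - 1) (2*i))" by (simp add: pfaffian_term_def)
  also have "\<dots> = (\<Prod>i = 1..r. d i)" by (intro prod.cong) (auto simp: blockdiag_def)
  finally show ?thesis .
qed

text \<open>The entry \<open>(a, b)\<close> of \<open>U B U^T\<close> for
  \<open>B = blockdiag d\<close>: each block of \<open>B\<close> pairs two neighbouring columns of
  \<open>U\<close> into a wedge.\<close>

lemma blockdiag_congruence:
  fixes U :: "nat \<Rightarrow> nat \<Rightarrow> 'b::comm_ring_1"
  shows "(\<Sum>p = 1..2*r. \<Sum>q = 1..2*r. U a p * blockdiag d p q * U b q) =
    (\<Sum>l = 1..r. d l * dec (\<lambda>i. U i (2*l - 1)) (\<lambda>i. U i (2*l)) a b)"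
proof -
  have 1: "(\<Sum>q = 1..2*r. U a (2*l - 1) * blockdiag d (2*l - 1) q * U b q) = U a (2*l - 1) * d l * U b (2*l)"
    if "l \<in> {1..r}" for l
  proof -
    have "(\<Sum>q = 1..2*r. U a (2*l - 1) * blockdiag d (2*l - 1) q * U b q)
       = (\<Sum>q \<in> {2*l}. U a (2*l - 1) * blockdiag d (2*l - 1) q * U b q)"
    proof (rule sum.mono_neutral_right)
      show "\<forall>q\<in>{1..2*r} - {2*l}. U a (2*l - 1) * blockdiag d (2*l - 1) q * U b q = 0"
      proof
        fix q assume "q \<in> {1..2*r} - {2*l}"
        moreover have "\<not> (odd q \<and> 2*l - 1 = q + 1)" by presburger
        ultimately show "U a (2*l - 1) * blockdiag d (2*l - 1) q * U b q = 0"
          using that unfolding blockdiag_def by auto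
      qed
    qed (use that in auto)
    then show ?thesis using that by (simp add: blockdiag_def)
  qed
  have 2: "(\<Sum>q = 1..2*r. U a (2*l) * blockdiag d (2*l) q * U b q) = - (U a (2*l) * d l * U b (2*l - 1))"
    if "l \<in> {1..r}" for l
  proof -
    have "(\<Sum>q = 1..2*r. U a (2*l) * blockdiag d (2*l) q * U b q)
       = (\<Sum>q \<in> {2*l - 1}. U a (2*l) * blockdiag d (2*l) q * U b q)"
    proof (rule sum.mono_neutral_right)
      show "\<forall>q\<in>{1..2*r} - {2*l - 1}. U a (2*l) * blockdiag d (2*l) q * U b q = 0"
        using that by (auto simp: blockdiag_def)
    qed (use that in auto)
    then show ?thesis using that by (auto simp: blockdiag_def)
  qed
  show ?thesis
    unfolding sum_pairs[of "\<lambda>p. \<Sum>q = 1..2*r. U a p * blockdiag d p q * U b q"]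
  proof (rule sum.cong[OF refl])
    fix l assume "l \<in> {1..r}"
    then show "(\<Sum>q = 1..2*r. U a (2*l - 1) * blockdiag d (2*l - 1) q * U b q) +
         (\<Sum>q = 1..2*r. U a (2*l) * blockdiag d (2*l) q * U b q) =
         d l * dec (\<lambda>i. U i (2*l - 1)) (\<lambda>i. U i (2*l)) a b"
      unfolding 1[OF \<open>l \<in> {1..r}\<close>] 2[OF \<open>l \<in> {1..r}\<close>] by (simp add: dec_def algebra_simps)
  qed
qed

text \<open>For skew \<open>D\<close> this is \<open>pf(U D U^T) = det U pf D\<close> times the
  order of the stabiliser. Summing over all permutations makes the expression alternating in the
  chosen columns, so expansion yields \<open>det U\<close> times a constant that does not depend on
  \<open>U\<close>; the case where \<open>U\<close> is the identity identifies the constant.\<close>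

lemma sum_pfaffian_term_congruence:
  fixes U D :: "nat \<Rightarrow> nat \<Rightarrow> 'b::comm_ring_1"
  assumes tf: "\<And>x::'b. x + x = 0 \<Longrightarrow> x = 0"
  shows "(\<Sum>\<sigma> | \<sigma> permutes {1..2*r}.
        pfaffian_term r (\<lambda>a b. \<Sum>p = 1..2*r. \<Sum>q = 1..2*r. U a p * D p q * U b q) \<sigma>) =
      detf (2*r) U * (\<Sum>\<sigma> | \<sigma> permutes {1..2*r}. pfaffian_term r D \<sigma>)"
proof -
  let ?S = "{1..2*r} \<times> {1..2*r}"
  let ?F = "PiE {1..r} (\<lambda>_. ?S)"
  let ?P = "\<lambda>U :: nat \<Rightarrow> nat \<Rightarrow> 'b. \<Sum>\<sigma> | \<sigma> permutes {1..2*r}.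
        pfaffian_term r (\<lambda>a b. \<Sum>p = 1..2*r. \<Sum>q = 1..2*r. U a p * D p q * U b q) \<sigma>"
  \<comment> \<open>An index pair chosen for each of the \<open>r\<close> factors, read as a list of
    \<open>2r\<close> column indices.\<close>
  let ?g = "\<lambda>f :: nat \<Rightarrow> nat \<times> nat. \<lambda>j. if odd j then fst (f ((j + 1) div 2)) else snd (f (j div 2))"
  let ?A = "\<lambda>(U :: nat \<Rightarrow> nat \<Rightarrow> 'b) g. \<Sum>\<sigma> | \<sigma> permutes {1..2*r}. of_int (sign \<sigma>) * (\<Prod>j = 1..2*r. U (\<sigma> j) (g j))"
  define c where "c = (\<Sum>f\<in>?F. (\<Prod>i = 1..r. D (fst (f i)) (snd (f i))) *
    (\<Sum>\<sigma> | \<sigma> permutes {1..2*r}. of_int (sign \<sigma>) * (\<Prod>j = 1..2*r. of_bool (\<sigma> j = ?g f j))))"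
  have main: "?P U = c * detf (2*r) U" for U
  proof -
    have "pfaffian_term r (\<lambda>a b. \<Sum>p = 1..2*r. \<Sum>q = 1..2*r. U a p * D p q * U b q) \<sigma> =
       (\<Sum>f\<in>?F. (\<Prod>i = 1..r. D (fst (f i)) (snd (f i))) * (of_int (sign \<sigma>) * (\<Prod>j = 1..2*r. U (\<sigma> j) (?g f j))))"
      for \<sigma>
    proof -
      have "(\<Prod>i = 1..r. \<Sum>p = 1..2*r. \<Sum>q = 1..2*r. U (\<sigma> (2*i - 1)) p * D p q * U (\<sigma> (2*i)) q)
        = (\<Prod>i = 1..r. \<Sum>z\<in>?S. U (\<sigma> (2*i - 1)) (fst z) * D (fst z) (snd z) * U (\<sigma> (2*i)) (snd z))"
        by (simp add: sum.cartesian_product case_prod_beta)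
      also have "\<dots> = (\<Sum>f\<in>?F. \<Prod>i = 1..r. U (\<sigma> (2*i - 1)) (fst (f i)) * D (fst (f i)) (snd (f i)) * U (\<sigma> (2*i)) (snd (f i)))"
        by (rule prod_sum_PiE) auto
      also have "\<dots> = (\<Sum>f\<in>?F. (\<Prod>i = 1..r. D (fst (f i)) (snd (f i))) * (\<Prod>j = 1..2*r. U (\<sigma> j) (?g f j)))"
      proof (rule sum.cong[OF refl])
        fix f
        have "(\<Prod>j = 1..2*r. U (\<sigma> j) (?g f j)) = (\<Prod>i = 1..r. U (\<sigma> (2*i - 1)) (fst (f i)) * U (\<sigma> (2*i)) (snd (f i)))"
          unfolding prod_pairs by (rule prod.cong) auto
        then show "(\<Prod>i = 1..r. U (\<sigma> (2*i - 1)) (fst (f i)) * D (fst (f i)) (snd (f i)) * U (\<sigma> (2*i)) (snd (f i)))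
          = (\<Prod>i = 1..r. D (fst (f i)) (snd (f i))) * (\<Prod>j = 1..2*r. U (\<sigma> j) (?g f j))"
          by (simp add: prod.distrib ac_simps)
      qed
      finally show ?thesis unfolding pfaffian_term_def by (simp add: sum_distrib_left ac_simps)
    qed
    then have "?P U = (\<Sum>\<sigma> | \<sigma> permutes {1..2*r}. \<Sum>f\<in>?F. (\<Prod>i = 1..r. D (fst (f i)) (snd (f i))) *
        (of_int (sign \<sigma>) * (\<Prod>j = 1..2*r. U (\<sigma> j) (?g f j))))" by simp
    also have "\<dots> = (\<Sum>f\<in>?F. (\<Prod>i = 1..r. D (fst (f i)) (snd (f i))) * ?A U (?g f))"
      unfolding sum_distrib_left by (rule sum.swap)
    also have "\<dots> = (\<Sum>f\<in>?F. (\<Prod>i = 1..r. D (fst (f i)) (snd (f i))) *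
        ((\<Sum>\<sigma> | \<sigma> permutes {1..2*r}. of_int (sign \<sigma>) * (\<Prod>j = 1..2*r. of_bool (\<sigma> j = ?g f j))) * detf (2*r) U))"
    proof (rule sum.cong[OF refl], rule arg_cong2[where f = "(*)", OF refl])
      fix f assume f: "f \<in> ?F"
      have "?g f ` {1..2*r} \<subseteq> {1..2*r}"
      proof (rule image_subsetI)
        fix j assume j: "j \<in> {1..2*r}"
        have "(j + 1) div 2 \<in> {1..r}" "even j \<Longrightarrow> j div 2 \<in> {1..r}" using j by auto
        then have "f ((j + 1) div 2) \<in> ?S" "even j \<Longrightarrow> f (j div 2) \<in> ?S"
          by (blast intro: PiE_mem[OF f])+
        then show "?g f j \<in> {1..2*r}" by (cases "even j") (simp_all add: mem_Times_iff del: atLeastAtMost_iff)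
      qed
      then show "?A U (?g f) =
        (\<Sum>\<sigma> | \<sigma> permutes {1..2*r}. of_int (sign \<sigma>) * (\<Prod>j = 1..2*r. of_bool (\<sigma> j = ?g f j))) * detf (2*r) U"
        by (rule detf_columns[OF _ tf])
    qed
    also have "\<dots> = c * detf (2*r) U"
      unfolding c_def by (simp add: sum_distrib_right mult.assoc)
    finally show ?thesis .
  qed
  let ?I = "\<lambda>i j. of_bool (i = j) :: 'b"
  have "?P ?I = (\<Sum>\<sigma> | \<sigma> permutes {1..2*r}. pfaffian_term r D \<sigma>)"
  proof (rule sum.cong[OF refl], rule pfaffian_term_cong)
    fix i j assume "i \<in> {1..2*r}" "j \<in> {1..2*r}"
    then show "(\<Sum>p = 1..2*r. \<Sum>q = 1..2*r. of_bool (i = p) * D p q * of_bool (j = q)) = D i j"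
      by (simp add: of_bool_def if_distrib[of "\<lambda>x. x * _"] if_distrib[of "\<lambda>x. _ * x"] cong: if_cong)
  qed auto
  then show ?thesis using main[of U] main[of ?I] by (simp add: detf_one mult.commute)
qed

section \<open>Specialising identities from integer indeterminates to arbitrary rings\<close>

definition int_eval :: "('v \<Rightarrow> 'b::comm_ring_1) \<Rightarrow> ('v, int) mpoly \<Rightarrow> 'b" where
  "int_eval x p = (\<Sum>m \<in> Poly_Mapping.keys p.
     of_int (Poly_Mapping.lookup p m) * (\<Prod>v \<in> Poly_Mapping.keys m. x v ^ Poly_Mapping.lookup m v))"

lemma int_eval_add: "int_eval x (p + q) = int_eval x p + int_eval x q"
  unfolding int_eval_def by (rule setsum_keys_plus_distrib) (simp_all add: distrib_right)

lemma int_eval_single: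
  "int_eval x (Poly_Mapping.single m c) =
     of_int c * (\<Prod>v \<in> Poly_Mapping.keys m. x v ^ Poly_Mapping.lookup m v)"
  by (simp add: int_eval_def)

lemma int_eval_1: "int_eval x 1 = 1"
  by (simp add: int_eval_def lookup_one)

lemma int_eval_mvar: "int_eval x (mvar v) = x v"
  by (simp add: mvar_def int_eval_single)

lemma int_eval_mult: "int_eval x (p * q) = int_eval x p * int_eval x q"
proof (induction p rule: mpoly_induct)
  case (single m c)
  then show ?case
  proof (induction q rule: mpoly_induct)
    case (single m' c')
    then show ?case
      by (simp add: mult_single int_eval_single prod_powers_add ac_simps)
  next
    case (add q q')
    then show ?case
      by (simp add: distrib_left int_eval_add)
  qed
qed (simp add: int_eval_add distrib_right)

lemma int_mpoly_torsion_free: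
  fixes p :: "('v, int) mpoly"
  assumes "of_nat n * p = 0" "n > 0"
  shows "p = 0"
proof -
  have *: "Poly_Mapping.lookup (of_nat n * p) m = int n * Poly_Mapping.lookup p m" for m
    by (induction n) (simp_all add: distrib_right lookup_add)
  show ?thesis
    using *[unfolded assms(1)] assms(2) by (intro poly_mapping_eqI) simp
qed

text \<open>Applied to two homomorphisms: the specialisation \<open>int_eval x\<close>, and the
  evaluation of jet coefficients into power series.\<close>

lemma pfaffian_hom:
  fixes h :: "'b::comm_ring_1 \<Rightarrow> 'c::comm_ring_1"
  assumes add: "\<And>x y. h (x + y) = h x + h y" and mult: "\<And>x y. h (x * y) = h x * h y" and one: "h 1 = 1"
  shows "h (pfaffian r M) = pfaffian r (\<lambda>i j. h (M i j))"
    and "h (detf m M) = detf m (\<lambda>i j. h (M i j))"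
    and "h (prod f I) = (\<Prod>i\<in>I. h (f i))"
    and "h (sum g J) = (\<Sum>i\<in>J. h (g i))"
    and "h (- x) = - h x"
proof -
  have zero: "h 0 = 0" using add[of 0 0] by simp
  show minus: "h (- x) = - h x" for x using add[of x "- x"] zero by (simp add: eq_neg_iff_add_eq_0 add.commute)
  show sum: "h (sum g J) = (\<Sum>i\<in>J. h (g i))" for g and J :: "'x set"
    by (induction J rule: infinite_finite_induct) (simp_all add: zero add)
  show prod: "h (prod f I) = (\<Prod>i\<in>I. h (f i))" for f and I :: "'x set"
    by (induction I rule: infinite_finite_induct) (simp_all add: one mult)
  have sgn: "h (of_int (sign \<sigma>)) = of_int (sign \<sigma>)" for \<sigma> :: "'x \<Rightarrow> 'x"
    by (cases \<sigma> rule: sign_cases) (simp_all add: one minus)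
  show "h (pfaffian r M) = pfaffian r (\<lambda>i j. h (M i j))" "h (detf m M) = detf m (\<lambda>i j. h (M i j))"
    by (simp_all add: pfaffian_def detf_def sum prod mult sgn)
qed

text \<open>
  Summing over all permutations counts every matching \<open>2\<^sup>r r!\<close> times, which can only be cancelled in a
  torsion-free ring. Hence the identity is proved for indeterminate entries over the integers first.
\<close>

theorem pfaffian_sum_dec:
  fixes U :: "nat \<Rightarrow> nat \<Rightarrow> 'b::comm_ring_1"
  shows "pfaffian r (\<lambda>a b. \<Sum>l = 1..r. d l * dec (\<lambda>i. U i (2*l - 1)) (\<lambda>i. U i (2*l)) a b) =
    (\<Prod>l = 1..r. d l) * detf (2*r) U"
proof -
  define V where "V = (\<lambda>i j. mvar (i, j) :: (nat \<times> nat, int) mpoly)"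
  \<comment> \<open>Rows and columns are numbered from 1, so the variables with first index 0 are
    free for the coefficients.\<close>
  define e where "e = (\<lambda>l. mvar (0, l) :: (nat \<times> nat, int) mpoly)"
  define M where "M = (\<lambda>a b. \<Sum>l = 1..r. e l * dec (\<lambda>i. V i (2*l - 1)) (\<lambda>i. V i (2*l)) a b)"
  let ?c = "of_nat (card (hyperoctahedral r)) :: (nat \<times> nat, int) mpoly"
  have "?c * pfaffian r M = (\<Sum>\<sigma> | \<sigma> permutes {1..2*r}. pfaffian_term r M \<sigma>)"
  proof (rule sum_perms_pfaffian_term[symmetric])
    show "M a b = - M b a" for a b
      unfolding M_def sum_negf[symmetric] by (rule sum.cong[OF refl]) (simp add: dec_def right_diff_distrib)
  qed
  also have "\<dots> = detf (2*r) V * (\<Sum>\<sigma> | \<sigma> permutes {1..2*r}. pfaffian_term r (blockdiag e) \<sigma>)"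
    unfolding M_def blockdiag_congruence[symmetric]
  proof (rule sum_pfaffian_term_congruence)
    fix p :: "(nat \<times> nat, int) mpoly" assume "p + p = 0"
    then have "of_nat 2 * p = 0" unfolding of_nat_numeral mult_2 .
    then show "p = 0" by (rule int_mpoly_torsion_free) simp
  qed
  also have "(\<Sum>\<sigma> | \<sigma> permutes {1..2*r}. pfaffian_term r (blockdiag e) \<sigma>) = ?c * pfaffian r (blockdiag e)"
  proof (rule sum_perms_pfaffian_term)
    show "blockdiag e a b = - blockdiag e b a" for a b by (auto simp: blockdiag_def)
  qed
  finally have "?c * (pfaffian r M - (\<Prod>l = 1..r. e l) * detf (2*r) V) = 0"
    by (simp add: pfaffian_blockdiag algebra_simps)
  then have main: "pfaffian r M = (\<Prod>l = 1..r. e l) * detf (2*r) V"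
    using int_mpoly_torsion_free card_hyperoctahedral_pos by (metis eq_iff_diff_eq_0)
  define x where "x = (\<lambda>(i, j). if i = 0 then d j else U i j)"
  note hom = pfaffian_hom[of "int_eval x", OF int_eval_add int_eval_mult int_eval_1]
  have "int_eval x (pfaffian r M) = pfaffian r (\<lambda>a b. int_eval x (M a b))" by (rule hom(1))
  also have "\<dots> = pfaffian r (\<lambda>a b. \<Sum>l = 1..r. d l * dec (\<lambda>i. U i (2*l - 1)) (\<lambda>i. U i (2*l)) a b)"
  proof (rule pfaffian_cong)
    fix a b assume "a \<in> {1..2*r}" "b \<in> {1..2*r}"
    then have "int_eval x (V a j) = U a j" "int_eval x (V b j) = U b j" for j
      by (simp_all add: V_def int_eval_mvar x_def)
    moreover have "int_eval x (e l) = d l" for l by (simp add: e_def int_eval_mvar x_def)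
    ultimately show "int_eval x (M a b) = (\<Sum>l = 1..r. d l * dec (\<lambda>i. U i (2*l - 1)) (\<lambda>i. U i (2*l)) a b)"
      unfolding M_def hom(4) by (simp add: int_eval_mult dec_def int_eval_add hom(5) diff_conv_add_uminus del: add_uminus_conv_diff)
  qed
  finally have 1: "int_eval x (pfaffian r M) =
    pfaffian r (\<lambda>a b. \<Sum>l = 1..r. d l * dec (\<lambda>i. U i (2*l - 1)) (\<lambda>i. U i (2*l)) a b)" .
  have "int_eval x (detf (2*r) V) = detf (2*r) (\<lambda>i j. int_eval x (V i j))" by (rule hom(2))
  also have "\<dots> = detf (2*r) U"
    unfolding detf_def
  proof (rule sum.cong[OF refl], rule arg_cong2[where f = "(*)", OF refl], rule prod.cong[OF refl])
    fix \<sigma> :: "nat \<Rightarrow> nat" and j assume "\<sigma> \<in> {\<sigma>. \<sigma> permutes {1..2*r}}" and j: "j \<in> {1..2*r}"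
    then have \<sigma>: "\<sigma> permutes {1..2*r}" by simp
    have "\<sigma> j \<in> {1..2*r}" by (simp only: permutes_in_image[OF \<sigma>] j)
    then show "int_eval x (V (\<sigma> j) j) = U (\<sigma> j) j" by (simp add: V_def int_eval_mvar x_def)
  qed
  finally have 2: "int_eval x (detf (2*r) V) = detf (2*r) U" .
  have 3: "int_eval x (\<Prod>l = 1..r. e l) = (\<Prod>l = 1..r. d l)"
    unfolding hom(3) by (simp add: e_def int_eval_mvar x_def)
  show ?thesis unfolding 1[symmetric] main int_eval_mult 2 3 ..
qed

text \<open>Entries of jets are known only modulo a power of \<open>t\<close>. Products are compared
  by exchanging one factor at a time.\<close>

lemma pfaffian_cong_dvd:
  fixes M :: "nat \<Rightarrow> nat \<Rightarrow> 'b::comm_ring_1"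
  assumes "\<And>i j. i \<in> {1..2*r} \<Longrightarrow> j \<in> {1..2*r} \<Longrightarrow> c dvd M i j - N i j"
  shows "c dvd pfaffian r M - pfaffian r N"
proof -
  have prod: "c dvd prod f I - prod g I" if "\<And>i. i \<in> I \<Longrightarrow> c dvd f i - g i"
    for f g :: "nat \<Rightarrow> 'b" and I
    using that
  proof (induction I rule: infinite_finite_induct)
    case (insert i I)
    have "prod f (insert i I) - prod g (insert i I) = (f i - g i) * prod f I + g i * (prod f I - prod g I)"
      using insert.hyps by (simp add: algebra_simps)
    also have "c dvd \<dots>" using insert by (intro dvd_add dvd_mult dvd_mult2) auto
    finally show ?case .
  qed simp_all
  show ?thesis
    unfolding pfaffian_eq_sum_terms sum_subtractf[symmetric]
  proof (rule dvd_sum)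
    fix \<sigma> assume "\<sigma> \<in> pfaffian_perms r"
    then have \<sigma>: "\<sigma> permutes {1..2*r}" by (simp add: pfaffian_perms_def)
    have "c dvd (\<Prod>i = 1..r. M (\<sigma> (2 * i - 1)) (\<sigma> (2 * i))) - (\<Prod>i = 1..r. N (\<sigma> (2 * i - 1)) (\<sigma> (2 * i)))"
      by (intro prod assms) (simp_all only: permutes_in_image[OF \<sigma>], auto)
    then show "c dvd pfaffian_term r M \<sigma> - pfaffian_term r N \<sigma>"
      unfolding pfaffian_term_def right_diff_distrib[symmetric] by (rule dvd_mult)
  qed
qed

text \<open>A nonzero term needs \<open>p^-1 (\<sigma> j) \<le> j\<close> for all \<open>j\<close>,
  and the identity is the only permutation with this property, so \<open>\<sigma> = p\<close>. The
  row permutation is there because pivots appear in elimination order, not in increasing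
  order.\<close>

lemma detf_unitriangular:
  fixes U :: "nat \<Rightarrow> nat \<Rightarrow> 'b::comm_ring_1"
  assumes p: "p permutes {1..m}" and one: "\<And>i. i \<in> {1..m} \<Longrightarrow> U (p i) i = 1"
    and zero: "\<And>i j. i \<in> {1..m} \<Longrightarrow> j \<in> {1..m} \<Longrightarrow> j < i \<Longrightarrow> U (p i) j = 0"
  shows "detf m U = of_int (sign p)"
proof -
  have z: "(\<Prod>j = 1..m. U (\<sigma> j) j) = 0" if \<sigma>: "\<sigma> permutes {1..m}" "\<sigma> \<noteq> p" for \<sigma>
  proof (rule ccontr)
    assume nz: "(\<Prod>j = 1..m. U (\<sigma> j) j) \<noteq> 0"
    have p': "inv_into UNIV p permutes {1..m}" using p by (rule permutes_inv)
    have "\<forall>j\<in>{1..m}. (inv_into UNIV p \<circ> \<sigma>) j \<le> j"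
    proof
      fix j assume j: "j \<in> {1..m}"
      define i where "i = inv_into UNIV p (\<sigma> j)"
      have i: "i \<in> {1..m}" "p i = \<sigma> j"
        unfolding i_def permutes_inverses(1)[OF p]
        by (simp_all only: permutes_in_image[OF p'] permutes_in_image[OF \<sigma>(1)] j)
      have "U (\<sigma> j) j \<noteq> 0"
      proof
        assume "U (\<sigma> j) j = 0"
        then have "(\<Prod>j = 1..m. U (\<sigma> j) j) = 0" using j by (intro prod_zero) auto
        with nz show False by simp
      qed
      then have "\<not> j < i" using zero[OF i(1) j] i(2) by auto
      then show "(inv_into UNIV p \<circ> \<sigma>) j \<le> j" by (simp add: i_def)
    qed
    then have "inv_into UNIV p \<circ> \<sigma> = id" by (rule permutes_natset_le[OF permutes_compose[OF \<sigma>(1) p']])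
    then have "p \<circ> (inv_into UNIV p \<circ> \<sigma>) = p" by simp
    then have "\<sigma> = p" using permutes_inv_o(1)[OF p] by (metis comp_assoc id_comp)
    with \<sigma> show False by simp
  qed
  have "detf m U = (\<Sum>\<sigma>\<in>{p}. of_int (sign \<sigma>) * (\<Prod>j = 1..m. U (\<sigma> j) j))"
    unfolding detf_def
  proof (rule sum.mono_neutral_right)
    show "\<forall>\<sigma>\<in>{\<sigma>. \<sigma> permutes {1..m}} - {p}. of_int (sign \<sigma>) * (\<Prod>j = 1..m. U (\<sigma> j) j) = 0"
      using z by simp
  qed (use p in \<open>auto simp: finite_permutations\<close>)
  then show ?thesis using one by simp
qed

section \<open>Zariski closures and polynomial curves\<close>

text \<open>Over a finite field, one plus the product of all \<open>X - a\<close> is a nonconstant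
  polynomial without roots.\<close>

lemma infinite_alg_closed: "infinite (UNIV :: 'a::alg_closed_field set)"
proof
  assume fin: "finite (UNIV :: 'a set)"
  define p where "p = (\<Prod>a\<in>(UNIV::'a set). [:- a, 1:]) + 1"
  have d: "degree (\<Prod>a\<in>(UNIV::'a set). [:- a, 1:]) = card (UNIV::'a set)"
    by (subst degree_prod_eq_sum_degree) auto
  have "degree p = card (UNIV::'a set)"
    unfolding p_def using d fin by (subst degree_add_eq_left) (auto simp: card_gt_0_iff)
  then have "degree p > 0" using fin by (simp add: card_gt_0_iff)
  then obtain x where "poly p x = 0" using alg_closed_imp_poly_has_root by blast
  moreover have "poly p x = 1" using fin by (simp add: p_def poly_prod)
  ultimately show False by simp
qed

text \<open>Every coordinate has to be polynomial in the parameter, also outside \<open>V\<close>;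
  the curves below have the constant value \<open>undefined\<close> there.\<close>

definition poly_curve :: "('a::comm_ring_1 \<Rightarrow> 'v \<Rightarrow> 'a) \<Rightarrow> bool" where
  "poly_curve c \<longleftrightarrow> (\<exists>p. \<forall>s v. c s v = poly (p v) s)"

lemma eval_poly_curve:
  assumes "poly_curve c"
  obtains q where "\<And>s. eval_mpoly (c s) f = poly q s"
proof -
  obtain p where p: "\<And>s v. c s v = poly (p v) s" using assms by (auto simp: poly_curve_def)
  show thesis
    by (rule that[of "\<Sum>m \<in> Poly_Mapping.keys f. [:Poly_Mapping.lookup f m:] *
        (\<Prod>v \<in> Poly_Mapping.keys m. p v ^ Poly_Mapping.lookup m v)"])
      (simp add: eval_mpoly_def p poly_sum poly_prod)
qed

lemma poly_infinite_zeros: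
  fixes q :: "'a::idom poly"
  assumes "infinite A" "\<And>s. s \<in> A \<Longrightarrow> poly q s = 0"
  shows "q = 0"
proof (rule ccontr)
  assume "q \<noteq> 0"
  then have "finite {s. poly q s = 0}" by (rule poly_roots_finite)
  with assms show False by (meson finite_subset mem_Collect_eq subsetI)
qed

definition zclosure :: "'v set \<Rightarrow> ('v \<Rightarrow> 'a::comm_ring_1) set \<Rightarrow> ('v \<Rightarrow> 'a) set" where
  "zclosure V S = zero_locus V {f \<in> carrier (mpoly_ring V). \<forall>x\<in>S. eval_mpoly x f = 0}"

lemma zclosureI:
  assumes "x \<in> affine_space V"
    "\<And>f. f \<in> carrier (mpoly_ring V) \<Longrightarrow> (\<And>y. y \<in> S \<Longrightarrow> eval_mpoly y f = 0) \<Longrightarrow> eval_mpoly x f = 0"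
  shows "x \<in> zclosure V S"
  using assms unfolding zclosure_def zero_locus_def by blast

lemma zclosureD:
  assumes "x \<in> zclosure V S" "f \<in> carrier (mpoly_ring V)" "\<And>y. y \<in> S \<Longrightarrow> eval_mpoly y f = 0"
  shows "eval_mpoly x f = 0"
  using assms unfolding zclosure_def zero_locus_def by blast

lemma zclosure_affine: "zclosure V S \<subseteq> affine_space V"
  by (auto simp: zclosure_def zero_locus_def)

lemma zclosure_superset: "S \<subseteq> affine_space V \<Longrightarrow> S \<subseteq> zclosure V S"
  by (auto simp: zclosure_def zero_locus_def)

text \<open>With \<open>S\<close> inside the closure of \<open>T\<close>, not just inside
  \<open>T\<close>, this also covers idempotence of the closure.\<close>

lemma zclosure_mono:
  assumes "S \<subseteq> zclosure V T"
  shows "zclosure V S \<subseteq> zclosure V T"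
proof
  fix x assume x: "x \<in> zclosure V S"
  show "x \<in> zclosure V T"
  proof (rule zclosureI)
    show "x \<in> affine_space V" using x zclosure_affine by blast
    fix f assume f: "f \<in> carrier (mpoly_ring V)" "\<And>y. y \<in> T \<Longrightarrow> eval_mpoly y f = 0"
    show "eval_mpoly x f = 0"
      using x f(1)
    proof (rule zclosureD)
      fix y assume "y \<in> S"
      then have "y \<in> zclosure V T" using assms by blast
      then show "eval_mpoly y f = 0" using f by (rule zclosureD)
    qed
  qed
qed

lemma closedin_zclosure: "closedin (zariski V) (zclosure V (S :: ('v \<Rightarrow> 'a::field) set))"
  unfolding closedin_zariski zclosure_def by (intro exI conjI, rule Collect_restrict, rule refl)

lemma zclosure_minimal:
  assumes "S \<subseteq> zero_locus V F" "F \<subseteq> carrier (mpoly_ring V)"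
  shows "zclosure V S \<subseteq> zero_locus V F"
proof
  fix x assume x: "x \<in> zclosure V S"
  then have "x \<in> affine_space V" using zclosure_affine by blast
  moreover have "eval_mpoly x f = 0" if "f \<in> F" for f
    using x
  proof (rule zclosureD)
    show "f \<in> carrier (mpoly_ring V)" using that assms(2) by blast
    show "eval_mpoly y f = 0" if "y \<in> S" for y
      using that \<open>f \<in> F\<close> assms(1) unfolding zero_locus_def by blast
  qed
  ultimately show "x \<in> zero_locus V F" by (simp add: zero_locus_def)
qed

text \<open>Replaces passage to a limit: a polynomial vanishing on \<open>S\<close> pulls back to a
  univariate polynomial with infinitely many zeros, so it vanishes along the whole curve.\<close>

lemma zclosure_curve:
  fixes c :: "'a::idom \<Rightarrow> 'v \<Rightarrow> 'a"
  assumes c: "poly_curve c" and inf: "infinite {s. c s \<in> zclosure V S}" and aff: "c s \<in> affine_space V"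
  shows "c s \<in> zclosure V S"
proof (rule zclosureI[OF aff])
  fix f assume f: "f \<in> carrier (mpoly_ring V)" "\<And>y. y \<in> S \<Longrightarrow> eval_mpoly y f = 0"
  obtain q where q: "\<And>s. eval_mpoly (c s) f = poly q s" using eval_poly_curve[OF c, of f] by blast
  have "q = 0"
    using inf
  proof (rule poly_infinite_zeros)
    fix s assume "s \<in> {s. c s \<in> zclosure V S}"
    then have "c s \<in> zclosure V S" by simp
    from zclosureD[OF this f] show "poly q s = 0" by (simp add: q)
  qed
  then show "eval_mpoly (c s) f = 0" by (simp add: q)
qed

text \<open>The condition on the right says that the vanishing ideal of \<open>S\<close> is prime;
  hypersurfaces suffice to test covers by two closed sets.\<close>

lemma irreducible_in_zariski_iff:
  fixes S :: "('v \<Rightarrow> 'a::field) set"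
  shows "irreducible_in (zariski V) S \<longleftrightarrow> S \<noteq> {} \<and> S \<subseteq> affine_space V \<and>
    (\<forall>f \<in> carrier (mpoly_ring V). \<forall>g \<in> carrier (mpoly_ring V). (\<forall>x\<in>S. eval_mpoly x f * eval_mpoly x g = 0) \<longrightarrow>
      (\<forall>x\<in>S. eval_mpoly x f = 0) \<or> (\<forall>x\<in>S. eval_mpoly x g = 0))" (is "?L \<longleftrightarrow> ?R")
proof
  assume L: ?L
  then have S: "S \<noteq> {}" "S \<subseteq> affine_space V" by (auto simp: irreducible_in_def topspace_zariski)
  show ?R
  proof (intro conjI S ballI impI)
    fix f g assume fg: "f \<in> carrier (mpoly_ring V)" "g \<in> carrier (mpoly_ring V)"
      "\<forall>x\<in>S. eval_mpoly x f * eval_mpoly x g = 0"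
    have "closedin (zariski V) (zero_locus V {f})" "closedin (zariski V) (zero_locus V {g})"
      unfolding closedin_zariski using fg by blast+
    moreover have "S \<subseteq> zero_locus V {f} \<union> zero_locus V {g}"
      using fg S by (auto simp: zero_locus_def)
    ultimately have "S \<subseteq> zero_locus V {f} \<or> S \<subseteq> zero_locus V {g}"
      using L unfolding irreducible_in_def by blast
    then show "(\<forall>x\<in>S. eval_mpoly x f = 0) \<or> (\<forall>x\<in>S. eval_mpoly x g = 0)"
      by (auto simp: zero_locus_def)
  qed
next
  assume R: ?R
  show ?L
    unfolding irreducible_in_def
  proof (intro conjI allI impI)
    show "S \<noteq> {}" "S \<subseteq> topspace (zariski V)" using R by (auto simp: topspace_zariski)
    fix C D :: "('v \<Rightarrow> 'a) set"
    assume "closedin (zariski V) C" "closedin (zariski V) D" and sub: "S \<subseteq> C \<union> D"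
    then obtain F G where F: "F \<subseteq> carrier (mpoly_ring V)" "C = zero_locus V F"
      and G: "G \<subseteq> carrier (mpoly_ring V)" "D = zero_locus V G"
      unfolding closedin_zariski by blast
    show "S \<subseteq> C \<or> S \<subseteq> D"
    proof (rule ccontr)
      assume "\<not> (S \<subseteq> C \<or> S \<subseteq> D)"
      then obtain x y where xy: "x \<in> S" "x \<notin> C" "y \<in> S" "y \<notin> D" by blast
      then have "x \<in> affine_space V" "y \<in> affine_space V" using R by blast+
      then obtain f g where fg: "f \<in> F" "eval_mpoly x f \<noteq> 0" "g \<in> G" "eval_mpoly y g \<noteq> 0"
        using xy F(2) G(2) unfolding zero_locus_def by blast
      have "\<forall>z\<in>S. eval_mpoly z f * eval_mpoly z g = 0"
        using sub fg F(2) G(2) by (fastforce simp: zero_locus_def)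
      then have "(\<forall>x\<in>S. eval_mpoly x f = 0) \<or> (\<forall>x\<in>S. eval_mpoly x g = 0)"
        using R fg F(1) G(1) by blast
      then show False using fg xy by blast
    qed
  qed
qed

text \<open>Join a point where \<open>f\<close> is nonzero to a point where \<open>g\<close> is
  nonzero. Along the curve both pull back to nonzero univariate polynomials, whose product cannot be
  zero.\<close>

lemma irreducible_zclosure:
  fixes S :: "('v \<Rightarrow> 'a::field) set"
  assumes inf: "infinite (UNIV :: 'a set)" and ne: "S \<noteq> {}" and aff: "S \<subseteq> affine_space V"
    and curves: "\<And>x y. x \<in> S \<Longrightarrow> y \<in> S \<Longrightarrow> \<exists>c. poly_curve c \<and> c 0 = x \<and> c 1 = y \<and> (\<forall>s. c s \<in> S)"
  shows "irreducible_in (zariski V) (zclosure V S)"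
  unfolding irreducible_in_zariski_iff
proof (intro conjI ballI impI)
  show "zclosure V S \<noteq> {}" using ne zclosure_superset[OF aff] by blast
  show "zclosure V S \<subseteq> affine_space V" by (rule zclosure_affine)
  fix f g assume f: "f \<in> carrier (mpoly_ring V)" and g: "g \<in> carrier (mpoly_ring V)"
    and fg: "\<forall>x\<in>zclosure V S. eval_mpoly x f * eval_mpoly x g = 0"
  have "(\<forall>x\<in>S. eval_mpoly x f = 0) \<or> (\<forall>x\<in>S. eval_mpoly x g = 0)"
  proof (rule ccontr)
    assume "\<not> ((\<forall>x\<in>S. eval_mpoly x f = 0) \<or> (\<forall>x\<in>S. eval_mpoly x g = 0))"
    then obtain x y where xy: "x \<in> S" "eval_mpoly x f \<noteq> 0" "y \<in> S" "eval_mpoly y g \<noteq> 0" by blast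
    obtain c where c: "poly_curve c" "c 0 = x" "c 1 = y" "\<And>s. c s \<in> S" using curves xy by blast
    obtain p where p: "\<And>s. eval_mpoly (c s) f = poly p s" using eval_poly_curve[OF c(1), of f] by blast
    obtain q where q: "\<And>s. eval_mpoly (c s) g = poly q s" using eval_poly_curve[OF c(1), of g] by blast
    have "poly (p * q) s = 0" for s
      using fg c(4)[of s] zclosure_superset[OF aff] by (auto simp: p[symmetric] q[symmetric])
    then have "p * q = 0" using poly_infinite_zeros[OF inf] by blast
    moreover have "p \<noteq> 0" "q \<noteq> 0" using xy c(2,3) p[of 0] q[of 1] by auto
    ultimately show False by simp
  qed
  then show "(\<forall>x\<in>zclosure V S. eval_mpoly x f = 0) \<or> (\<forall>x\<in>zclosure V S. eval_mpoly x g = 0)"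
    using zclosureD f g by blast
qed


section \<open>Chains of irreducible closed sets and algebraic independence\<close>

text \<open>Polynomial dependence on the point without a named polynomial, because the combinations
  \<open>comb\<close> are given as functions.\<close>

definition polyfun :: "'v set \<Rightarrow> (('v \<Rightarrow> 'a::comm_ring_1) \<Rightarrow> 'a) \<Rightarrow> bool" where
  "polyfun V F \<longleftrightarrow> (\<exists>p \<in> carrier (mpoly_ring V). \<forall>x. F x = eval_mpoly x p)"

lemma polyfun_eval: "p \<in> carrier (mpoly_ring V) \<Longrightarrow> polyfun V (\<lambda>x. eval_mpoly x p)"
  by (auto simp: polyfun_def simp del: mpoly_ring_simps)

lemma polyfun_const: "polyfun V (\<lambda>x. c)"
  unfolding polyfun_def by (rule bexI[of _ "Poly_Mapping.single 0 c"]) (auto simp: eval_mpoly_single)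

lemma polyfun_add: "polyfun V F \<Longrightarrow> polyfun V G \<Longrightarrow> polyfun V (\<lambda>x. F x + G x)"
  unfolding polyfun_def by (metis eval_mpoly_add mpoly_carrier_add)

lemma polyfun_mult: "polyfun V F \<Longrightarrow> polyfun V G \<Longrightarrow> polyfun V (\<lambda>x. F x * G x)"
  unfolding polyfun_def by (metis eval_mpoly_mult mpoly_carrier_mult)

lemma polyfun_power: "polyfun V F \<Longrightarrow> polyfun V (\<lambda>x. F x ^ j)"
  by (induction j) (simp_all add: polyfun_const polyfun_mult)

lemma polyfun_sum: "(\<And>j. j \<in> J \<Longrightarrow> polyfun V (F j)) \<Longrightarrow> polyfun V (\<lambda>x. \<Sum>j\<in>J. F j x)"
  by (induction J rule: infinite_finite_induct) (simp_all add: polyfun_const polyfun_add)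

lemma irreducible_polyfun:
  fixes F G :: "('v \<Rightarrow> 'a::field) \<Rightarrow> 'a"
  assumes "irreducible_in (zariski V) S" "polyfun V F" "polyfun V G" "\<And>x. x \<in> S \<Longrightarrow> F x * G x = 0"
  shows "(\<forall>x\<in>S. F x = 0) \<or> (\<forall>x\<in>S. G x = 0)"
  using assms unfolding irreducible_in_zariski_iff polyfun_def by metis

text \<open>A list \<open>e\<close> of exponents at most \<open>s\<close> is the exponent vector of a monomial in \<open>gs\<close>, and \<open>c e\<close> is its coefficient.\<close>

fun comb :: "nat \<Rightarrow> ('v, 'a::comm_ring_1) mpoly list \<Rightarrow> (nat list \<Rightarrow> 'a) \<Rightarrow> ('v \<Rightarrow> 'a) \<Rightarrow> 'a" where
  "comb s [] c x = c []"
| "comb s (g # gs) c x = (\<Sum>j\<le>s. eval_mpoly x g ^ j * comb s gs (\<lambda>e. c (j # e)) x)"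

text \<open>Algebraic independence in the coordinate ring of \<open>Z\<close>. A common bound
  \<open>s\<close> on all exponents makes a relation a finite table \<open>c\<close>, from which the
  first exponent can be peeled off.\<close>

definition alg_indep_on :: "('v \<Rightarrow> 'a) set \<Rightarrow> ('v, 'a::comm_ring_1) mpoly list \<Rightarrow> bool" where
  "alg_indep_on Z gs \<longleftrightarrow> (\<forall>s c. (\<forall>x\<in>Z. comb s gs c x = 0) \<longrightarrow>
     (\<forall>e. length e = length gs \<and> set e \<subseteq> {..s} \<longrightarrow> c e = 0))"

lemma polyfun_comb:
  "set gs \<subseteq> carrier (mpoly_ring V) \<Longrightarrow> polyfun V (comb s gs c)"
proof (induction gs arbitrary: c)
  case Nil
  then show ?case by (simp add: polyfun_const)
next
  case (Cons g gs)
  have "polyfun V (\<lambda>x. \<Sum>j\<le>s. eval_mpoly x g ^ j * comb s gs (\<lambda>e. c (j # e)) x)"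
    by (intro polyfun_sum polyfun_mult polyfun_power polyfun_eval)
      (use Cons in \<open>simp_all del: mpoly_ring_simps\<close>)
  then show ?case by (simp del: mpoly_ring_simps)
qed

lemma comb_zero:
  "(\<And>e. length e = length gs \<Longrightarrow> set e \<subseteq> {..s} \<Longrightarrow> c e = 0) \<Longrightarrow> comb s gs c x = 0"
proof (induction gs arbitrary: c)
  case (Cons g gs)
  have "comb s gs (\<lambda>e. c (j # e)) x = 0" if "j \<le> s" for j
    by (rule Cons.IH) (use Cons.prems that in simp)
  then show ?case by simp
qed simp

text \<open>Read a relation on \<open>Z'\<close> as a polynomial in \<open>f\<close>. Once its lower
  coefficients vanish, a power of \<open>f\<close> can be cancelled because \<open>Z'\<close> is
  irreducible; restriction to \<open>Z\<close> then kills the higher terms and leaves a relation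
  among \<open>gs\<close>.\<close>

lemma alg_indep_on_step:
  fixes Z Z' :: "('v \<Rightarrow> 'a::field) set"
  assumes irr: "irreducible_in (zariski V) Z'" and sub: "Z \<subseteq> Z'" and indep: "alg_indep_on Z gs"
    and carr: "set gs \<subseteq> carrier (mpoly_ring V)" "f \<in> carrier (mpoly_ring V)"
    and f0: "\<And>x. x \<in> Z \<Longrightarrow> eval_mpoly x f = 0" and f1: "y \<in> Z'" "eval_mpoly y f \<noteq> 0"
  shows "alg_indep_on Z' (f # gs)"
  unfolding alg_indep_on_def
proof (intro allI impI)
  fix s c e
  assume zero: "\<forall>x\<in>Z'. comb s (f # gs) c x = 0" and "length e = length (f # gs) \<and> set e \<subseteq> {..s}"
  then obtain i e' where e: "e = i # e'" "i \<le> s" "length e' = length gs" "set e' \<subseteq> {..s}"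
    by (cases e) auto
  have "\<forall>e. length e = length gs \<and> set e \<subseteq> {..s} \<longrightarrow> c (i # e) = 0" if "i \<le> s" for i
    using that
  proof (induction i rule: less_induct)
    case (less i)
    \<comment> \<open>The relation divided by \<open>f^i\<close>, its terms below \<open>i\<close>
      being zero by induction.\<close>
    define Q where "Q = (\<lambda>x. \<Sum>j\<in>{i..s}. eval_mpoly x f ^ (j - i) * comb s gs (\<lambda>e. c (j # e)) x)"
    have "eval_mpoly x f ^ i * Q x = 0" if "x \<in> Z'" for x
    proof -
      have "comb s gs (\<lambda>e. c (j # e)) x = 0" if "j < i" for j
        by (rule comb_zero) (use less.IH[OF that] less.prems that in auto)
      then have "(\<Sum>j\<in>{i..s}. eval_mpoly x f ^ j * comb s gs (\<lambda>e. c (j # e)) x) =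
          (\<Sum>j\<le>s. eval_mpoly x f ^ j * comb s gs (\<lambda>e. c (j # e)) x)"
        by (intro sum.mono_neutral_left) auto
      also have "\<dots> = 0" using zero that by simp
      finally have "(\<Sum>j\<in>{i..s}. eval_mpoly x f ^ j * comb s gs (\<lambda>e. c (j # e)) x) = 0" .
      moreover have "eval_mpoly x f ^ i * Q x = (\<Sum>j\<in>{i..s}. eval_mpoly x f ^ j * comb s gs (\<lambda>e. c (j # e)) x)"
        unfolding Q_def sum_distrib_left
        by (rule sum.cong[OF refl]) (simp add: mult.assoc[symmetric] power_add[symmetric])
      ultimately show ?thesis by simp
    qed
    moreover have "polyfun V (\<lambda>x. eval_mpoly x f ^ i)" "polyfun V Q"
      unfolding Q_def by (intro polyfun_sum polyfun_mult polyfun_power polyfun_eval polyfun_comb carr)+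
    ultimately have "(\<forall>x\<in>Z'. eval_mpoly x f ^ i = 0) \<or> (\<forall>x\<in>Z'. Q x = 0)"
      using irreducible_polyfun[OF irr] by blast
    then have Q0: "\<forall>x\<in>Z'. Q x = 0" using f1 by auto
    have "comb s gs (\<lambda>e. c (i # e)) x = 0" if "x \<in> Z" for x
    proof -
      have "Q x = (\<Sum>j\<in>{i}. eval_mpoly x f ^ (j - i) * comb s gs (\<lambda>e. c (j # e)) x)"
        unfolding Q_def using less.prems f0[OF that] by (intro sum.mono_neutral_right) auto
      then show ?thesis using Q0 that sub by auto
    qed
    then show ?case using indep unfolding alg_indep_on_def by blast
  qed
  with e show "c e = 0" by blast
qed

text \<open>The function gained in each step is an equation of the smaller set that fails at some
  point of the larger one.\<close>

lemma alg_indep_on_chain: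
  fixes Z :: "nat \<Rightarrow> ('v \<Rightarrow> 'a::field) set"
  assumes "\<And>i. i \<le> d \<Longrightarrow> closedin (zariski V) (Z i) \<and> irreducible_in (zariski V) (Z i)"
    and "\<And>i. i < d \<Longrightarrow> Z i \<subset> Z (Suc i)"
    and "alg_indep_on (Z 0) gs" "set gs \<subseteq> carrier (mpoly_ring V)"
  shows "\<exists>hs. length hs = length gs + d \<and> set hs \<subseteq> carrier (mpoly_ring V) \<and> alg_indep_on (Z d) hs"
  using assms
proof (induction d)
  case 0
  then show ?case by (intro exI[of _ gs]) (simp del: mpoly_ring_simps)
next
  case (Suc d)
  obtain hs where hs: "length hs = length gs + d" "set hs \<subseteq> carrier (mpoly_ring V)" "alg_indep_on (Z d) hs"
    using Suc.IH Suc.prems by auto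
  have ZS: "Z d \<subset> Z (Suc d)" "irreducible_in (zariski V) (Z (Suc d))" "closedin (zariski V) (Z d)"
    using Suc.prems(1,2)[of d] Suc.prems(1)[of "Suc d"] by auto
  then obtain y where y: "y \<in> Z (Suc d)" "y \<notin> Z d" by blast
  obtain F where F: "F \<subseteq> carrier (mpoly_ring V)" "Z d = zero_locus V F"
    using ZS(3) unfolding closedin_zariski by blast
  have "y \<in> affine_space V" using y ZS(2) unfolding irreducible_in_zariski_iff by blast
  then obtain f where f: "f \<in> F" "eval_mpoly y f \<noteq> 0" using y F(2) by (auto simp: zero_locus_def)
  have f0: "eval_mpoly x f = 0" if "x \<in> Z d" for x using that f(1) F(2) by (simp add: zero_locus_def)
  have fc: "f \<in> carrier (mpoly_ring V)" using f F by blast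
  have "alg_indep_on (Z (Suc d)) (f # hs)"
    using ZS(1) by (intro alg_indep_on_step[OF ZS(2) _ hs(3,2) fc f0 y(1) f(2)]) auto
  then show ?case using hs fc by (intro exI[of _ "f # hs"]) (simp del: mpoly_ring_simps)
qed

text \<open>Gaussian elimination: an equation with nonzero coefficient at \<open>e0\<close> is
  solved for that unknown and substituted into the others.\<close>

lemma exists_nontrivial_solution:
  fixes a :: "'e \<Rightarrow> 't \<Rightarrow> 'a::field"
  assumes "finite T" "finite E" "card T < card E"
  shows "\<exists>c. (\<exists>e\<in>E. c e \<noteq> 0) \<and> (\<forall>t\<in>T. (\<Sum>e\<in>E. a e t * c e) = 0)"
  using assms
proof (induction T arbitrary: E a rule: finite_induct)
  case empty
  then have "E \<noteq> {}" by auto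
  then show ?case by (intro exI[of _ "\<lambda>_. 1"]) auto
next
  case (insert t T)
  show ?case
  proof (cases "\<forall>e\<in>E. a e t = 0")
    case True
    have "card T < card E" using insert by simp
    from insert.IH[OF insert.prems(1) this, of a] True show ?thesis by auto
  next
    case False
    then obtain e0 where e0: "e0 \<in> E" "a e0 t \<noteq> 0" by blast
    define E' where "E' = E - {e0}"
    define a' where "a' = (\<lambda>e u. a e u - a e t / a e0 t * a e0 u)"
    have "finite E'" "card T < card E'" using insert e0 by (auto simp: E'_def)
    from insert.IH[OF this, of a'] obtain c where c: "\<exists>e\<in>E'. c e \<noteq> 0"
      "\<And>u. u \<in> T \<Longrightarrow> (\<Sum>e\<in>E'. a' e u * c e) = 0" by blast
    define c' where "c' = c(e0 := - (\<Sum>e\<in>E'. a e t / a e0 t * c e))"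
    have split: "(\<Sum>e\<in>E. a e u * c' e) = (\<Sum>e\<in>E'. a' e u * c e)" for u
    proof -
      have "(\<Sum>e\<in>E. a e u * c' e) = a e0 u * c' e0 + (\<Sum>e\<in>E'. a e u * c' e)"
        unfolding E'_def using insert.prems(1) e0(1) by (rule sum.remove)
      also have "(\<Sum>e\<in>E'. a e u * c' e) = (\<Sum>e\<in>E'. a e u * c e)"
        by (rule sum.cong) (auto simp: c'_def E'_def)
      also have "a e0 u * c' e0 + (\<Sum>e\<in>E'. a e u * c e) = (\<Sum>e\<in>E'. a' e u * c e)"
      proof -
        have "a' e u * c e = a e u * c e - a e0 u * (a e t / a e0 t * c e)" for e
          by (simp add: a'_def algebra_simps)
        then show ?thesis by (simp add: c'_def sum_distrib_left sum_subtractf)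
      qed
      finally show ?thesis .
    qed
    have "(\<Sum>e\<in>E. a e u * c' e) = 0" if "u \<in> insert t T" for u
    proof (cases "u = t")
      case True
      then show ?thesis unfolding split using e0 by (simp add: a'_def)
    next
      case False
      then show ?thesis using that c(2) by (simp add: split)
    qed
    moreover have "\<exists>e\<in>E. c' e \<noteq> 0" using c(1) by (auto simp: c'_def E'_def)
    ultimately show ?thesis by blast
  qed
qed

section \<open>Monomial counts and the bound on the number of independent functions\<close>

fun pmon :: "('v, 'a::comm_ring_1) mpoly list \<Rightarrow> nat list \<Rightarrow> ('v, 'a) mpoly" where
  "pmon (g # gs) (j # e) = g ^ j * pmon gs e"
| "pmon _ _ = 1"

lemma eval_mpoly_power: "eval_mpoly x (p ^ j) = eval_mpoly x p ^ j"
  by (induction j) (simp_all add: eval_mpoly_mult)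

lemma comb_eq_sum:
  "comb s gs c x = (\<Sum>e \<in> {e. set e \<subseteq> {..s} \<and> length e = length gs}. c e * eval_mpoly x (pmon gs e))"
proof (induction gs arbitrary: c)
  case Nil
  have "{e. set e \<subseteq> {..s} \<and> length e = length []} = {[]}" by auto
  then show ?case by simp
next
  case (Cons g gs)
  let ?L = "{e. set e \<subseteq> {..s} \<and> length e = length gs}"
  have L: "{e. set e \<subseteq> {..s} \<and> length e = length (g # gs)} = (\<lambda>(j, e). j # e) ` ({..s} \<times> ?L)"
    by (auto simp: length_Suc_conv image_iff)
  have "(\<Sum>e \<in> {e. set e \<subseteq> {..s} \<and> length e = length (g # gs)}. c e * eval_mpoly x (pmon (g # gs) e))
     = (\<Sum>(j, e) \<in> {..s} \<times> ?L. c (j # e) * eval_mpoly x (pmon (g # gs) (j # e)))"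
    unfolding L by (subst sum.reindex) (auto simp: inj_on_def case_prod_beta)
  also have "\<dots> = (\<Sum>j\<le>s. \<Sum>e\<in>?L. c (j # e) * eval_mpoly x (pmon (g # gs) (j # e)))"
    by (rule sum.cartesian_product[symmetric])
  also have "\<dots> = comb s (g # gs) c x"
    by (simp add: Cons.IH sum_distrib_left eval_mpoly_mult eval_mpoly_power ac_simps)
  finally show ?case by simp
qed

text \<open>Bounding each exponent separately, not the total degree, gives at most
  \<open>(B + 1) ^ card V\<close> monomials, and the bounds add up under multiplication.\<close>

definition mon_box :: "'v set \<Rightarrow> nat \<Rightarrow> ('v \<Rightarrow>\<^sub>0 nat) set" where
  "mon_box V B = {m. Poly_Mapping.keys m \<subseteq> V \<and> (\<forall>v. Poly_Mapping.lookup m v \<le> B)}"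

lemma card_mon_box:
  assumes "finite V"
  shows "finite (mon_box V B)" "card (mon_box V B) \<le> (B + 1) ^ card V"
proof -
  let ?h = "\<lambda>m. restrict (Poly_Mapping.lookup m) V"
  have inj: "inj_on ?h (mon_box V B)"
  proof (rule inj_onI)
    fix m m' assume m: "m \<in> mon_box V B" "m' \<in> mon_box V B" "?h m = ?h m'"
    show "m = m'"
    proof (rule poly_mapping_eqI)
      fix v
      show "Poly_Mapping.lookup m v = Poly_Mapping.lookup m' v"
      proof (cases "v \<in> V")
        case True
        then show ?thesis using m(3) by (metis restrict_apply')
      next
        case False
        then have "v \<notin> Poly_Mapping.keys m" "v \<notin> Poly_Mapping.keys m'" using m by (auto simp: mon_box_def)
        then show ?thesis by (simp add: in_keys_iff)
      qed
    qed
  qed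
  have sub: "?h ` mon_box V B \<subseteq> PiE V (\<lambda>_. {..B})" by (auto simp: mon_box_def)
  have fin: "finite (PiE V (\<lambda>_. {..B}))" using assms by (intro finite_PiE) auto
  show "finite (mon_box V B)" using inj sub fin by (rule inj_on_finite)
  have "card (mon_box V B) \<le> card (PiE V (\<lambda>_. {..B}))" using inj sub fin by (rule card_inj_on_le)
  also have "\<dots> = (B + 1) ^ card V" using assms by (simp add: card_PiE)
  finally show "card (mon_box V B) \<le> (B + 1) ^ card V" .
qed

lemma keys_mult_mon_box:
  assumes "Poly_Mapping.keys p \<subseteq> mon_box V B" "Poly_Mapping.keys q \<subseteq> mon_box V C"
  shows "Poly_Mapping.keys (p * q) \<subseteq> mon_box V (B + C)"
proof
  fix m assume "m \<in> Poly_Mapping.keys (p * q)"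
  then obtain a b where "m = a + b" "a \<in> Poly_Mapping.keys p" "b \<in> Poly_Mapping.keys q"
    using keys_mult[of p q] by blast
  then show "m \<in> mon_box V (B + C)"
    using assms keys_add[of a b] unfolding mon_box_def
    by (fastforce simp: lookup_add intro: add_mono)
qed

lemma keys_one_mon_box: "Poly_Mapping.keys (1 :: ('v, 'a::comm_ring_1) mpoly) \<subseteq> mon_box V B"
  by (simp add: mon_box_def)

lemma mon_box_mono: "B \<le> C \<Longrightarrow> mon_box V B \<subseteq> mon_box V C"
  by (auto simp: mon_box_def intro: order_trans)

lemma keys_pmon_mon_box:
  assumes "\<And>g. g \<in> set gs \<Longrightarrow> Poly_Mapping.keys g \<subseteq> mon_box V D" "set e \<subseteq> {..s}" "length e = length gs"
  shows "Poly_Mapping.keys (pmon gs e) \<subseteq> mon_box V (length gs * s * D)"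
  using assms
proof (induction gs arbitrary: e)
  case Nil
  then show ?case using keys_one_mon_box by simp
next
  case (Cons g gs)
  then obtain j e' where e: "e = j # e'" "j \<le> s" "set e' \<subseteq> {..s}" "length e' = length gs"
    by (cases e) auto
  have "Poly_Mapping.keys (g ^ i) \<subseteq> mon_box V (i * D)" for i
  proof (induction i)
    case 0
    then show ?case using keys_one_mon_box by simp
  next
    case (Suc i)
    then show ?case using keys_mult_mon_box[of g V D "g ^ i" "i * D"] Cons.prems(1)[of g] by simp
  qed
  from keys_mult_mon_box[OF this[of j] Cons.IH[OF Cons.prems(1) e(3,4)]]
  have "Poly_Mapping.keys (pmon (g # gs) e) \<subseteq> mon_box V (j * D + length gs * s * D)"
    using e by simp
  also have "\<dots> \<subseteq> mon_box V (length (g # gs) * s * D)"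
    using e(2) by (intro mon_box_mono) (simp add: distrib_right)
  finally show ?case .
qed

text \<open>The \<open>M\<close> polynomials have \<open>(s + 1)^M\<close> monomial expressions with
  exponents at most \<open>s\<close>, but these lie in a space whose dimension grows like
  \<open>s^N\<close> for \<open>N = card V\<close>. If \<open>M > N\<close>, a large
  \<open>s\<close> forces a linear relation.\<close>

theorem alg_indep_on_length_le:
  fixes gs :: "('v, 'a::field) mpoly list"
  assumes fin: "finite V" and carr: "set gs \<subseteq> carrier (mpoly_ring V)" and indep: "alg_indep_on Z gs"
  shows "length gs \<le> card V"
proof (rule ccontr)
  assume "\<not> length gs \<le> card V"
  define M where "M = length gs"
  define N where "N = card V"
  have MN: "N + 1 \<le> M" using \<open>\<not> length gs \<le> card V\<close> by (simp add: M_def N_def)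
  have "\<exists>D. \<forall>g\<in>set gs. Poly_Mapping.keys g \<subseteq> mon_box V D"
    using carr
  proof (induction gs)
    case (Cons g gs)
    then obtain D where D: "\<forall>g\<in>set gs. Poly_Mapping.keys g \<subseteq> mon_box V D" by auto
    \<comment> \<open>The sum of all exponents, as a crude bound for each of them.\<close>
    define D' where "D' = (\<Sum>m\<in>Poly_Mapping.keys g. \<Sum>v\<in>Poly_Mapping.keys m. Poly_Mapping.lookup m v)"
    have "Poly_Mapping.keys g \<subseteq> mon_box V D'"
    proof
      fix m assume m: "m \<in> Poly_Mapping.keys g"
      have "Poly_Mapping.lookup m v \<le> D'" for v
      proof (cases "v \<in> Poly_Mapping.keys m")
        case True
        have "Poly_Mapping.lookup m v \<le> (\<Sum>v\<in>Poly_Mapping.keys m. Poly_Mapping.lookup m v)"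
          using True by (intro member_le_sum) auto
        also have "\<dots> \<le> D'" unfolding D'_def using m
          by (intro member_le_sum[of _ _ "\<lambda>m. \<Sum>v\<in>Poly_Mapping.keys m. Poly_Mapping.lookup m v"]) auto
        finally show ?thesis .
      qed (simp add: in_keys_iff)
      then show "m \<in> mon_box V D'" using m Cons.prems by (simp add: mon_box_def)
    qed
    then show ?case
      using D subset_trans[OF _ mon_box_mono[of D' "D' + D" V]] subset_trans[OF _ mon_box_mono[of D "D' + D" V]]
      by (intro exI[of _ "D' + D"]) simp
  qed simp
  then obtain D where D: "\<And>g. g\<in>set gs \<Longrightarrow> Poly_Mapping.keys g \<subseteq> mon_box V D" by blast
  \<comment> \<open>With this choice \<open>(M D + 1)^N (s + 1)^N\<close> equals
    \<open>s (s + 1)^N\<close>, just below \<open>(s + 1)^(N + 1)\<close>.\<close>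
  define s where "s = (M * D + 1) ^ N"
  define B where "B = M * s * D"
  define E where "E = {e. set e \<subseteq> {..s} \<and> length e = length gs}"
  have finE: "finite E" unfolding E_def by (rule finite_lists_length_eq) simp
  have cE: "card E = (s + 1) ^ M" unfolding E_def M_def by (subst card_lists_length_eq) auto
  have "card (mon_box V B) \<le> (B + 1) ^ N" unfolding N_def by (rule card_mon_box(2)[OF fin])
  also have "\<dots> \<le> ((M * D + 1) * (s + 1)) ^ N" by (intro power_mono) (simp_all add: B_def algebra_simps)
  also have "\<dots> = s * (s + 1) ^ N" by (simp only: power_mult_distrib s_def[symmetric])
  also have "\<dots> < (s + 1) ^ (N + 1)" by simp
  also have "\<dots> \<le> card E" unfolding cE using MN by (intro power_increasing) auto
  finally have "card (mon_box V B) < card E" .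
  from exists_nontrivial_solution[OF card_mon_box(1)[OF fin] finE this,
      of "\<lambda>e. Poly_Mapping.lookup (pmon gs e)"]
  obtain c where c: "\<exists>e\<in>E. c e \<noteq> 0"
    "\<And>m. m \<in> mon_box V B \<Longrightarrow> (\<Sum>e\<in>E. Poly_Mapping.lookup (pmon gs e) m * c e) = 0" by blast
  have "comb s gs c x = 0" for x
  proof -
    let ?w = "\<lambda>m. \<Prod>v \<in> Poly_Mapping.keys m. x v ^ Poly_Mapping.lookup m v"
    have "comb s gs c x = (\<Sum>e\<in>E. c e * eval_mpoly x (pmon gs e))"
      unfolding comb_eq_sum E_def ..
    also have "\<dots> = (\<Sum>e\<in>E. \<Sum>m\<in>mon_box V B. c e * (Poly_Mapping.lookup (pmon gs e) m * ?w m))"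
    proof (rule sum.cong[OF refl])
      fix e assume "e \<in> E"
      then have "Poly_Mapping.keys (pmon gs e) \<subseteq> mon_box V B"
        unfolding B_def M_def E_def using keys_pmon_mon_box[of gs V D e s] D by simp
      then have "eval_mpoly x (pmon gs e) = (\<Sum>m\<in>mon_box V B. Poly_Mapping.lookup (pmon gs e) m * ?w m)"
        unfolding eval_mpoly_def using card_mon_box(1)[OF fin]
        by (intro sum.mono_neutral_left) (auto simp: in_keys_iff)
      then show "c e * eval_mpoly x (pmon gs e) = (\<Sum>m\<in>mon_box V B. c e * (Poly_Mapping.lookup (pmon gs e) m * ?w m))"
        by (simp add: sum_distrib_left)
    qed
    also have "\<dots> = (\<Sum>m\<in>mon_box V B. \<Sum>e\<in>E. c e * (Poly_Mapping.lookup (pmon gs e) m * ?w m))"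
      by (rule sum.swap)
    also have "\<dots> = (\<Sum>m\<in>mon_box V B. (\<Sum>e\<in>E. Poly_Mapping.lookup (pmon gs e) m * c e) * ?w m)"
      unfolding sum_distrib_right by (intro sum.cong refl) (simp add: ac_simps)
    also have "\<dots> = 0" using c(2) by simp
    finally show ?thesis .
  qed
  then have "c e = 0" if "e \<in> E" for e
    using indep that unfolding alg_indep_on_def E_def by blast
  with c(1) show False by blast
qed

section \<open>Independence of the coordinates on affine space\<close>

lemma comb_coords_cong:
  "(\<And>v. v \<in> set vs \<Longrightarrow> x v = y v) \<Longrightarrow> comb s (map mvar vs) c x = comb s (map mvar vs) c y"
  by (induction vs arbitrary: c) simp_all

text \<open>Vary the coordinate \<open>v\<close> alone: the relation becomes a univariate polynomial
  with every scalar as a root, so each coefficient vanishes and is a relation among the remaining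
  coordinates.\<close>

lemma alg_indep_on_coords:
  assumes inf: "infinite (UNIV :: 'a::field set)" and "distinct vs" "set vs \<subseteq> V"
  shows "alg_indep_on (affine_space V :: ('v \<Rightarrow> 'a) set) (map mvar vs)"
  using assms(2,3)
proof (induction vs)
  case Nil
  \<comment> \<open>With no function left, independence says that the space has a point.\<close>
  have "(\<lambda>v. if v \<in> V then 0 else undefined) \<in> (affine_space V :: ('v \<Rightarrow> 'a) set)"
    by (auto simp: affine_space_def)
  then show ?case by (auto simp: alg_indep_on_def)
next
  case (Cons v vs)
  show ?case
    unfolding alg_indep_on_def
  proof (intro allI impI)
    fix s c e
    assume zero: "\<forall>x\<in>affine_space V. comb s (map mvar (v # vs)) c x = (0 :: 'a)"
      and "length e = length (map (mvar :: _ \<Rightarrow> (_, 'a) mpoly) (v # vs)) \<and> set e \<subseteq> {..s}"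
    then obtain i e' where e: "e = i # e'" "i \<le> s" "length e' = length vs" "set e' \<subseteq> {..s}"
      by (cases e) auto
    have "comb s (map mvar vs) (\<lambda>e. c (i # e)) x = 0" if x: "x \<in> affine_space V" for x
    proof -
      define q where "q = (\<Sum>j\<le>s. Polynomial.monom (comb s (map mvar vs) (\<lambda>e. c (j # e)) x) j)"
      have "poly q t = 0" for t
      proof -
        have "x(v := t) \<in> affine_space V"
          using x Cons.prems by (auto simp: affine_space_def PiE_iff extensional_def)
        then have "comb s (map mvar (v # vs)) c (x(v := t)) = 0" using zero by blast
        moreover have "comb s (map mvar vs) c' (x(v := t)) = comb s (map mvar vs) c' x" for c'
          by (rule comb_coords_cong) (use Cons.prems in auto)
        ultimately show ?thesis by (simp add: q_def poly_sum poly_monom mult.commute)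
      qed
      then have "q = 0" using poly_infinite_zeros[OF inf] by blast
      moreover have "coeff q i = comb s (map mvar vs) (\<lambda>e. c (i # e)) x"
        using e(2) by (simp add: q_def coeff_sum)
      ultimately show ?thesis by simp
    qed
    then have "\<forall>e. length e = length (map (mvar :: _ \<Rightarrow> (_, 'a) mpoly) vs) \<and> set e \<subseteq> {..s} \<longrightarrow> c (i # e) = 0"
      using Cons.IH Cons.prems unfolding alg_indep_on_def
      by (metis (no_types, lifting) distinct.simps(2) insert_subset list.simps(15))
    with e show "c e = 0" by simp
  qed
qed

unbundle fps_syntax

section \<open>Jets of skew-symmetric matrices\<close>

lemma fps_X_power_dvd_iff:
  fixes f :: "'a::comm_ring_1 fps"
  shows "fps_X ^ k dvd f \<longleftrightarrow> (\<forall>h<k. f $ h = 0)"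
proof
  assume "fps_X ^ k dvd f"
  then show "\<forall>h<k. f $ h = 0" by (auto elim!: dvdE simp: fps_X_power_mult_nth)
next
  assume *: "\<forall>h<k. f $ h = 0"
  have "f = fps_X ^ k * Abs_fps (\<lambda>h. f $ (h + k))"
    by (rule fps_ext) (use * in \<open>simp add: fps_X_power_mult_nth\<close>)
  then show "fps_X ^ k dvd f" by (rule dvdI)
qed

text \<open>In characteristic 2 the zero diagonal does not follow from antisymmetry.\<close>

definition skew :: "('i \<Rightarrow> 'i \<Rightarrow> 'b::ab_group_add) \<Rightarrow> bool" where
  "skew Y \<longleftrightarrow> (\<forall>i j. Y i j = - Y j i) \<and> (\<forall>i. Y i i = 0)"

lemma skew_dec: "skew (dec u v)"
  by (simp add: skew_def dec_def mult.commute)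

lemma skew_add: "skew Y \<Longrightarrow> skew Z \<Longrightarrow> skew (\<lambda>i j. Y i j + Z i j)"
  unfolding skew_def by (metis minus_add_distrib add.left_neutral)

lemma skew_minus: "skew Y \<Longrightarrow> skew Z \<Longrightarrow> skew (\<lambda>i j. Y i j - Z i j)"
  unfolding skew_def by (metis minus_diff_eq minus_diff_commute diff_self)

lemma skew_scale: "skew Y \<Longrightarrow> skew (\<lambda>i j. c * Y i j :: 'b::comm_ring_1)"
  unfolding skew_def by (metis mult_minus_right mult_zero_right)

lemma skew_sum: "(\<And>l. l \<in> I \<Longrightarrow> skew (Y l)) \<Longrightarrow> skew (\<lambda>i j. \<Sum>l\<in>I. Y l i j)"
  by (induction I rule: infinite_finite_induct) (simp_all add: skew_add, simp_all add: skew_def)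

lemma skew_restrict:
  assumes "skew Y"
  shows "skew (\<lambda>i j. if i \<in> A \<and> j \<in> A then Y i j else 0)"
  unfolding skew_def
proof (intro conjI allI)
  fix i j
  have Y: "Y i j = - Y j i" "Y i i = 0" using assms unfolding skew_def by blast+
  show "(if i \<in> A \<and> j \<in> A then Y i j else 0) = - (if j \<in> A \<and> i \<in> A then Y j i else 0)"
    using Y(1) by auto
  show "(if i \<in> A \<and> i \<in> A then Y i i else 0) = 0" using Y(2) by simp
qed

text \<open>Matrices are cut off at order \<open>k\<close> only here. Before that all arithmetic
  takes place in the valuation ring \<open>K[[t]]\<close>, where entries of least order divide the
  others and can be cancelled, unlike in the truncated ring with its zero divisors.\<close>

definition jet_point :: "nat \<Rightarrow> nat \<Rightarrow> (nat \<Rightarrow> nat \<Rightarrow> 'a fps) \<Rightarrow> jet_var \<Rightarrow> 'a::zero" where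
  "jet_point n k Y = restrict (\<lambda>(i, j, h). Y i j $ h) (jet_vars n k)"

definition point_matrix :: "nat \<Rightarrow> (jet_var \<Rightarrow> 'a::comm_ring_1) \<Rightarrow> nat \<Rightarrow> nat \<Rightarrow> 'a fps" where
  "point_matrix k x i j =
     (if i < j then Abs_fps (\<lambda>h. if h < k then x (i, j, h) else 0)
      else if j < i then - Abs_fps (\<lambda>h. if h < k then x (j, i, h) else 0) else 0)"

lemma skew_point_matrix: "skew (point_matrix k x)"
  by (simp add: skew_def point_matrix_def)

lemma jet_point_affine: "jet_point n k Y \<in> affine_space (jet_vars n k)"
  by (simp add: jet_point_def affine_space_def)

lemma jet_point_point_matrix:
  assumes "x \<in> affine_space (jet_vars n k)"
    and "\<And>i j. i \<in> {1..n} \<Longrightarrow> j \<in> {1..n} \<Longrightarrow> Y i j = point_matrix k x i j"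
  shows "jet_point n k Y = x"
proof
  fix v :: jet_var
  obtain i j h where v: "v = (i, j, h)" by (cases v)
  show "jet_point n k Y v = x v"
  proof (cases "v \<in> jet_vars n k")
    case True
    then have "Y i j = point_matrix k x i j" using assms(2)[of i j] by (auto simp: v jet_vars_def)
    with True show ?thesis by (simp add: v jet_point_def jet_vars_def point_matrix_def)
  next
    case False
    then have "x v = undefined" using PiE_arb[of x "jet_vars n k" _ v] assms(1) by (simp add: affine_space_def)
    with False show ?thesis by (simp add: jet_point_def)
  qed
qed

lemma jet_point_cong:
  assumes "\<And>i j. fps_X ^ k dvd Y i j - Z i j"
  shows "jet_point n k Y = jet_point n k (Z :: _ \<Rightarrow> _ \<Rightarrow> 'a::comm_ring_1 fps)"
proof -
  have "Y i j $ h = Z i j $ h" if "h < k" for i j h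
    using assms[of i j] that by (simp add: fps_X_power_dvd_iff)
  then show ?thesis unfolding jet_point_def by (intro restrict_ext) (auto simp: jet_vars_def)
qed

text \<open>The polynomials that vanish at a given point form an ideal.\<close>

lemma zero_locus_genideal:
  fixes G :: "('v, 'a::comm_ring_1) mpoly set"
  assumes G: "G \<subseteq> carrier (mpoly_ring V)"
  shows "zero_locus V (genideal (mpoly_ring V) G) = zero_locus V G"
proof -
  let ?R = "mpoly_ring V :: ('v, 'a) mpoly ring"
  have R: "ring ?R" using cring_mpoly_ring by (rule cring.axioms)
  have sub: "G \<subseteq> genideal ?R G" by (rule ring.genideal_self[OF R G])
  have "zero_locus V G \<subseteq> zero_locus V (genideal ?R G)"
  proof
    fix x assume x: "x \<in> zero_locus V G"
    let ?I = "{f \<in> carrier ?R. eval_mpoly x f = 0}"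
    have "ideal ?I ?R"
    proof (rule idealI[OF R])
      have neg: "\<ominus>\<^bsub>?R\<^esub> f = - f" if "f \<in> carrier ?R" for f
      proof -
        interpret ring ?R by (rule R)
        have "- f \<in> carrier ?R" using that by (rule mpoly_carrier_uminus)
        then show ?thesis using that by (intro minus_equality) simp_all
      qed
      have eval_neg: "eval_mpoly x (- f) = - eval_mpoly x f" for f
        using eval_mpoly_add[of x f "- f"] by (simp add: eq_neg_iff_add_eq_0 add.commute)
      show "subgroup ?I (add_monoid ?R)"
      proof (rule group.subgroupI)
        show "Group.group (add_monoid ?R)" by (rule abelian_group.a_group[OF ring.is_abelian_group[OF R]])
        show "?I \<noteq> {}" by (auto intro!: exI[of _ 0])
        show "inv\<^bsub>add_monoid ?R\<^esub> f \<in> ?I" if "f \<in> ?I" for f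
        proof -
          have f: "f \<in> carrier ?R" "eval_mpoly x f = 0" using that by blast+
          then have "- f \<in> ?I" using mpoly_carrier_uminus[OF f(1)] by (simp add: eval_neg del: mpoly_ring_simps)
          then show ?thesis using neg[OF f(1)] by (simp add: a_inv_def)
        qed
        show "f \<otimes>\<^bsub>add_monoid ?R\<^esub> g \<in> ?I" if "f \<in> ?I" "g \<in> ?I" for f g
          using that mpoly_carrier_add[of f V g] by (auto simp: eval_mpoly_add simp del: mpoly_ring_simps(1))
      qed auto
    next
      fix f g assume "f \<in> ?I" "g \<in> carrier ?R"
      then show "g \<otimes>\<^bsub>?R\<^esub> f \<in> ?I" "f \<otimes>\<^bsub>?R\<^esub> g \<in> ?I"
        using mpoly_carrier_mult[of f V g] mpoly_carrier_mult[of g V f]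
        by (auto simp: eval_mpoly_mult simp del: mpoly_ring_simps(1))
    qed
    moreover have "G \<subseteq> ?I" using G x unfolding zero_locus_def by blast
    ultimately have "genideal ?R G \<subseteq> ?I" by (rule ring.genideal_minimal[OF R])
    then show "x \<in> zero_locus V (genideal ?R G)" using x by (auto simp: zero_locus_def simp del: mpoly_ring_simps)
  qed
  with sub show ?thesis by (auto simp: zero_locus_def)
qed

section \<open>Membership in the variety as divisibility by \<open>t^k\<close>\<close>

lemma pfaffian_jet_variety_eq:
  "pfaffian_jet_variety n k r =
    zero_locus (jet_vars n k) {coeff p h | p h. p \<in> jet_pfaffians n k r \<and> h < k}"
  unfolding pfaffian_jet_variety_def pfaffian_jet_ideal_def
  by (rule zero_locus_genideal[OF jet_pfaffian_coeffs_in_carrier])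

text \<open>Evaluating every coefficient at \<open>x\<close> is a ring homomorphism from polynomials
  in \<open>t\<close> to power series. It carries the jet matrix to \<open>point_matrix k x\<close>,
  and pfaffians commute with it.\<close>

lemma eval_coeff_pfaffian_jet_matrix:
  fixes x :: "jet_var \<Rightarrow> 'a::comm_ring_1"
  shows "eval_mpoly x (coeff (pfaffian r (\<lambda>i j. jet_matrix k (a i) (a j))) h) =
    pfaffian r (\<lambda>i j. point_matrix k x (a i) (a j)) $ h"
proof -
  define \<phi> where "\<phi> = (\<lambda>p :: (jet_var, 'a) mpoly poly. Abs_fps (\<lambda>h. eval_mpoly x (coeff p h)))"
  have eval_sum: "eval_mpoly x (sum f A) = (\<Sum>i\<in>A. eval_mpoly x (f i))" for f and A :: "nat set"
    by (induction A rule: infinite_finite_induct) (simp_all add: eval_mpoly_add)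
  have add: "\<phi> (p + q) = \<phi> p + \<phi> q" for p q by (rule fps_ext) (simp add: \<phi>_def eval_mpoly_add)
  have mult: "\<phi> (p * q) = \<phi> p * \<phi> q" for p q
    by (rule fps_ext)
      (simp add: \<phi>_def coeff_mult fps_mult_nth eval_sum eval_mpoly_mult atLeast0AtMost)
  have one: "\<phi> 1 = 1" by (rule fps_ext) (simp add: \<phi>_def coeff_1)
  note hom = pfaffian_hom[of \<phi>, OF add mult one]
  have "\<phi> (jet_entry k i j) = Abs_fps (\<lambda>h. if h < k then x (i, j, h) else 0)" for i j
    by (rule fps_ext) (simp add: \<phi>_def jet_entry_def coeff_sum eval_sum if_distrib cong: if_cong)
  moreover have "\<phi> 0 = 0" by (rule fps_ext) (simp add: \<phi>_def)
  ultimately have "\<phi> (jet_matrix k i j) = point_matrix k x i j" for i j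
    by (simp add: jet_matrix_def point_matrix_def hom(5))
  then have "\<phi> (pfaffian r (\<lambda>i j. jet_matrix k (a i) (a j))) = pfaffian r (\<lambda>i j. point_matrix k x (a i) (a j))"
    unfolding hom(1) by simp
  then show ?thesis by (simp add: \<phi>_def fps_eq_iff)
qed

lemma mem_pfaffian_jet_variety:
  "x \<in> pfaffian_jet_variety n k r \<longleftrightarrow> x \<in> affine_space (jet_vars n k) \<and>
    (\<forall>a. strict_mono_on {1..2 * r} a \<longrightarrow> a ` {1..2 * r} \<subseteq> {1..n} \<longrightarrow>
      fps_X ^ k dvd pfaffian r (\<lambda>i j. point_matrix k x (a i) (a j)))"
proof -
  have "(\<forall>f\<in>{coeff p h | p h. p \<in> jet_pfaffians n k r \<and> h < k}. eval_mpoly x f = 0) \<longleftrightarrow>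
    (\<forall>a. strict_mono_on {1..2 * r} a \<longrightarrow> a ` {1..2 * r} \<subseteq> {1..n} \<longrightarrow>
      (\<forall>h<k. eval_mpoly x (coeff (pfaffian r (\<lambda>i j. jet_matrix k (a i) (a j))) h) = 0))"
    unfolding jet_pfaffians_def by blast
  then show ?thesis
    unfolding pfaffian_jet_variety_eq zero_locus_def fps_X_power_dvd_iff
    by (simp only: eval_coeff_pfaffian_jet_matrix mem_Collect_eq)
qed

lemma point_matrix_jet_point:
  fixes Y :: "nat \<Rightarrow> nat \<Rightarrow> 'a::comm_ring_1 fps"
  assumes "skew Y" "i \<in> {1..n}" "j \<in> {1..n}"
  shows "fps_X ^ k dvd point_matrix k (jet_point n k Y) i j - Y i j"
proof -
  have neg: "Y i j $ h = - (Y j i $ h)" for h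
  proof -
    have "Y i j = - Y j i" using assms(1) unfolding skew_def by blast
    then have "Y i j $ h = (- Y j i) $ h" by (rule arg_cong)
    then show ?thesis unfolding fps_neg_nth .
  qed
  have diag: "Y i i = 0" using assms(1) unfolding skew_def by blast
  have "(point_matrix k (jet_point n k Y) i j - Y i j) $ h = 0" if h: "h < k" for h
  proof (cases i j rule: linorder_cases)
    case less
    then show ?thesis using assms(2,3) h by (simp add: point_matrix_def jet_point_def jet_vars_def)
  next
    case equal
    then show ?thesis using diag by (simp add: point_matrix_def)
  next
    case greater
    then show ?thesis using assms(2,3) h neg[of h] by (simp add: point_matrix_def jet_point_def jet_vars_def)
  qed
  then show ?thesis unfolding fps_X_power_dvd_iff by blast
qed

lemma dvd_cong_diff: "c dvd a - b \<Longrightarrow> c dvd a \<longleftrightarrow> c dvd (b :: 'b::comm_ring_1)"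
  using dvd_add_right_iff[of c "a - b" b] by simp

text \<open>Pfaffians modulo \<open>t^k\<close> depend on the entries modulo \<open>t^k\<close>, so
  any skew lift to \<open>K[[t]]\<close> may replace the truncated matrix.\<close>

lemma jet_point_mem_variety:
  fixes Y :: "nat \<Rightarrow> nat \<Rightarrow> 'a::comm_ring_1 fps"
  assumes "skew Y"
  shows "jet_point n k Y \<in> pfaffian_jet_variety n k r \<longleftrightarrow>
    (\<forall>a. strict_mono_on {1..2 * r} a \<longrightarrow> a ` {1..2 * r} \<subseteq> {1..n} \<longrightarrow>
      fps_X ^ k dvd pfaffian r (\<lambda>i j. Y (a i) (a j)))"
proof -
  have "fps_X ^ k dvd pfaffian r (\<lambda>i j. point_matrix k (jet_point n k Y) (a i) (a j)) \<longleftrightarrow>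
      fps_X ^ k dvd pfaffian r (\<lambda>i j. Y (a i) (a j))" if a: "a ` {1..2 * r} \<subseteq> {1..n}" for a
  proof (rule dvd_cong_diff)
    show "fps_X ^ k dvd pfaffian r (\<lambda>i j. point_matrix k (jet_point n k Y) (a i) (a j)) -
        pfaffian r (\<lambda>i j. Y (a i) (a j))"
    proof (rule pfaffian_cong_dvd)
      fix i j assume "i \<in> {1..2*r}" "j \<in> {1..2*r}"
      then show "fps_X ^ k dvd point_matrix k (jet_point n k Y) (a i) (a j) - Y (a i) (a j)"
        using a by (intro point_matrix_jet_point[OF assms]) blast+
    qed
  qed
  then show ?thesis unfolding mem_pfaffian_jet_variety by (auto simp: jet_point_affine)
qed

text \<open>For empty \<open>W\<close> these are the jets of sums of \<open>m\<close> decomposable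
  matrices, the cone over a secant variety of a Grassmannian of planes. The coordinates in
  \<open>W\<close> receive arbitrary extra terms, so that growing \<open>W\<close> leads from these
  sums to larger sets that are still parametrised by \<open>u\<close>, \<open>v\<close>,
  \<open>w\<close>.\<close>

definition secant :: "nat \<Rightarrow> nat \<Rightarrow> nat \<Rightarrow> jet_var set \<Rightarrow> (jet_var \<Rightarrow> 'a::comm_ring_1) set" where
  "secant n k m W = {restrict (\<lambda>(i, j, h). (\<Sum>l<m. dec (u l) (v l) i j) $ h + w (i, j, h)) (jet_vars n k)
     | u v w. \<forall>x. x \<notin> W \<longrightarrow> w x = 0}"

lemma secantI: "jet_point n k (\<lambda>i j. \<Sum>l<m. dec (u l) (v l) i j) \<in> secant n k m W"
  unfolding secant_def jet_point_def by (rule CollectI, rule exI[of _ u], rule exI[of _ v], rule exI[of _ "\<lambda>_. 0"]) simp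

lemma secant_affine: "secant n k m W \<subseteq> affine_space (jet_vars n k)"
  by (auto simp: secant_def affine_space_def)

lemma secant_mono: "W \<subseteq> W' \<Longrightarrow> secant n k m W \<subseteq> secant n k m W'"
  unfolding secant_def by blast

text \<open>The version with terms numbered from 0: columns \<open>2l + 1\<close> and
  \<open>2l + 2\<close> of the determinant hold \<open>u l\<close> and \<open>v l\<close>.\<close>

lemma pfaffian_sum_dec_lessThan:
  fixes u v :: "nat \<Rightarrow> nat \<Rightarrow> 'b::comm_ring_1"
  shows "pfaffian r (\<lambda>a b. \<Sum>l<r. d l * dec (u l) (v l) a b) = (\<Prod>l<r. d l) *
    detf (2*r) (\<lambda>i j. if odd j then u ((j - 1) div 2) i else v (j div 2 - 1) i)"
proof -
  let ?U = "\<lambda>i j. if odd j then u ((j - 1) div 2) i else v (j div 2 - 1) i"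
  have "(\<Sum>l<r. d l * dec (u l) (v l) a b) =
      (\<Sum>l = 1..r. d (l - 1) * dec (\<lambda>i. ?U i (2*l - 1)) (\<lambda>i. ?U i (2*l)) a b)" for a b
    by (rule sum.reindex_bij_witness[of _ "\<lambda>l. l - 1" Suc]) auto
  moreover have "(\<Prod>l<r. d l) = (\<Prod>l = 1..r. d (l - 1))"
    by (rule prod.reindex_bij_witness[of _ "\<lambda>l. l - 1" Suc]) auto
  ultimately show ?thesis using pfaffian_sum_dec[of r "\<lambda>l. d (l - 1)" ?U] by simp
qed

text \<open>Padding the sum to \<open>r\<close> terms with zero coefficients makes the product of
  the coefficients zero.\<close>

lemma pfaffian_few_decs:
  fixes u v :: "nat \<Rightarrow> nat \<Rightarrow> 'b::comm_ring_1"
  assumes "m < r"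
  shows "pfaffian r (\<lambda>a b. \<Sum>l<m. dec (u l) (v l) a b) = 0"
proof -
  have "(\<Sum>l<m. dec (u l) (v l) a b) = (\<Sum>l<r. of_bool (l < m) * dec (u l) (v l) a b)" for a b
    using assms by (intro sum.mono_neutral_cong_left) auto
  moreover have "(\<Prod>l<r. of_bool (l < m) :: 'b) = 0"
    using assms by (intro prod_zero) (auto intro!: bexI[of _ m])
  ultimately show ?thesis using pfaffian_sum_dec_lessThan[of r "\<lambda>l. of_bool (l < m)" u v] by simp
qed

lemma secant_subset_variety:
  assumes "m < r"
  shows "secant n k m {} \<subseteq> (pfaffian_jet_variety n k r :: (jet_var \<Rightarrow> 'a::comm_ring_1) set)"
proof
  fix x :: "jet_var \<Rightarrow> 'a" assume "x \<in> secant n k m {}"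
  then obtain u v w where x: "x = restrict (\<lambda>(i, j, h). (\<Sum>l<m. dec (u l) (v l) i j) $ h + w (i, j, h)) (jet_vars n k)"
    and w: "\<And>x. w x = 0" unfolding secant_def by blast
  have x: "x = jet_point n k (\<lambda>i j. \<Sum>l<m. dec (u l) (v l) i j)"
    unfolding x jet_point_def by (simp add: w)
  have sk: "skew (\<lambda>i j. \<Sum>l<m. dec (u l) (v l) i j)" by (intro skew_sum skew_dec)
  show "x \<in> pfaffian_jet_variety n k r"
    unfolding x jet_point_mem_variety[OF sk]
  proof (intro allI impI)
    fix a :: "nat \<Rightarrow> nat"
    have "pfaffian r (\<lambda>i j. \<Sum>l<m. dec (u l) (v l) (a i) (a j)) =
      pfaffian r (\<lambda>i j. \<Sum>l<m. dec (u l \<circ> a) (v l \<circ> a) i j)" by (simp add: dec_def)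
    also have "\<dots> = 0" by (rule pfaffian_few_decs[OF assms])
    finally show "fps_X ^ k dvd pfaffian r (\<lambda>i j. \<Sum>l<m. dec (u l) (v l) (a i) (a j))" by simp
  qed
qed

text \<open>Two points are joined by the segment between their parameters \<open>u\<close>,
  \<open>v\<close>, \<open>w\<close>. Each coordinate is then quadratic in the segment parameter,
  because \<open>dec\<close> is bilinear.\<close>

lemma irreducible_zclosure_secant:
  assumes inf: "infinite (UNIV :: 'a::field set)"
  shows "irreducible_in (zariski (jet_vars n k)) (zclosure (jet_vars n k) (secant n k m W :: (jet_var \<Rightarrow> 'a) set))"
proof (rule irreducible_zclosure[OF inf _ secant_affine])
  show "(secant n k m W :: (jet_var \<Rightarrow> 'a) set) \<noteq> {}" using secantI by blast
  fix x y :: "jet_var \<Rightarrow> 'a" assume "x \<in> secant n k m W" "y \<in> secant n k m W"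
  then obtain u v w u' v' w'
    where x: "x = restrict (\<lambda>(i, j, h). (\<Sum>l<m. dec (u l) (v l) i j) $ h + w (i, j, h)) (jet_vars n k)"
      and w: "\<And>x. x \<notin> W \<Longrightarrow> w x = 0"
      and y: "y = restrict (\<lambda>(i, j, h). (\<Sum>l<m. dec (u' l) (v' l) i j) $ h + w' (i, j, h)) (jet_vars n k)"
      and w': "\<And>x. x \<notin> W \<Longrightarrow> w' x = 0" unfolding secant_def by blast
  define a where "a = (\<lambda>l i. u' l i - u l i)"
  define b where "b = (\<lambda>l i. v' l i - v l i)"
  define us where "us = (\<lambda>s l i. u l i + fps_const s * a l i)"
  define vs where "vs = (\<lambda>s l i. v l i + fps_const s * b l i)"
  define ws where "ws = (\<lambda>s z. w z + s * (w' z - w z))"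
  define c where "c = (\<lambda>s. restrict (\<lambda>(i, j, h). (\<Sum>l<m. dec (us s l) (vs s l) i j) $ h + ws s (i, j, h)) (jet_vars n k))"
  have dec: "dec (us s l) (vs s l) i j = dec (u l) (v l) i j + fps_const s * (dec (a l) (v l) i j + dec (u l) (b l) i j)
      + fps_const s * (fps_const s * dec (a l) (b l) i j)" for s l i j
    by (simp add: us_def vs_def dec_def algebra_simps)
  have "poly_curve c"
    unfolding poly_curve_def
  proof (intro exI allI)
    fix s z
    show "c s z = poly (if z \<in> jet_vars n k then (case z of (i, j, h) \<Rightarrow>
        [:(\<Sum>l<m. dec (u l) (v l) i j) $ h + w z, (\<Sum>l<m. dec (a l) (v l) i j + dec (u l) (b l) i j) $ h + (w' z - w z),
          (\<Sum>l<m. dec (a l) (b l) i j) $ h:]) else [:undefined:]) s"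
      by (cases z) (simp add: c_def ws_def dec sum.distrib sum_distrib_left[symmetric] distrib_left
          fps_mult_left_const_nth algebra_simps del: fps_sum_nth)
  qed
  moreover have "c 0 = x" unfolding c_def x us_def vs_def ws_def by simp
  moreover have "c 1 = y" unfolding c_def y us_def vs_def ws_def a_def b_def by simp
  moreover have "c s \<in> secant n k m W" for s
    unfolding secant_def c_def
    by (rule CollectI, rule exI[of _ "us s"], rule exI[of _ "vs s"], rule exI[of _ "ws s"])
      (simp add: ws_def w w')
  ultimately show "\<exists>c. poly_curve c \<and> c 0 = x \<and> c 1 = y \<and> (\<forall>s. c s \<in> secant n k m W)" by blast
qed

section \<open>The variety as a closure of a secant set\<close>

text \<open>The good parameters only have to be infinite in number and may leave out
  \<open>s = 0\<close>, the value at which the conclusion is read off.\<close>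

lemma secant_limit:
  fixes Y Z :: "nat \<Rightarrow> nat \<Rightarrow> 'a::field fps"
  assumes "infinite {s. jet_point n k (\<lambda>i j. Y i j + fps_const s * Z i j) \<in> zclosure (jet_vars n k) S}"
  shows "jet_point n k Y \<in> zclosure (jet_vars n k) S"
proof -
  let ?c = "\<lambda>s. jet_point n k (\<lambda>i j. Y i j + fps_const s * Z i j)"
  have "poly_curve ?c"
    unfolding poly_curve_def
  proof (intro exI allI)
    fix s z
    show "?c s z = poly (if z \<in> jet_vars n k then (case z of (i, j, h) \<Rightarrow> [:Y i j $ h, Z i j $ h:])
        else [:undefined:]) s"
      by (cases z) (simp add: jet_point_def)
  qed
  then have "?c 0 \<in> zclosure (jet_vars n k) S"
    using assms jet_point_affine by (rule zclosure_curve)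
  then show ?thesis by simp
qed

text \<open>
  For a scalar \<open>s \<noteq> 0\<close>, the terms \<open>d1 (e1 \<and> f1) + d2 (e2 \<and> f2) + s (e1 \<and> e2)\<close> are equal to
  \<open>(s e1 - d2 f2) \<and> (e2 + d1 f1 / s) - (d1 d2 / s) (f1 \<and> f2)\<close>. This merges two coefficients into
  their product, and letting \<open>s\<close> tend to \<open>0\<close> removes the perturbation.
\<close>

lemma merge_in_zclosure:
  fixes u v e f :: "nat \<Rightarrow> nat \<Rightarrow> 'a::field fps" and d :: "nat \<Rightarrow> 'a fps"
  assumes inf: "infinite (UNIV :: 'a set)" and dvd: "fps_X ^ k dvd (\<Prod>l<Suc m. d l)"
  shows "jet_point n k (\<lambda>i j. (\<Sum>l<q. dec (u l) (v l) i j) + (\<Sum>l<Suc m. d l * dec (e l) (f l) i j))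
    \<in> zclosure (jet_vars n k) (secant n k (q + m) {})"
  using dvd
\<comment> \<open>Each merge replaces two weighted terms by a plain one and a weighted one, so
  \<open>q\<close> grows by one as \<open>m\<close> drops by one.\<close>
proof (induction m arbitrary: q u v d e f)
  case 0
  \<comment> \<open>The one remaining coefficient is itself divisible by \<open>t^k\<close>, so its
    term vanishes in the jet.\<close>
  have "jet_point n k (\<lambda>i j. (\<Sum>l<q. dec (u l) (v l) i j) + (\<Sum>l<Suc 0. d l * dec (e l) (f l) i j))
      = jet_point n k (\<lambda>i j. \<Sum>l<q. dec (u l) (v l) i j)"
    using 0 by (intro jet_point_cong) simp
  also have "\<dots> \<in> zclosure (jet_vars n k) (secant n k (q + 0) {})"
    using subsetD[OF zclosure_superset[OF secant_affine] secantI] by simp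
  finally show ?case .
next
  case (Suc m)
  let ?Y = "\<lambda>i j. (\<Sum>l<q. dec (u l) (v l) i j) + (\<Sum>l<Suc (Suc m). d l * dec (e l) (f l) i j)"
  let ?Z = "dec (e m) (e (Suc m))"
  have "jet_point n k (\<lambda>i j. ?Y i j + fps_const s * ?Z i j)
      \<in> zclosure (jet_vars n k) (secant n k (q + Suc m) {})" if s: "s \<noteq> 0" for s
  proof -
    define c where "c = fps_const (inverse s)"
    have c: "fps_const s * c = 1" using s by (simp add: c_def)
    \<comment> \<open>Slot \<open>q\<close> takes the new plain term, and slot \<open>m\<close> the
      merged coefficient with the vectors \<open>f m\<close> and \<open>f (Suc m)\<close>. The
      product of the coefficients changes only by the factor \<open>- c\<close>.\<close>
    define u' where "u' = u(q := \<lambda>i. fps_const s * e m i - d (Suc m) * f (Suc m) i)"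
    define v' where "v' = v(q := \<lambda>i. e (Suc m) i + c * d m * f m i)"
    define d' where "d' = d(m := - (c * d m * d (Suc m)))"
    define e' where "e' = e(m := f m)"
    define f' where "f' = f(m := f (Suc m))"
    have "(\<Prod>l<Suc m. d' l) = (\<Prod>l<m. d l) * (- (c * d m * d (Suc m)))"
      by (simp add: d'_def)
    also have "\<dots> = - c * (\<Prod>l<Suc (Suc m). d l)" by (simp add: algebra_simps)
    also have "fps_X ^ k dvd \<dots>" using Suc.prems by (rule dvd_mult)
    finally have dvd': "fps_X ^ k dvd (\<Prod>l<Suc m. d' l)" .
    have "?Y i j + fps_const s * ?Z i j =
      (\<Sum>l<Suc q. dec (u' l) (v' l) i j) + (\<Sum>l<Suc m. d' l * dec (e' l) (f' l) i j)" for i j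
    proof -
      have 1: "(\<Sum>l<Suc q. dec (u' l) (v' l) i j) = (\<Sum>l<q. dec (u l) (v l) i j) +
          dec (\<lambda>i. fps_const s * e m i - d (Suc m) * f (Suc m) i) (\<lambda>i. e (Suc m) i + c * d m * f m i) i j"
        by (simp add: u'_def v'_def)
      have 2: "(\<Sum>l<Suc m. d' l * dec (e' l) (f' l) i j) = (\<Sum>l<m. d l * dec (e l) (f l) i j)
          - c * d m * d (Suc m) * dec (f m) (f (Suc m)) i j"
        by (simp add: d'_def e'_def f'_def)
      have 3: "dec (\<lambda>i. S * E1 i - D2 * F2 i) (\<lambda>i. E2 i + C * D1 * F1 i) i j - C * D1 * D2 * dec F1 F2 i j
         = S * dec E1 E2 i j + (S * C) * (D1 * dec E1 F1 i j) + D2 * dec E2 F2 i j"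
        for S C D1 D2 :: "'a fps" and E1 E2 F1 F2
        by (simp add: dec_def algebra_simps)
      show ?thesis
        unfolding 1 2 using 3[of "fps_const s" "e m" "d (Suc m)" "f (Suc m)" "e (Suc m)" c "d m" "f m"]
        unfolding c by (simp add: algebra_simps)
    qed
    then have "jet_point n k (\<lambda>i j. ?Y i j + fps_const s * ?Z i j) =
      jet_point n k (\<lambda>i j. (\<Sum>l<Suc q. dec (u' l) (v' l) i j) + (\<Sum>l<Suc m. d' l * dec (e' l) (f' l) i j))"
      by presburger
    also have "\<dots> \<in> zclosure (jet_vars n k) (secant n k (Suc q + m) {})"
      by (rule Suc.IH[OF dvd'])
    finally show ?thesis by simp
  qed
  then have "{s. s \<noteq> 0} \<subseteq> {s. jet_point n k (\<lambda>i j. ?Y i j + fps_const s * ?Z i j)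
      \<in> zclosure (jet_vars n k) (secant n k (q + Suc m) {})}" by blast
  moreover have "infinite {s :: 'a. s \<noteq> 0}"
    using inf infinite_remove[of UNIV "0 :: 'a"] by (simp add: Compl_eq_Diff_UNIV[symmetric] Collect_neg_eq)
  ultimately have "infinite {s. jet_point n k (\<lambda>i j. ?Y i j + fps_const s * ?Z i j)
      \<in> zclosure (jet_vars n k) (secant n k (q + Suc m) {})}"
    by (rule infinite_super)
  then show ?case by (rule secant_limit)
qed

text \<open>Columns \<open>2l - 1\<close> and \<open>2l\<close> of \<open>U\<close> are the vectors
  \<open>e_l\<close> and \<open>f_l\<close>. The rows listed by \<open>p\<close> form an upper
  unitriangular matrix, which records the minor \<open>\<plusminus>1\<close> in a form suited to
  induction; the support condition supplies its zeros in later pivot rows.\<close>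

definition normal_form ::
    "nat set \<Rightarrow> nat \<Rightarrow> (nat \<Rightarrow> nat \<Rightarrow> 'b::comm_ring_1) \<Rightarrow> (nat \<Rightarrow> 'b) \<Rightarrow> (nat \<Rightarrow> nat \<Rightarrow> 'b) \<Rightarrow> (nat \<Rightarrow> nat) \<Rightarrow> bool" where
  "normal_form I m Y d U p \<longleftrightarrow>
    (\<forall>i j. Y i j = (\<Sum>l = 1..m. d l * dec (\<lambda>i. U i (2*l - 1)) (\<lambda>i. U i (2*l)) i j)) \<and>
    inj_on p {1..2*m} \<and> p ` {1..2*m} \<subseteq> I \<and>
    (\<forall>i\<in>{1..2*m}. U (p i) i = 1) \<and> (\<forall>i\<in>{1..2*m}. \<forall>j\<in>{1..2*m}. j < i \<longrightarrow> U (p i) j = 0) \<and>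
    (\<forall>i j. i \<notin> I \<longrightarrow> U i j = 0)"

lemma normal_formD:
  assumes "normal_form I m Y d U p"
  shows "Y i j = (\<Sum>l = 1..m. d l * dec (\<lambda>i. U i (2*l - 1)) (\<lambda>i. U i (2*l)) i j)"
    and "inj_on p {1..2*m}" and "p ` {1..2*m} \<subseteq> I"
    and "i \<in> {1..2*m} \<Longrightarrow> U (p i) i = 1"
    and "i \<in> {1..2*m} \<Longrightarrow> j \<in> {1..2*m} \<Longrightarrow> j < i \<Longrightarrow> U (p i) j = 0"
    and "i \<notin> I \<Longrightarrow> U i j = 0"
  using assms unfolding normal_form_def by simp_all

text \<open>Skew Gaussian elimination: an entry of least order divides all others in
  \<open>K[[t]]\<close>, so subtracting one multiple of a wedge clears its two rows and columns. An
  odd index set shrinks to a single index, where a skew matrix is zero.\<close>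

lemma skew_normal_form:
  fixes Y :: "nat \<Rightarrow> nat \<Rightarrow> 'a::field fps"
  assumes "finite I" "card I = 2 * m + 1" "skew Y" "\<And>i j. i \<notin> I \<Longrightarrow> Y i j = 0"
  shows "\<exists>d U p. normal_form I m Y d U p"
  using assms
proof (induction m arbitrary: I Y)
  case 0
  then obtain a where "I = {a}" by (auto simp: card_1_singleton_iff)
  then have "Y i j = 0" for i j
    using 0(3,4) unfolding skew_def by (metis insertE singletonD minus_zero)
  then have "normal_form I 0 Y d (\<lambda>_ _. 0) p" for d p by (simp add: normal_form_def)
  then show ?case by blast
next
  case (Suc m)
  \<comment> \<open>The pivot data are stated so that they also cover the zero matrix, with
    \<open>d = 0\<close> and unit vectors.\<close>
  have "\<exists>d e f a b. a \<in> I \<and> b \<in> I \<and> a \<noteq> b \<and> e a = 1 \<and> e b = 0 \<and> f a = 0 \<and> f b = 1 \<and>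
    (\<forall>x. Y a x = d * f x) \<and> (\<forall>x. Y b x = - (d * f b * e x)) \<and>
    (\<forall>x. (\<forall>y. Y x y = 0) \<longrightarrow> x \<notin> {a, b} \<longrightarrow> e x = 0 \<and> f x = 0)"
  proof (cases "\<forall>x y. Y x y = 0")
    case True
    have "\<not> card I \<le> Suc 0" using Suc.prems by simp
    then obtain a b where "a \<in> I" "b \<in> I" "a \<noteq> b"
      using Suc.prems(1) by (auto simp: card_le_Suc0_iff_eq)
    then show ?thesis
      using True
      by (intro exI[of _ 0] exI[of _ "\<lambda>x. of_bool (x = a)"] exI[of _ "\<lambda>x. of_bool (x = b)"] exI[of _ a] exI[of _ b]) auto
  next
    case False
    define P where "P = (\<lambda>z :: nat \<times> nat. Y (fst z) (snd z) \<noteq> 0)"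
    have "\<exists>z. P z" using False by (auto simp: P_def)
    then obtain z where z: "P z" "\<And>w. P w \<Longrightarrow> subdegree (Y (fst z) (snd z)) \<le> subdegree (Y (fst w) (snd w))"
      using ex_has_least_nat[of P _ "\<lambda>z. subdegree (Y (fst z) (snd z))"] by blast
    obtain a b where ab: "z = (a, b)" by (cases z)
    define d where "d = Y a b"
    have d0: "d \<noteq> 0" using z(1) by (simp add: P_def ab d_def)
    have "d dvd Y x y" for x y
    proof (cases "Y x y = 0")
      case False
      then show ?thesis using d0 z(2)[of "(x, y)"] by (simp add: fps_dvd_iff P_def ab d_def)
    qed simp
    then obtain g where g: "\<And>x y. Y x y = d * g x y" unfolding dvd_def by metis
    have sk: "Y x y = - Y y x" "Y x x = 0" for x y using Suc.prems(3) unfolding skew_def by blast+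
    have g0: "g x y = 0 \<longleftrightarrow> Y x y = 0" for x y using d0 by (simp add: g)
    have gs: "g x y = - g y x" for x y
    proof -
      have "d * g x y = d * (- g y x)" using sk(1)[of x y] by (simp add: g)
      then show ?thesis using d0 by (simp only: mult_cancel_left) simp
    qed
    have gab: "g a b = 1"
    proof -
      have "d * g a b = d * 1" using g[of a b] by (simp add: d_def)
      then show ?thesis using d0 by (simp only: mult_cancel_left) simp
    qed
    have "a \<in> I" using Suc.prems(4)[of a b] d0 by (auto simp: d_def)
    moreover have "b \<in> I" using Suc.prems(4)[of b a] sk(1)[of a b] d0 by (auto simp: d_def)
    moreover have "a \<noteq> b" using sk(2)[of a] d0 by (auto simp: d_def)
    moreover have "g a a = 0" "g b b = 0" using g0[of a a] g0[of b b] sk(2)[of a] sk(2)[of b] by simp_all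
    moreover have "g x b = 0 \<and> g a x = 0" if "\<forall>y. Y x y = 0" for x
      using that g0[of x b] g0[of x a] gs[of a x] by simp
    moreover have "Y b x = - (d * g a b * g x b)" for x
      using g[of b x] gs[of b x] by (simp add: gab)
    ultimately show ?thesis
      using g gab
      by (intro exI[of _ d] exI[of _ "\<lambda>x. g x b"] exI[of _ "\<lambda>x. g a x"] exI[of _ a] exI[of _ b]) blast
  qed
  then obtain d0 e f a b where ab: "a \<in> I" "b \<in> I" "a \<noteq> b" and ef: "e a = 1" "e b = 0" "f a = 0" "f b = 1"
    and rows: "\<And>x. Y a x = d0 * f x" "\<And>x. Y b x = - (d0 * f b * e x)"
    and van: "\<And>x. (\<And>y. Y x y = 0) \<Longrightarrow> x \<notin> {a, b} \<Longrightarrow> e x = 0 \<and> f x = 0" by blast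
  define Y' where "Y' = (\<lambda>i j. Y i j - d0 * dec e f i j)"
  have out: "e i = 0" "f i = 0" if "i \<notin> I" for i
    using van[of i] Suc.prems(4)[OF that] that ab by auto
  have skY': "skew Y'" unfolding Y'_def by (intro skew_minus skew_scale skew_dec Suc.prems(3))
  have "Y' a x = 0" "Y' b x = 0" for x
    using rows[of x] ef by (simp_all add: Y'_def dec_def)
  moreover have "Y' i j = 0" if "i \<notin> I" for i j
    using out[OF that] Suc.prems(4)[OF that] by (simp add: Y'_def dec_def)
  ultimately have Y'0: "Y' i j = 0" if "i \<notin> I - {a, b}" for i j using that by blast
  have "finite (I - {a, b})" "card (I - {a, b}) = 2 * m + 1"
    using Suc.prems(1,2) ab by (auto simp: card_Diff_subset)
  from Suc.IH[OF this skY' Y'0] obtain d U p where nf: "normal_form (I - {a, b}) m Y' d U p" by blast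
  note IH = normal_formD[OF nf]
  \<comment> \<open>The new pair goes last: the earlier columns are supported on
    \<open>I - {a, b}\<close> and hence zero in the rows \<open>a\<close> and \<open>b\<close>, as
    unitriangularity requires.\<close>
  define d' where "d' = d(Suc m := d0)"
  define U' where "U' = (\<lambda>i j. if j = 2*m + 1 then e i else if j = 2*m + 2 then f i else U i j)"
  define p' where "p' = p(2*m + 1 := a, 2*m + 2 := b)"
  have S: "{1..2 * Suc m} = insert (2*m + 2) (insert (2*m + 1) {1..2*m})" by auto
  have p'p: "p' j = p j" if "j \<in> {1..2*m}" for j using that by (auto simp: p'_def)
  have p'ab: "p' (2*m + 1) = a" "p' (2*m + 2) = b" by (simp_all add: p'_def)
  have U'U: "U' i j = U i j" if "j \<in> {1..2*m}" for i j using that by (auto simp: U'_def)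
  have pne: "p j \<noteq> a" "p j \<noteq> b" if "j \<in> {1..2*m}" for j using IH(3) that by blast+
  have "Y i j = (\<Sum>l = 1..Suc m. d' l * dec (\<lambda>i. U' i (2*l - 1)) (\<lambda>i. U' i (2*l)) i j)" for i j
  proof -
    have "(\<Sum>l = 1..Suc m. d' l * dec (\<lambda>i. U' i (2*l - 1)) (\<lambda>i. U' i (2*l)) i j)
      = (\<Sum>l = 1..m. d' l * dec (\<lambda>i. U' i (2*l - 1)) (\<lambda>i. U' i (2*l)) i j) + d0 * dec e f i j"
      by (simp add: d'_def U'_def)
    also have "(\<Sum>l = 1..m. d' l * dec (\<lambda>i. U' i (2*l - 1)) (\<lambda>i. U' i (2*l)) i j) = Y' i j"
      unfolding IH(1)
    proof (rule sum.cong[OF refl])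
      fix l assume l: "l \<in> {1..m}"
      then have mem: "2*l - 1 \<in> {1..2*m}" "2*l \<in> {1..2*m}" by auto
      show "d' l * dec (\<lambda>i. U' i (2*l - 1)) (\<lambda>i. U' i (2*l)) i j = d l * dec (\<lambda>i. U i (2*l - 1)) (\<lambda>i. U i (2*l)) i j"
        unfolding U'U[OF mem(1)] U'U[OF mem(2)] using l by (simp add: d'_def)
    qed
    finally show ?thesis by (simp add: Y'_def)
  qed
  moreover have "inj_on p' {1..2 * Suc m}"
  proof -
    have "inj_on p' {1..2*m} \<longleftrightarrow> inj_on p {1..2*m}" by (rule inj_on_cong) (rule p'p)
    then have inj: "inj_on p' {1..2*m}" using IH(2) by simp
    have im: "p' ` {1..2*m} = p ` {1..2*m}" using p'p by (rule image_cong[OF refl])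
    then have "a \<notin> p' ` {1..2*m}" "b \<notin> p' ` {1..2*m}" using IH(3) by blast+
    then have "a \<notin> p' ` ({1..2*m} - {2*m + 1})" "b \<notin> p' ` (insert (2*m + 1) {1..2*m} - {2*m + 2})"
      using ab(3) p'ab(1) by auto
    with inj show ?thesis unfolding S inj_on_insert p'ab by blast
  qed
  moreover have "p' ` {1..2 * Suc m} \<subseteq> I"
    unfolding S using p'ab ab IH(3) p'p by auto
  moreover have "U' (p' i) i = 1" if "i \<in> {1..2 * Suc m}" for i
    using that IH(4)[of i] p'p[of i] U'U[of i] p'ab ef unfolding S by (auto simp: U'_def)
  moreover have "U' (p' i) j = 0" if "i \<in> {1..2 * Suc m}" "j \<in> {1..2 * Suc m}" "j < i" for i j
  proof (cases "i \<in> {1..2*m}")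
    case True
    then have "j \<in> {1..2*m}" using that by auto
    then show ?thesis using IH(5)[OF True _ that(3)] U'U p'p[OF True] by simp
  next
    case False
    then have i: "i = 2*m + 1 \<or> i = 2*m + 2" using that by auto
    show ?thesis
    proof (cases "j \<in> {1..2*m}")
      case True
      then show ?thesis using i IH(6)[of a j] IH(6)[of b j] U'U[OF True] p'ab by auto
    next
      case False
      then have "j = 2*m + 1" "i = 2*m + 2" using i that by auto
      then show ?thesis using p'ab ef by (simp add: U'_def)
    qed
  qed
  moreover have "U' i j = 0" if "i \<notin> I" for i j
    using out[OF that] IH(6)[of i j] that by (auto simp: U'_def)
  ultimately have "normal_form I (Suc m) Y d' U' p'" unfolding normal_form_def by blast
  then show ?case by blast
qed

text \<open>On the sorted pivot rows the pfaffian is \<open>\<plusminus>\<close> the product of the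
  coefficients. Hence \<open>t^k\<close> divides this product, and the merging argument applies with
  no plain terms at the start.\<close>

lemma variety_subset_zclosure_secant:
  assumes inf: "infinite (UNIV :: 'a::field set)" and r: "r > 0"
  shows "(pfaffian_jet_variety (2*r + 1) k r :: (jet_var \<Rightarrow> 'a) set) \<subseteq>
    zclosure (jet_vars (2*r + 1) k) (secant (2*r + 1) k (r - 1) {})"
proof
  let ?n = "2*r + 1"
  fix x :: "jet_var \<Rightarrow> 'a" assume x: "x \<in> pfaffian_jet_variety ?n k r"
  \<comment> \<open>Set to zero outside the index range, so that the support is the set of rows to
    be eliminated.\<close>
  define Y where "Y = (\<lambda>i j. if i \<in> {1..?n} \<and> j \<in> {1..?n} then point_matrix k x i j else 0)"
  have xY: "jet_point ?n k Y = x"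
    using x by (intro jet_point_point_matrix) (auto simp: Y_def mem_pfaffian_jet_variety)
  have skY: "skew Y" unfolding Y_def by (intro skew_restrict skew_point_matrix)
  have zero: "Y i j = 0" if "i \<notin> {1..?n}" for i j using that unfolding Y_def by (simp del: atLeastAtMost_iff)
  have "card {1..?n} = 2 * r + 1" by simp
  from skew_normal_form[OF finite_atLeastAtMost this skY zero] obtain d U p
    where nf: "normal_form {1..?n} r Y d U p" by blast
  note YU = normal_formD(1)[OF nf] and p = normal_formD(2,3)[OF nf] and U = normal_formD(4,5)[OF nf]
  obtain \<pi> where \<pi>: "\<pi> permutes {1..2*r}" "strict_mono_on {1..2*r} (p \<circ> \<pi>)"
    using exists_sorting_perm[OF p(1)] by blast
  have "(p \<circ> \<pi>) ` {1..2*r} \<subseteq> {1..?n}" using p(2) permutes_image[OF \<pi>(1)] by (metis image_comp)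
  then have "fps_X ^ k dvd pfaffian r (\<lambda>i j. Y ((p \<circ> \<pi>) i) ((p \<circ> \<pi>) j))"
    using x \<pi>(2) jet_point_mem_variety[OF skY, of ?n k r] unfolding xY by blast
  also have "pfaffian r (\<lambda>i j. Y ((p \<circ> \<pi>) i) ((p \<circ> \<pi>) j)) = (\<Prod>l = 1..r. d l) * detf (2*r) (\<lambda>i j. U ((p \<circ> \<pi>) i) j)"
    using pfaffian_sum_dec[of r d "\<lambda>i j. U ((p \<circ> \<pi>) i) j"] by (simp add: YU dec_def)
  \<comment> \<open>Sorting the pivots by \<open>\<pi>\<close> is undone by the row permutation in
    the unitriangularity criterion.\<close>
  also have "detf (2*r) (\<lambda>i j. U ((p \<circ> \<pi>) i) j) = of_int (sign (inv_into UNIV \<pi>))"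
    using permutes_inverses(1)[OF \<pi>(1)] U by (intro detf_unitriangular permutes_inv \<pi>(1)) simp_all
  finally have "fps_X ^ k dvd (\<Prod>l = 1..r. d l)"
    by (cases "inv_into UNIV \<pi>" rule: sign_cases) simp_all
  also have "(\<Prod>l = 1..r. d l) = (\<Prod>l<Suc (r - 1). d (Suc l))"
    using r by (intro prod.reindex_bij_witness[of _ Suc "\<lambda>l. l - 1"]) auto
  finally have dvd: "fps_X ^ k dvd (\<Prod>l<Suc (r - 1). d (Suc l))" .
  have "Y i j = (\<Sum>l<(0::nat). dec (undefined l) (undefined l) i j) +
      (\<Sum>l<Suc (r - 1). d (Suc l) * dec (\<lambda>i. U i (2 * Suc l - 1)) (\<lambda>i. U i (2 * Suc l)) i j)" for i j
    unfolding YU[of i j] lessThan_0 sum.empty add_0_left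
    using r by (intro sum.reindex_bij_witness[of _ Suc "\<lambda>l. l - 1"]) (auto simp del: mult_Suc_right)
  then have "x = jet_point ?n k (\<lambda>i j. (\<Sum>l<(0::nat). dec (undefined l) (undefined l) i j) +
      (\<Sum>l<Suc (r - 1). d (Suc l) * dec (\<lambda>i. U i (2 * Suc l - 1)) (\<lambda>i. U i (2 * Suc l)) i j))"
    unfolding xY[symmetric] by presburger
  also have "\<dots> \<in> zclosure (jet_vars ?n k) (secant ?n k (0 + (r - 1)) {})"
    by (rule merge_in_zclosure[OF inf dvd])
  finally show "x \<in> zclosure (jet_vars ?n k) (secant ?n k (r - 1) {})" by simp
qed

theorem variety_eq_zclosure_secant:
  assumes "infinite (UNIV :: 'a::field set)" and "r > 0"
  shows "(pfaffian_jet_variety (2*r + 1) k r :: (jet_var \<Rightarrow> 'a) set) =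
    zclosure (jet_vars (2*r + 1) k) (secant (2*r + 1) k (r - 1) {})"
proof
  have "secant (2*r + 1) k (r - 1) {} \<subseteq> (pfaffian_jet_variety (2*r + 1) k r :: (jet_var \<Rightarrow> 'a) set)"
    using assms(2) by (intro secant_subset_variety) simp
  then show "zclosure (jet_vars (2*r + 1) k) (secant (2*r + 1) k (r - 1) {}) \<subseteq>
      (pfaffian_jet_variety (2*r + 1) k r :: (jet_var \<Rightarrow> 'a) set)"
    unfolding pfaffian_jet_variety_eq by (rule zclosure_minimal) (rule jet_pfaffian_coeffs_in_carrier)
qed (rule variety_subset_zclosure_secant[OF assms])

section \<open>The codimension\<close>

text \<open>
  The coordinates of the last \<open>3 \<times> 3\<close> block, three for each order \<open>h\<close>, enumerated by descending \<open>h\<close>: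
  the pfaffian with rows \<open>1, \<dots>, 2r-2, a, b\<close> then shows that freeing the next coordinate
  enlarges the closure.
\<close>

definition last_pair :: "nat \<Rightarrow> nat \<Rightarrow> nat \<times> nat" where
  "last_pair r c = (if c = 0 then (2*r - 1, 2*r) else if c = 1 then (2*r - 1, 2*r + 1) else (2*r, 2*r + 1))"

definition last_var :: "nat \<Rightarrow> nat \<Rightarrow> nat \<Rightarrow> jet_var" where
  "last_var r k j = (fst (last_pair r (j mod 3)), snd (last_pair r (j mod 3)), k - 1 - j div 3)"

definition last_vars :: "nat \<Rightarrow> nat \<Rightarrow> nat \<Rightarrow> jet_var set" where
  "last_vars r k i = last_var r k ` {..<i}"

lemma last_pair_inj:
  assumes "r > 0" "last_pair r c = last_pair r c'" "c < 3" "c' < 3"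
  shows "c = c'"
proof -
  have "c = 0 \<or> c = 1 \<or> c = 2" "c' = 0 \<or> c' = 1 \<or> c' = 2" using assms(3,4) by auto
  then show ?thesis using assms(1,2) by (elim disjE) (simp_all add: last_pair_def)
qed

lemma last_vars_complete:
  assumes "(i, j, h) \<in> jet_vars (2*r + 1) k" "2*r - 1 \<le> i"
  shows "(i, j, h) \<in> last_vars r k (3 * k)"
proof -
  have h: "h < k" "i < j" "j \<le> 2*r + 1" "1 \<le> i" using assms(1) by (auto simp: jet_vars_def)
  obtain c where c: "c < 3" "last_pair r c = (i, j)"
  proof (cases "i = 2*r - 1")
    case True
    show thesis
    proof (cases "j = 2*r")
      case True
      then show thesis using \<open>i = 2*r - 1\<close> by (intro that[of 0]) (auto simp: last_pair_def)
    next
      case False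
      then show thesis using \<open>i = 2*r - 1\<close> h by (intro that[of 1]) (auto simp: last_pair_def)
    qed
  next
    case False
    then show thesis using h assms(2) by (intro that[of 2]) (auto simp: last_pair_def)
  qed
  define q where "q = 3 * (k - 1 - h) + c"
  have "q div 3 = k - 1 - h" "q mod 3 = c" using c(1) by (simp_all add: q_def)
  then have "last_var r k q = (i, j, h)" using c(2) h by (simp add: last_var_def)
  moreover have "q < 3 * k" using c(1) h by (simp add: q_def)
  ultimately show ?thesis unfolding last_vars_def by (metis imageI lessThan_iff)
qed

text \<open>Skew elimination of a generic matrix: after a small change the pivot is a unit, so one
  plain wedge removes each pivot pair. After \<open>r - 1\<close> pairs the remainder lives in the
  last 3 x 3 block, whose coordinates are all free.\<close>

lemma zclosure_secant_last_vars:
  assumes inf: "infinite (UNIV :: 'a::field set)" and r: "r > 0"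
  shows "zclosure (jet_vars (2*r + 1) k) (secant (2*r + 1) k (r - 1) (last_vars r k (3 * k))) =
    (affine_space (jet_vars (2*r + 1) k) :: (jet_var \<Rightarrow> 'a) set)"
proof -
  let ?n = "2*r + 1"
  let ?C = "zclosure (jet_vars ?n k) (secant ?n k (r - 1) (last_vars r k (3 * k))) :: (jet_var \<Rightarrow> 'a) set"
  \<comment> \<open>Here \<open>a\<close> pairs are split off and \<open>b\<close> are still to
    come; the remainder \<open>Y\<close> is already zero in the rows up to
    \<open>2a\<close>.\<close>
  have claim: "jet_point ?n k (\<lambda>i j. (\<Sum>l<a. dec (u l) (v l) i j) + Y i j) \<in> ?C"
    if "a + b = r - 1" "skew Y" "\<And>i j. i \<le> 2 * a \<Longrightarrow> Y i j = 0" for a b u v and Y :: "nat \<Rightarrow> nat \<Rightarrow> 'a fps"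
    using that
  proof (induction b arbitrary: a u v Y)
    case 0
    define w where "w = (\<lambda>(i, j, h). if (i, j, h) \<in> last_vars r k (3*k) then Y i j $ h else 0)"
    have "jet_point ?n k (\<lambda>i j. (\<Sum>l<a. dec (u l) (v l) i j) + Y i j) =
        restrict (\<lambda>(i, j, h). (\<Sum>l<r - 1. dec (u l) (v l) i j) $ h + w (i, j, h)) (jet_vars ?n k)"
      unfolding jet_point_def
    proof (rule restrict_ext)
      fix z assume z: "z \<in> jet_vars ?n k"
      obtain i j h where ijh: "z = (i, j, h)" by (cases z)
      have "w (i, j, h) = Y i j $ h"
      proof (cases "i \<le> 2 * a")
        case True
        then show ?thesis using 0(3)[OF True, of j] by (simp add: w_def)
      next
        case False
        then have "2*r - 1 \<le> i" using 0(1) by simp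
        then show ?thesis using last_vars_complete[of i j h r k] z by (simp add: w_def ijh)
      qed
      then show "(case z of (i, j, h) \<Rightarrow> ((\<Sum>l<a. dec (u l) (v l) i j) + Y i j) $ h) =
          (case z of (i, j, h) \<Rightarrow> (\<Sum>l<r - 1. dec (u l) (v l) i j) $ h + w (i, j, h))"
        using 0(1) by (simp add: ijh)
    qed
    also have "\<dots> \<in> secant ?n k (r - 1) (last_vars r k (3*k))"
      unfolding secant_def
      by (rule CollectI, rule exI[of _ u], rule exI[of _ v], rule exI[of _ w]) (auto simp: w_def)
    finally show ?case using zclosure_superset[OF secant_affine] by blast
  next
    case (Suc b)
    define p where "p = 2 * a + 1"
    define q where "q = 2 * a + 2"
    define Z where "Z = dec (\<lambda>i. of_bool (i = p)) (\<lambda>i. of_bool (i = q) :: 'a fps)"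
    let ?Y = "\<lambda>i j. (\<Sum>l<a. dec (u l) (v l) i j) + Y i j"
    have pq: "p \<noteq> q" by (simp add: p_def q_def)
    \<comment> \<open>The excluded parameter is the one at which the pivot loses its constant term
      and with it invertibility.\<close>
    have good: "jet_point ?n k (\<lambda>i j. ?Y i j + fps_const s * Z i j) \<in> ?C" if s: "s \<noteq> - (Y p q $ 0)" for s
    proof -
      define T where "T = (\<lambda>i j. Y i j + fps_const s * Z i j)"
      have skT: "skew T" unfolding T_def Z_def by (intro skew_add skew_scale skew_dec Suc.prems(2))
      have T0: "T i j = 0" if "i \<le> 2 * a" for i j
        using Suc.prems(3)[OF that] that by (simp add: T_def Z_def dec_def p_def q_def)
      have T1: "T i j = - T j i" "T i i = 0" for i j using skT unfolding skew_def by blast+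
      define d where "d = T p q"
      have "d $ 0 = Y p q $ 0 + s" using pq by (simp add: d_def T_def Z_def dec_def)
      then have "d $ 0 \<noteq> 0" using s by (metis add.commute eq_neg_iff_add_eq_0)
      then have "d dvd 1" by simp
      then obtain g where g: "d * g = 1" by (metis dvdE)
      \<comment> \<open>Chosen with \<open>f\<close> below so that their wedge agrees with
        \<open>T\<close> in the rows \<open>p\<close> and \<open>q\<close>.\<close>
      define e where "e = (\<lambda>x. - g * T q x)"
      define f where "f = (\<lambda>x. T p x)"
      define T' where "T' = (\<lambda>i j. T i j - dec e f i j)"
      have ep: "e p = 1" using g T1(1)[of q p] by (simp add: e_def d_def mult.commute)
      have eq: "e q = 0" using T1(2)[of q] by (simp add: e_def)
      have fp: "f p = 0" using T1(2)[of p] by (simp add: f_def)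
      have fq: "f q = d" by (simp add: f_def d_def)
      have skT': "skew T'" unfolding T'_def by (intro skew_minus skew_dec skT)
      have T'0: "T' i j = 0" if i: "i \<le> 2 * Suc a" for i j
      proof -
        consider "i \<le> 2 * a" | "i = p" | "i = q" using i by (auto simp: p_def q_def le_Suc_eq)
        then show ?thesis
        proof cases
          case 1
          then have "e i = 0" "f i = 0"
            using T0[OF 1] T1(1)[of q i] T1(1)[of p i] by (simp_all add: e_def f_def)
          then show ?thesis using T0[OF 1] by (simp add: T'_def dec_def)
        next
          case 2
          then show ?thesis by (simp add: T'_def dec_def ep fp) (simp add: f_def)
        next
          case 3
          have "e j * d = - (d * g) * T q j" by (simp add: e_def algebra_simps)
          then have "e j * d = - T q j" by (simp add: g)
          then show ?thesis using 3 by (simp add: T'_def dec_def eq fq)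
        qed
      qed
      have "?Y i j + fps_const s * Z i j =
          (\<Sum>l<Suc a. dec ((u(a := e)) l) ((v(a := f)) l) i j) + T' i j" for i j
        by (simp add: T'_def T_def)
      then have "jet_point ?n k (\<lambda>i j. ?Y i j + fps_const s * Z i j) =
          jet_point ?n k (\<lambda>i j. (\<Sum>l<Suc a. dec ((u(a := e)) l) ((v(a := f)) l) i j) + T' i j)"
        by presburger
      also have "\<dots> \<in> ?C" using Suc.prems(1) by (intro Suc.IH skT' T'0) simp_all
      finally show ?thesis .
    qed
    have "infinite (UNIV - {- (Y p q $ 0)})" using inf by (rule infinite_remove)
    moreover have "UNIV - {- (Y p q $ 0)} \<subseteq> {s. jet_point ?n k (\<lambda>i j. ?Y i j + fps_const s * Z i j) \<in> ?C}"
      using good by blast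
    ultimately have "infinite {s. jet_point ?n k (\<lambda>i j. ?Y i j + fps_const s * Z i j) \<in> ?C}"
      by (rule infinite_super[rotated])
    then show ?case by (rule secant_limit)
  qed
  have "x \<in> ?C" if x: "x \<in> affine_space (jet_vars ?n k)" for x :: "jet_var \<Rightarrow> 'a"
  proof -
    define Y where "Y = (\<lambda>i j. if i \<in> {1..?n} \<and> j \<in> {1..?n} then point_matrix k x i j else 0)"
    have "skew Y" unfolding Y_def by (intro skew_restrict skew_point_matrix)
    moreover have "Y i j = 0" if "i \<le> 2 * 0" for i j using that by (simp add: Y_def)
    ultimately have "jet_point ?n k (\<lambda>i j. (\<Sum>l<(0::nat). dec (undefined l) (undefined l) i j) + Y i j) \<in> ?C"
      by (intro claim[of 0 "r - 1"]) simp_all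
    moreover have "jet_point ?n k Y = x"
      using x by (intro jet_point_point_matrix) (auto simp: Y_def)
    ultimately show ?thesis by simp
  qed
  then show ?thesis using zclosure_affine by blast
qed

text \<open>A relation among the other coordinates does not see the freed ones, so it extends from
  sums of \<open>r - 1\<close> wedges to the enlarged set, whose closure is the whole space.\<close>

lemma coords_alg_indep_on_variety:
  assumes inf: "infinite (UNIV :: 'a::field set)" and r: "r > 0"
    and vs: "distinct vs" "set vs = jet_vars (2*r + 1) k - last_vars r k (3 * k)"
  shows "alg_indep_on (pfaffian_jet_variety (2*r + 1) k r :: (jet_var \<Rightarrow> 'a) set) (map mvar vs)"
  unfolding alg_indep_on_def
proof (intro allI impI)
  let ?V = "jet_vars (2*r + 1) k"
  fix s c e
  assume zero: "\<forall>x\<in>pfaffian_jet_variety (2*r + 1) k r. comb s (map mvar vs) c x = (0 :: 'a)"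
    and e: "length e = length (map (mvar :: _ \<Rightarrow> (_, 'a) mpoly) vs) \<and> set e \<subseteq> {..s}"
  have "set (map mvar vs) \<subseteq> (carrier (mpoly_ring ?V) :: (jet_var, 'a) mpoly set)"
    using vs(2) by (auto simp: mvar_def)
  then obtain p where p: "p \<in> carrier (mpoly_ring ?V)" "\<And>x. comb s (map mvar vs) c x = eval_mpoly x p"
    using polyfun_comb[of "map mvar vs" ?V s c] unfolding polyfun_def by blast
  have "eval_mpoly x p = 0" if "x \<in> secant (2*r + 1) k (r - 1) (last_vars r k (3*k))" for x
  proof -
    obtain u v w where x: "x = restrict (\<lambda>(i, j, h). (\<Sum>l<r - 1. dec (u l) (v l) i j) $ h + w (i, j, h)) ?V"
      and w: "\<And>z. z \<notin> last_vars r k (3*k) \<Longrightarrow> w z = 0" using \<open>x \<in> _\<close> unfolding secant_def by blast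
    define y where "y = jet_point (2*r + 1) k (\<lambda>i j. \<Sum>l<r - 1. dec (u l) (v l) i j)"
    have "y \<in> secant (2*r + 1) k (r - 1) {}" unfolding y_def by (rule secantI)
    moreover have "r - 1 < r" using r by simp
    ultimately have "y \<in> pfaffian_jet_variety (2*r + 1) k r" using secant_subset_variety by blast
    then have "comb s (map mvar vs) c y = 0" using zero by blast
    moreover have "comb s (map mvar vs) c x = comb s (map mvar vs) c y"
    proof (rule comb_coords_cong)
      fix z assume "z \<in> set vs"
      then have "z \<in> ?V" "w z = 0" using vs(2) w by auto
      then show "x z = y z" by (cases z) (simp add: x y_def jet_point_def)
    qed
    ultimately show ?thesis by (simp add: p(2))
  qed
  then have "eval_mpoly x p = 0" if "x \<in> affine_space ?V" for x
    using that p(1) zclosureD unfolding zclosure_secant_last_vars[OF inf r, symmetric] by blast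
  then have "\<forall>x\<in>affine_space ?V. comb s (map mvar vs) c x = 0" by (simp add: p(2))
  moreover have "alg_indep_on (affine_space ?V :: (jet_var \<Rightarrow> 'a) set) (map mvar vs)"
    using vs by (intro alg_indep_on_coords[OF inf]) auto
  ultimately show "c e = 0" using e unfolding alg_indep_on_def by blast
qed

text \<open>The separating function is the coefficient of \<open>t^h\<close> in the pfaffian, where
  \<open>(a, b, h)\<close> is the coordinate freed next. It involves only orders up to
  \<open>h\<close>, while the coordinates of the entry \<open>(a, b)\<close> freed before have
  larger order. On the smaller set it therefore sees just \<open>r - 1\<close> wedges and
  vanishes.\<close>

lemma zclosure_secant_strict:
  assumes inf: "infinite (UNIV :: 'a::field set)" and r: "r > 0" and i: "i < 3 * k"
  shows "zclosure (jet_vars (2*r + 1) k) (secant (2*r + 1) k (r - 1) (last_vars r k i)) \<subset>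
    (zclosure (jet_vars (2*r + 1) k) (secant (2*r + 1) k (r - 1) (last_vars r k (Suc i))) :: (jet_var \<Rightarrow> 'a) set)"
proof -
  let ?n = "2*r + 1"
  let ?V = "jet_vars ?n k"
  obtain a b where ab: "last_pair r (i mod 3) = (a, b)" by (cases "last_pair r (i mod 3)")
  define h where "h = k - 1 - i div 3"
  have lv: "last_var r k i = (a, b, h)" by (simp add: last_var_def ab h_def)
  have hk: "h < k" "i div 3 < k" using i by (auto simp: h_def)
  have ab': "2*r - 1 \<le> a" "a < b" "b \<le> 2*r + 1" "1 \<le> a"
    using ab r by (auto simp: last_pair_def split: if_splits)
  define \<alpha> where "\<alpha> = (\<lambda>j. if j \<le> 2*r - 2 then j else if j = 2*r - 1 then a else b)"
  have \<alpha>mono: "strict_mono_on {1..2*r} \<alpha>"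
    using ab' by (intro strict_mono_onI) (auto simp: \<alpha>_def)
  have \<alpha>mem: "\<alpha> j \<in> {1..?n}" if "j \<in> {1..2*r}" for j using ab' that by (auto simp: \<alpha>_def)
  define p where "p = coeff (pfaffian r (\<lambda>i j. jet_matrix k (\<alpha> i) (\<alpha> j)) :: (jet_var, 'a) mpoly poly) h"
  have "pfaffian r (\<lambda>i j. jet_matrix k (\<alpha> i) (\<alpha> j)) \<in> (jet_pfaffians ?n k r :: (jet_var, 'a) mpoly poly set)"
    unfolding jet_pfaffians_def using \<alpha>mono \<alpha>mem by blast
  then have pc: "p \<in> carrier (mpoly_ring ?V)"
    unfolding p_def using jet_pfaffian_coeffs_in_carrier[of ?n k r] hk(1) by blast
  have eval: "eval_mpoly x p = pfaffian r (\<lambda>i j. Y (\<alpha> i) (\<alpha> j)) $ h"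
    if sk: "skew Y" and eq: "\<And>i j h'. i \<in> \<alpha> ` {1..2*r} \<Longrightarrow> j \<in> \<alpha> ` {1..2*r} \<Longrightarrow> i < j \<Longrightarrow> h' \<le> h \<Longrightarrow> x (i, j, h') = Y i j $ h'"
    for x and Y :: "nat \<Rightarrow> nat \<Rightarrow> 'a fps"
  proof -
    \<comment> \<open>Working modulo \<open>t^(h + 1)\<close> keeps exactly the orders that the
      coefficient of \<open>t^h\<close> can see.\<close>
    have "fps_X ^ Suc h dvd pfaffian r (\<lambda>i j. point_matrix k x (\<alpha> i) (\<alpha> j)) - pfaffian r (\<lambda>i j. Y (\<alpha> i) (\<alpha> j))"
    proof (rule pfaffian_cong_dvd)
      fix i j assume ij: "i \<in> {1..2*r}" "j \<in> {1..2*r}"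
      have lt: "fps_X ^ Suc h dvd point_matrix k x (\<alpha> i) (\<alpha> j) - Y (\<alpha> i) (\<alpha> j)"
        if "\<alpha> i < \<alpha> j" "i \<in> {1..2*r}" "j \<in> {1..2*r}" for i j
        unfolding fps_X_power_dvd_iff
        using eq[of "\<alpha> i" "\<alpha> j"] that hk(1) by (simp add: point_matrix_def)
      have sk': "Y (\<alpha> i) (\<alpha> j) = - Y (\<alpha> j) (\<alpha> i)" "Y (\<alpha> i) (\<alpha> i) = 0" using sk unfolding skew_def by blast+
      have sk'': "point_matrix k x (\<alpha> i) (\<alpha> j) = - point_matrix k x (\<alpha> j) (\<alpha> i)" "point_matrix k x (\<alpha> i) (\<alpha> i) = 0"
        using skew_point_matrix[of k x] unfolding skew_def by blast+
      show "fps_X ^ Suc h dvd point_matrix k x (\<alpha> i) (\<alpha> j) - Y (\<alpha> i) (\<alpha> j)"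
      proof (cases "\<alpha> i" "\<alpha> j" rule: linorder_cases)
        case less
        then show ?thesis using lt ij by blast
      next
        case equal
        then show ?thesis using sk'(2) sk''(2) by simp
      next
        case greater
        have "point_matrix k x (\<alpha> i) (\<alpha> j) - Y (\<alpha> i) (\<alpha> j) = - (point_matrix k x (\<alpha> j) (\<alpha> i) - Y (\<alpha> j) (\<alpha> i))"
          unfolding sk'(1) sk''(1) by simp
        then show ?thesis using lt[OF greater ij(2,1)] by (simp only: dvd_minus_iff)
      qed
    qed
    then show ?thesis
      unfolding p_def eval_coeff_pfaffian_jet_matrix fps_X_power_dvd_iff by simp
  qed
  have vanish: "eval_mpoly x p = 0" if "x \<in> secant ?n k (r - 1) (last_vars r k i)" for x
  proof -
    obtain u v w where x: "x = restrict (\<lambda>(i, j, h). (\<Sum>l<r - 1. dec (u l) (v l) i j) $ h + w (i, j, h)) ?V"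
      and w: "\<And>z. z \<notin> last_vars r k i \<Longrightarrow> w z = 0" using \<open>x \<in> _\<close> unfolding secant_def by blast
    define Y where "Y = (\<lambda>i j. \<Sum>l<r - 1. dec (u l) (v l) i j)"
    have "skew Y" unfolding Y_def by (intro skew_sum skew_dec)
    then have "eval_mpoly x p = pfaffian r (\<lambda>i j. Y (\<alpha> i) (\<alpha> j)) $ h"
    proof (rule eval)
      fix i' j' h' assume ij: "i' \<in> \<alpha> ` {1..2*r}" "j' \<in> \<alpha> ` {1..2*r}" "i' < j'" "h' \<le> h"
      have "(i', j', h') \<notin> last_vars r k i"
      proof
        assume "(i', j', h') \<in> last_vars r k i"
        then obtain q where q: "q < i" "last_pair r (q mod 3) = (i', j')" "h' = k - 1 - q div 3"
          by (auto simp: last_vars_def last_var_def prod_eq_iff)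
        have "2*r - 1 \<le> i'" "2*r - 1 < j'"
          using q(2) r by (auto simp: last_pair_def split: if_splits)
        \<comment> \<open>Among the rows chosen by \<open>\<alpha>\<close> only \<open>a\<close> and
          \<open>b\<close> lie in the last block, so a freed coordinate met here belongs to the
          entry \<open>(a, b)\<close>.\<close>
        then have "i' \<in> {a, b}" "j' \<in> {a, b}" using ij(1,2) by (auto simp: \<alpha>_def split: if_splits)
        then have "i' = a" "j' = b" using ij(3) ab'(2) by auto
        then have "last_pair r (q mod 3) = last_pair r (i mod 3)" using q(2) ab by simp
        then have "q mod 3 = i mod 3"
          using last_pair_inj[OF r] by simp
        then have "q div 3 < i div 3" using q(1) by (metis div_le_mono div_mult_mod_eq le_neq_implies_less less_imp_le less_irrefl)
        moreover have "\<not> k - 1 - x \<le> k - 1 - y" if "x < y" "y < k" for x y :: nat using that by linarith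
        ultimately show False using q(3) ij(4) hk(2) unfolding h_def by blast
      qed
      then have "w (i', j', h') = 0" by (rule w)
      moreover have "(i', j', h') \<in> ?V" using ij \<alpha>mem hk(1) by (auto simp: jet_vars_def)
      ultimately show "x (i', j', h') = Y i' j' $ h'" by (simp add: x Y_def)
    qed
    also have "pfaffian r (\<lambda>i j. Y (\<alpha> i) (\<alpha> j)) = pfaffian r (\<lambda>i j. \<Sum>l<r - 1. dec (u l \<circ> \<alpha>) (v l \<circ> \<alpha>) i j)"
      by (simp add: Y_def dec_def)
    also have "\<dots> = 0" using r by (intro pfaffian_few_decs) simp
    finally show ?thesis by simp
  qed
  \<comment> \<open>A point with pfaffian \<open>t^h\<close>: wedges of unit vectors on the row
    pairs up to \<open>2r - 2\<close>, and the newly freed coordinate, set to 1, in place of a wedge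
    on \<open>a\<close> and \<open>b\<close>.\<close>
  define E where "E = (\<lambda>(m :: nat) i. of_bool (i = m) :: 'a fps)"
  define u where "u = (\<lambda>l. E (\<alpha> (2*l + 1)))"
  define v where "v = (\<lambda>l. E (\<alpha> (2*l + 2)))"
  define d where "d = (\<lambda>l. if l < r - 1 then 1 else fps_X ^ h :: 'a fps)"
  define Y where "Y = (\<lambda>i j. \<Sum>l<r. d l * dec (u l) (v l) i j)"
  have Ysplit: "Y i j = (\<Sum>l<r - 1. dec (u l) (v l) i j) + fps_X ^ h * dec (E a) (E b) i j" for i j
  proof -
    have "Y i j = (\<Sum>l<Suc (r - 1). d l * dec (u l) (v l) i j)" using r by (simp add: Y_def)
    also have "\<dots> = (\<Sum>l<r - 1. dec (u l) (v l) i j) + fps_X ^ h * dec (u (r - 1)) (v (r - 1)) i j"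
      by (simp add: d_def)
    also have "u (r - 1) = E a" using r by (auto simp: u_def \<alpha>_def)
    also have "v (r - 1) = E b" using r by (auto simp: v_def \<alpha>_def)
    finally show ?thesis .
  qed
  have skY: "skew Y" unfolding Y_def by (intro skew_sum skew_scale skew_dec)
  define w where "w = (\<lambda>z. of_bool (z = (a, b, h)) :: 'a)"
  define x where "x = restrict (\<lambda>(i, j, h). (\<Sum>l<r - 1. dec (u l) (v l) i j) $ h + w (i, j, h)) ?V"
  have "(a, b, h) \<in> last_vars r k (Suc i)" unfolding last_vars_def lv[symmetric] by simp
  then have "x \<in> secant ?n k (r - 1) (last_vars r k (Suc i))"
    unfolding secant_def x_def
    by (intro CollectI exI[of _ u] exI[of _ v] exI[of _ w]) (auto simp: w_def)
  then have xmem: "x \<in> zclosure ?V (secant ?n k (r - 1) (last_vars r k (Suc i)))"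
    using zclosure_superset[OF secant_affine] by blast
  have "eval_mpoly x p = pfaffian r (\<lambda>i j. Y (\<alpha> i) (\<alpha> j)) $ h"
    using skY
  proof (rule eval)
    fix i' j' h' assume ij: "i' \<in> \<alpha> ` {1..2*r}" "j' \<in> \<alpha> ` {1..2*r}" "i' < j'" "h' \<le> h"
    have V: "(i', j', h') \<in> ?V" using ij \<alpha>mem hk(1) by (auto simp: jet_vars_def)
    have "(fps_X ^ h * dec (E a) (E b) i' j') $ h' = w (i', j', h')"
    proof -
      have "dec (E a) (E b) i' j' = of_bool (i' = a \<and> j' = b)"
        using ij(3) ab'(2) by (auto simp: dec_def E_def)
      then show ?thesis using ij(4) by (auto simp: w_def fps_X_power_iff)
    qed
    with V show "x (i', j', h') = Y i' j' $ h'" by (simp add: x_def Ysplit)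
  qed
  also have "pfaffian r (\<lambda>i j. Y (\<alpha> i) (\<alpha> j)) = pfaffian r (\<lambda>i j. \<Sum>l<r. d l * dec (u l \<circ> \<alpha>) (v l \<circ> \<alpha>) i j)"
    by (simp add: Y_def dec_def)
  also have "\<dots> = (\<Prod>l<r. d l) * detf (2*r) (\<lambda>i j. if odd j then (u ((j - 1) div 2) \<circ> \<alpha>) i else (v (j div 2 - 1) \<circ> \<alpha>) i)"
    by (rule pfaffian_sum_dec_lessThan)
  also have "detf (2*r) (\<lambda>i j. if odd j then (u ((j - 1) div 2) \<circ> \<alpha>) i else (v (j div 2 - 1) \<circ> \<alpha>) i) =
      of_int (sign (id :: nat \<Rightarrow> nat))"
  proof (rule detf_unitriangular[OF permutes_id])
    \<comment> \<open>On the rows selected by \<open>\<alpha>\<close> the unit vectors form the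
      identity matrix.\<close>
    have U: "(if odd j then (u ((j - 1) div 2) \<circ> \<alpha>) i else (v (j div 2 - 1) \<circ> \<alpha>) i) = of_bool (\<alpha> i = \<alpha> j)"
      if "j \<in> {1..2*r}" for i j
    proof (cases "odd j")
      case True
      then have "2 * ((j - 1) div 2) + 1 = j" by presburger
      with True show ?thesis by (simp add: u_def E_def)
    next
      case False
      then have "2 * (j div 2 - 1) + 2 = j" using that by auto
      with False show ?thesis by (simp add: v_def E_def)
    qed
    fix i j assume i: "i \<in> {1..2*r}"
    show "(if odd i then (u ((i - 1) div 2) \<circ> \<alpha>) (id i) else (v (i div 2 - 1) \<circ> \<alpha>) (id i)) = 1"
      unfolding U[OF i] by simp
    assume j: "j \<in> {1..2*r}" "j < i"
    then have "\<alpha> j < \<alpha> i" using strict_mono_onD[OF \<alpha>mono] i by blast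
    then show "(if odd j then (u ((j - 1) div 2) \<circ> \<alpha>) (id i) else (v (j div 2 - 1) \<circ> \<alpha>) (id i)) = 0"
      unfolding U[OF j(1)] by simp
  qed
  also have "(\<Prod>l<r. d l) = (\<Prod>l<Suc (r - 1). d l)" using r by simp
  also have "\<dots> = fps_X ^ h" by (simp add: d_def)
  finally have "eval_mpoly x p = 1" by simp
  then have "x \<notin> zclosure ?V (secant ?n k (r - 1) (last_vars r k i))"
    using zclosureD[OF _ pc vanish] by (metis zero_neq_one)
  moreover have "zclosure ?V (secant ?n k (r - 1) (last_vars r k i)) \<subseteq>
      (zclosure ?V (secant ?n k (r - 1) (last_vars r k (Suc i))) :: (jet_var \<Rightarrow> 'a) set)"
  proof (rule zclosure_mono)
    have "last_vars r k i \<subseteq> last_vars r k (Suc i)" by (auto simp: last_vars_def)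
    then show "secant ?n k (r - 1) (last_vars r k i) \<subseteq>
        (zclosure ?V (secant ?n k (r - 1) (last_vars r k (Suc i))) :: (jet_var \<Rightarrow> 'a) set)"
      using secant_mono zclosure_superset[OF secant_affine] by (meson subset_trans)
  qed
  ultimately show ?thesis using xmem by blast
qed

lemma finite_jet_vars: "finite (jet_vars n k)"
  by (rule finite_subset[of _ "{..n} \<times> {..n} \<times> {..<k}"]) (auto simp: jet_vars_def)

text \<open>At least \<open>card V - 3k\<close> coordinates, with \<open>V\<close> the set of all of
  them, are independent on the variety. A chain of length \<open>d\<close> adds \<open>d\<close>
  functions, and no more than \<open>card V\<close> can be independent on its last member.\<close>

lemma codim_variety_le:
  assumes inf: "infinite (UNIV :: 'a::field set)" and r: "r > 0"
    and Z0: "Z 0 = (pfaffian_jet_variety (2*r + 1) k r :: (jet_var \<Rightarrow> 'a) set)"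
    and irr: "\<And>i. i \<le> d \<Longrightarrow> closedin (zariski (jet_vars (2*r + 1) k)) (Z i) \<and>
        irreducible_in (zariski (jet_vars (2*r + 1) k)) (Z i)"
    and strict: "\<And>i. i < d \<Longrightarrow> Z i \<subset> Z (Suc i)"
  shows "d \<le> 3 * k"
proof -
  let ?V = "jet_vars (2*r + 1) k"
  obtain vs where vs: "set vs = ?V - last_vars r k (3 * k)" "distinct vs"
    using finite_distinct_list[of "?V - last_vars r k (3 * k)"] finite_jet_vars by blast
  have carr: "set (map mvar vs) \<subseteq> (carrier (mpoly_ring ?V) :: (jet_var, 'a) mpoly set)"
    using vs(1) by (auto simp: mvar_def)
  have "alg_indep_on (Z 0) (map mvar vs)"
    unfolding Z0 by (rule coords_alg_indep_on_variety[OF inf r vs(2,1)])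
  from alg_indep_on_chain[OF irr strict this carr] obtain hs
    where hs: "length hs = length vs + d" "set hs \<subseteq> carrier (mpoly_ring ?V)" "alg_indep_on (Z d) hs"
    by auto
  have "length hs \<le> card ?V" by (rule alg_indep_on_length_le[OF finite_jet_vars hs(2,3)])
  moreover have "length vs = card (?V - last_vars r k (3 * k))" using vs distinct_card by metis
  moreover have "card ?V \<le> card (?V - last_vars r k (3 * k)) + card (last_vars r k (3 * k))"
    using finite_jet_vars diff_card_le_card_Diff[of "last_vars r k (3 * k)" ?V]
    by (simp add: last_vars_def)
  moreover have "card (last_vars r k (3 * k)) \<le> 3 * k"
    unfolding last_vars_def using card_image_le[of "{..<3*k}" "last_var r k"] by simp
  ultimately show ?thesis using hs(1) by linarith
qed

theorem theorem3p6:
  fixes r k :: nat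
  assumes "r > 0" and "k > 0"
  shows "irreducible_in (zariski (jet_vars (2 * r + 1) k))
           (pfaffian_jet_variety (2 * r + 1) k r :: (jet_var \<Rightarrow> 'a::alg_closed_field) set) \<and>
         codim_in (zariski (jet_vars (2 * r + 1) k))
           (pfaffian_jet_variety (2 * r + 1) k r :: (jet_var \<Rightarrow> 'a) set) = enat (3 * k)"
proof
  let ?T = "zariski (jet_vars (2 * r + 1) k) :: (jet_var \<Rightarrow> 'a) topology"
  let ?P = "pfaffian_jet_variety (2 * r + 1) k r :: (jet_var \<Rightarrow> 'a) set"
  note inf = infinite_alg_closed[where 'a = 'a]
  note P = variety_eq_zclosure_secant[OF inf \<open>r > 0\<close>]
  show "irreducible_in ?T ?P" unfolding P by (rule irreducible_zclosure_secant[OF inf])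
  define Z where "Z = (\<lambda>i. zclosure (jet_vars (2*r + 1) k)
      (secant (2*r + 1) k (r - 1) (last_vars r k i)) :: (jet_var \<Rightarrow> 'a) set)"
  have "Z 0 = ?P" unfolding Z_def P last_vars_def lessThan_0 image_empty ..
  moreover have "closedin ?T (Z i) \<and> irreducible_in ?T (Z i)" for i
    unfolding Z_def using closedin_zclosure irreducible_zclosure_secant[OF inf] by blast
  moreover have "Z i \<subset> Z (Suc i)" if "i < 3 * k" for i
    unfolding Z_def by (rule zclosure_secant_strict[OF inf \<open>r > 0\<close> that])
  ultimately have "\<exists>Z. Z 0 = ?P \<and> (\<forall>i\<le>3 * k. closedin ?T (Z i) \<and> irreducible_in ?T (Z i)) \<and>
      (\<forall>i<3 * k. Z i \<subset> Z (Suc i))" by blast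
  then have "enat (3 * k) \<le> codim_in ?T ?P"
    unfolding codim_in_def by (intro Sup_upper) blast
  moreover have "codim_in ?T ?P \<le> enat (3 * k)"
    unfolding codim_in_def
  proof (rule Sup_least)
    fix m assume "m \<in> {enat d |d. \<exists>Z. Z 0 = ?P \<and> (\<forall>i\<le>d. closedin ?T (Z i) \<and> irreducible_in ?T (Z i)) \<and>
        (\<forall>i<d. Z i \<subset> Z (Suc i))}"
    then obtain d Z where d: "m = enat d" "Z 0 = ?P"
      "\<And>i. i \<le> d \<Longrightarrow> closedin ?T (Z i) \<and> irreducible_in ?T (Z i)" "\<And>i. i < d \<Longrightarrow> Z i \<subset> Z (Suc i)" by blast
    have "d \<le> 3 * k" using codim_variety_le[OF inf \<open>r > 0\<close> d(2,3,4)] by blast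
    then show "m \<le> enat (3 * k)" by (simp add: d(1))
  qed
  ultimately show "codim_in ?T ?P = enat (3 * k)" by (rule antisym[rotated])
qed

end
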